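(* Let $K$ be an algebraically closed field of characteristic zero and let $P$ be a pure homogeneous polynomial functor over $K$. Then there exist tensors $p,r\in P_\infty$ whose $\mathrm{GL}_\infty$-orbits are dense in $P_\infty$ such that $p\preceq q\preceq r$ for all $q\in P_\infty$ whose $\mathrm{GL}_\infty$-orbit is dense in $P_\infty$.
   Context: $\mathbf{Vec}$ is the category of finite-dimensional $K$-vector spaces with $K$-linear maps. A polynomial functor over $K$ is a functor $P\colon\mathbf{Vec}\to\mathbf{Vec}$ for which there is an integer $d$ such that for all $U,V$ the map $P\colon\operatorname{Hom}(U,V)\to\operatorname{Hom}(P(U),P(V))$ is a polynomial map of degree $\leq d$. It is homogeneous of degree $d$ if $P(t\,\mathrm{id}_V)=t^d\,\mathrm{id}_{P(V)}$ for all $V$ and $t\in K$, and pure if $P(\{0\})=\{0\}$. $P_\infty:=\varprojlim_n P(K^n)$ along the maps $P(\pi_n)\colon P(K^{n+1})\to P(K^n)$, where $\pi_n\colon K^{n+1}\to K^n$ forgets the last coordinate. It carries the inverse limit of the Zariski topologies on the $P(K^n)$. The group $\mathrm{GL}_\infty=\bigcup_n\mathrm{GL}_n$, with $\mathrm{GL}_n\hookrightarrow\mathrm{GL}_{n+1}$ via $g\mapsto\operatorname{diag}(g,1)$, acts on $P_\infty$ (the projections $P(K^{n+1})\to P(K^n)$ being $\mathrm{GL}_n$-equivariant). $E\supset\mathrm{GL}_\infty$ is the monoid of $\mathbb N\times\mathbb N$ matrices over $K$ in which each row has only finitely many nonzero entries. It acts on $P_\infty$: for $\phi\in E$ and $p=(p_0,p_1,\ldots)\in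 P_\infty$ with $p_i\in P(K^i)$, $P(\phi)p=(q_0,q_1,\ldots)$ where $q_i:=P(\psi_i)p_{n_i}$, $n_i$ is any integer such that all nonzero entries of the first $i$ rows of $\phi$ lie in the first $n_i$ columns, and $\psi_i$ is the upper-left $i\times n_i$ block of $\phi$ (this is independent of the choice of $n_i$). For $p,q\in P_\infty$ write $p\preceq q$ if $p=P(\phi)q$ for some $\phi\in E$. *)

theory Defs
  imports
    "Jordan_Normal_Form.VS_Connect"
    "HOL-Analysis.Function_Topology"
begin

section \<open>The category of finite-dimensional vector spaces\<close>

text \<open>
  The field is the type \<open>'a\<close>, which \<open>class_ring\<close> turns into a ring structure. A vector space is
  a \<open>module\<close> record whose carrier is a set of elements of an arbitrary type \<open>'v\<close>. For
  \<open>'v = 'a vec\<close> the standard spaces \<open>K\<^sup>n\<close> are among these records, so every finite-dimensional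
  space is represented up to isomorphism.
\<close>

definition fd_space :: "('a::field, 'v) module \<Rightarrow> bool" where
  "fd_space V \<longleftrightarrow> vectorspace class_ring V \<and> vectorspace.fin_dim class_ring V"

text \<open>Linear maps are made extensional, so that equality of morphisms is equality on the carrier.\<close>

definition Hom :: "('a::field, 'v) module \<Rightarrow> ('a, 'w) module \<Rightarrow> ('v \<Rightarrow> 'w) set" where
  "Hom V W = LinearCombinations.module_hom class_ring V W \<inter> extensional (carrier V)"

definition Hom_space :: "('a::field, 'v) module \<Rightarrow> ('a, 'w) module \<Rightarrow> ('a, 'v \<Rightarrow> 'w) module" where
  "Hom_space V W =
    \<lparr>carrier = Hom V W, mult = undefined, one = undefined,
     zero = (\<lambda>v\<in>carrier V. \<zero>\<^bsub>W\<^esub>),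
     add = (\<lambda>f g. \<lambda>v\<in>carrier V. f v \<oplus>\<^bsub>W\<^esub> g v),
     smult = (\<lambda>c f. \<lambda>v\<in>carrier V. c \<odot>\<^bsub>W\<^esub> f v)\<rparr>"

definition scalar_space :: "('a::field, 'a) module" where
  "scalar_space =
    \<lparr>carrier = UNIV, mult = (*), one = 1, zero = 0, add = (+), smult = (*)\<rparr>"


section \<open>Polynomial maps and the Zariski topology\<close>

text \<open>
  \<open>poly_fun V d f\<close>: on the carrier of \<open>V\<close>, \<open>f\<close> is a polynomial of total degree at most \<open>d\<close> in
  linear coordinates, that is, a sum of products of at most \<open>d\<close> linear functionals and a scalar.
\<close>

inductive poly_fun :: "('a::field, 'v) module \<Rightarrow> nat \<Rightarrow> ('v \<Rightarrow> 'a) \<Rightarrow> bool" for V where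
  poly_fun_const: "poly_fun V d (\<lambda>_. c)"
| poly_fun_linear_mult:
    "l \<in> LinearCombinations.module_hom class_ring V scalar_space \<Longrightarrow> poly_fun V d f \<Longrightarrow>
      poly_fun V (Suc d) (\<lambda>v. l v * f v)"
| poly_fun_add:
    "poly_fun V d f \<Longrightarrow> poly_fun V d g \<Longrightarrow> poly_fun V d (\<lambda>v. f v + g v)"

text \<open>
  A map between finite-dimensional spaces is polynomial of degree at most \<open>d\<close> if all its
  coordinates are; quantifying over all functionals on the target avoids choosing a basis.
\<close>

definition poly_map ::
    "nat \<Rightarrow> ('a::field, 'v) module \<Rightarrow> ('a, 'w) module \<Rightarrow> ('v \<Rightarrow> 'w) \<Rightarrow> bool" where
  "poly_map d V W F \<longleftrightarrow>
    F \<in> carrier V \<rightarrow> carrier W \<and>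
    (\<forall>l\<in>LinearCombinations.module_hom class_ring W scalar_space.
      \<exists>f. poly_fun V d f \<and> (\<forall>v\<in>carrier V. l (F v) = f v))"

definition zero_locus :: "('a::field, 'v) module \<Rightarrow> ('v \<Rightarrow> 'a) set \<Rightarrow> 'v set" where
  "zero_locus V S = {v \<in> carrier V. \<forall>f\<in>S. f v = 0}"

definition zariski :: "('a::field, 'v) module \<Rightarrow> 'v topology" where
  "zariski V = topology (\<lambda>U. \<exists>S \<subseteq> {f. \<exists>d. poly_fun V d f}. U = carrier V - zero_locus V S)"

lemma poly_fun_mono: "poly_fun V d f \<Longrightarrow> d \<le> e \<Longrightarrow> poly_fun V e f"
proof (induction arbitrary: e rule: poly_fun.induct)
  case (poly_fun_linear_mult l d f)
  then obtain e' where "e = Suc e'" "d \<le> e'"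
    by (metis Suc_le_D Suc_le_mono)
  with poly_fun_linear_mult show ?case
    by (auto intro: poly_fun.intros)
qed (auto intro: poly_fun.intros)

lemma poly_fun_mult:
  "poly_fun V d f \<Longrightarrow> poly_fun V e g \<Longrightarrow> poly_fun V (d + e) (\<lambda>v. f v * g v)"
proof (induction rule: poly_fun.induct)
  case (poly_fun_const d c)
  from poly_fun_const have "poly_fun V e (\<lambda>v. c * g v)"
  proof (induction rule: poly_fun.induct)
    case (poly_fun_const d c')
    show ?case by (rule poly_fun.intros)
  next
    case (poly_fun_linear_mult l d f)
    then have "poly_fun V (Suc d) (\<lambda>v. l v * (c * f v))"
      by (intro poly_fun.intros)
    then show ?case by (simp add: mult.left_commute)
  next
    case (poly_fun_add d f g)
    then show ?case using poly_fun.poly_fun_add[OF poly_fun_add.IH]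
      by (simp add: distrib_left)
  qed
  then show ?case by (rule poly_fun_mono) simp
next
  case (poly_fun_linear_mult l d f)
  then have "poly_fun V (Suc (d + e)) (\<lambda>v. l v * (f v * g v))"
    by (intro poly_fun.intros) auto
  then show ?case by (simp add: mult.assoc)
next
  case (poly_fun_add d f h)
  then show ?case using poly_fun.poly_fun_add[of V "d + e"]
    by (simp add: distrib_right)
qed

lemma istopology_zariski:
  "istopology (\<lambda>U. \<exists>S \<subseteq> {f. \<exists>d. poly_fun V d f}. U = carrier V - zero_locus V S)"
  (is "istopology ?T")
  unfolding istopology_def
proof (intro conjI allI impI)
  fix A B assume "?T A" "?T B"
  then obtain S T where S: "S \<subseteq> {f. \<exists>d. poly_fun V d f}" "A = carrier V - zero_locus V S"
    and T: "T \<subseteq> {f. \<exists>d. poly_fun V d f}" "B = carrier V - zero_locus V T" by blast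
  let ?R = "{\<lambda>v. f v * g v | f g. f \<in> S \<and> g \<in> T}"
  have "?R \<subseteq> {f. \<exists>d. poly_fun V d f}"
    using S(1) T(1) poly_fun_mult[of V] by blast
  moreover have "A \<inter> B = carrier V - zero_locus V ?R"
  proof (rule Set.set_eqI)
    fix v
    have "v \<in> carrier V - zero_locus V ?R \<longleftrightarrow>
        v \<in> carrier V \<and> (\<exists>f g. f \<in> S \<and> g \<in> T \<and> f v * g v \<noteq> 0)"
      unfolding zero_locus_def by fastforce
    then show "v \<in> A \<inter> B \<longleftrightarrow> v \<in> carrier V - zero_locus V ?R"
      unfolding S(2) T(2) zero_locus_def by auto
  qed
  ultimately show "?T (A \<inter> B)" by blast
next
  fix \<K> assume "\<forall>K\<in>\<K>. ?T K"
  then obtain S where S: "\<And>K. K \<in> \<K> \<Longrightarrow> S K \<subseteq> {f. \<exists>d. poly_fun V d f}"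
      "\<And>K. K \<in> \<K> \<Longrightarrow> K = carrier V - zero_locus V (S K)" by metis
  have "\<Union> \<K> = (\<Union>K\<in>\<K>. carrier V - zero_locus V (S K))"
    using S(2) by blast
  also have "\<dots> = carrier V - zero_locus V (\<Union>K\<in>\<K>. S K)"
    unfolding zero_locus_def by blast
  finally show "?T (\<Union> \<K>)"
    using S(1) by (intro exI[of _ "\<Union>K\<in>\<K>. S K"] conjI UN_least)
qed

lemma openin_zariski:
  "openin (zariski V) U \<longleftrightarrow>
    (\<exists>S \<subseteq> {f. \<exists>d. poly_fun V d f}. U = carrier V - zero_locus V S)"
  unfolding zariski_def using istopology_zariski[of V] by (simp add: topology_inverse')

lemma topspace_zariski [simp]: "topspace (zariski V) = carrier V"
proof -
  have "carrier V = carrier V - zero_locus V {\<lambda>_. 1}"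
    by (auto simp: zero_locus_def)
  then have "openin (zariski V) (carrier V)"
    unfolding openin_zariski by (intro exI[of _ "{\<lambda>_. 1}"]) (auto intro: poly_fun.intros)
  then show ?thesis
    unfolding topspace_def openin_zariski by blast
qed


section \<open>Polynomial functors\<close>

text \<open>
  A functor is given by its object part \<open>P\<close> and its morphism part \<open>Pm\<close>; the latter also takes
  the source and the target, as a function does not determine its codomain.
\<close>

locale polynomial_functor =
  fixes P :: "('a::field, 'v) module \<Rightarrow> ('a, 'w) module"
    and Pm :: "('a, 'v) module \<Rightarrow> ('a, 'v) module \<Rightarrow> ('v \<Rightarrow> 'v) \<Rightarrow> 'w \<Rightarrow> 'w"
  assumes obj: "fd_space V \<Longrightarrow> fd_space (P V)"
    and mor: "fd_space U \<Longrightarrow> fd_space V \<Longrightarrow> f \<in> Hom U V \<Longrightarrow> Pm U V f \<in> Hom (P U) (P V)"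
    and mor_id: "fd_space V \<Longrightarrow> Pm V V (\<lambda>v\<in>carrier V. v) = (\<lambda>w\<in>carrier (P V). w)"
    and mor_comp:
      "fd_space U \<Longrightarrow> fd_space V \<Longrightarrow> fd_space W \<Longrightarrow> f \<in> Hom U V \<Longrightarrow> g \<in> Hom V W \<Longrightarrow>
        Pm U W (compose (carrier U) g f) = compose (carrier (P U)) (Pm V W g) (Pm U V f)"
    and bounded_degree:
      "\<exists>d. \<forall>U V. fd_space U \<longrightarrow> fd_space V \<longrightarrow>
        poly_map d (Hom_space U V) (Hom_space (P U) (P V)) (Pm U V)"

definition homogeneous_functor ::
    "nat \<Rightarrow> (('a::field, 'v) module \<Rightarrow> ('a, 'w) module) \<Rightarrow>
      (('a, 'v) module \<Rightarrow> ('a, 'v) module \<Rightarrow> ('v \<Rightarrow> 'v) \<Rightarrow> 'w \<Rightarrow> 'w) \<Rightarrow> bool" where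
  "homogeneous_functor d P Pm \<longleftrightarrow>
    (\<forall>V t. fd_space V \<longrightarrow>
      Pm V V (\<lambda>v\<in>carrier V. t \<odot>\<^bsub>V\<^esub> v) = (\<lambda>w\<in>carrier (P V). t ^ d \<odot>\<^bsub>P V\<^esub> w))"

definition pure_functor :: "(('a::field, 'v) module \<Rightarrow> ('a, 'w) module) \<Rightarrow> bool" where
  "pure_functor P \<longleftrightarrow>
    (\<forall>V. fd_space V \<longrightarrow> carrier V = {\<zero>\<^bsub>V\<^esub>} \<longrightarrow> carrier (P V) = {\<zero>\<^bsub>P V\<^esub>})"


section \<open>The inverse limit and its topology\<close>

abbreviation K_pow :: "nat \<Rightarrow> ('a::field, 'a vec) module" where
  "K_pow n \<equiv> module_vec TYPE('a) n"

definition forget_last :: "nat \<Rightarrow> 'a vec \<Rightarrow> 'a vec" where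
  "forget_last n = (\<lambda>v\<in>carrier_vec (Suc n). vec_first v n)"

definition P_inf ::
    "(('a::field, 'a vec) module \<Rightarrow> ('a, 'w) module) \<Rightarrow>
      (('a, 'a vec) module \<Rightarrow> ('a, 'a vec) module \<Rightarrow> ('a vec \<Rightarrow> 'a vec) \<Rightarrow> 'w \<Rightarrow> 'w) \<Rightarrow>
      (nat \<Rightarrow> 'w) set" where
  "P_inf P Pm =
    {p. \<forall>n. p n \<in> carrier (P (K_pow n)) \<and>
      Pm (K_pow (Suc n)) (K_pow n) (forget_last n) (p (Suc n)) = p n}"

definition P_inf_topology ::
    "(('a::field, 'a vec) module \<Rightarrow> ('a, 'w) module) \<Rightarrow>
      (('a, 'a vec) module \<Rightarrow> ('a, 'a vec) module \<Rightarrow> ('a vec \<Rightarrow> 'a vec) \<Rightarrow> 'w \<Rightarrow> 'w) \<Rightarrow>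
      (nat \<Rightarrow> 'w) topology" where
  "P_inf_topology P Pm =
    subtopology (product_topology (\<lambda>n. zariski (P (K_pow n))) UNIV) (P_inf P Pm)"

lemma topspace_P_inf_topology: "topspace (P_inf_topology P Pm) = P_inf P Pm"
  by (auto simp: P_inf_topology_def P_inf_def)


section \<open>Infinite matrices and their action\<close>

text \<open>An \<open>\<nat> \<times> \<nat>\<close> matrix is a function of a row and a column index, both starting at 0.\<close>

definition row_finite_matrices :: "(nat \<Rightarrow> nat \<Rightarrow> 'a::zero) set" where
  "row_finite_matrices = {\<phi>. \<forall>i. finite {j. \<phi> i j \<noteq> 0}}"

definition GL_inf :: "(nat \<Rightarrow> nat \<Rightarrow> 'a::field) set" where
  "GL_inf =
    {\<phi>. \<exists>n. \<exists>g\<in>carrier_mat n n. invertible_mat g \<and>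
      \<phi> = (\<lambda>i j. if i < n \<and> j < n then g $$ (i, j) else if i = j then 1 else 0)}"

definition rows_within :: "(nat \<Rightarrow> nat \<Rightarrow> 'a::zero) \<Rightarrow> nat \<Rightarrow> nat \<Rightarrow> bool" where
  "rows_within \<phi> i n \<longleftrightarrow> (\<forall>r<i. \<forall>c. \<phi> r c \<noteq> 0 \<longrightarrow> c < n)"

definition block :: "(nat \<Rightarrow> nat \<Rightarrow> 'a::field) \<Rightarrow> nat \<Rightarrow> nat \<Rightarrow> 'a vec \<Rightarrow> 'a vec" where
  "block \<phi> i n = (\<lambda>v\<in>carrier_vec n. mat i n (\<lambda>(r, c). \<phi> r c) *\<^sub>v v)"

text \<open>
  The least admissible number of columns is used; \<open>P_act_eq\<close> below shows that any other admissible
  number gives the same result.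
\<close>

definition P_act ::
    "(('a::field, 'a vec) module \<Rightarrow> ('a, 'w) module) \<Rightarrow>
      (('a, 'a vec) module \<Rightarrow> ('a, 'a vec) module \<Rightarrow> ('a vec \<Rightarrow> 'a vec) \<Rightarrow> 'w \<Rightarrow> 'w) \<Rightarrow>
      (nat \<Rightarrow> nat \<Rightarrow> 'a) \<Rightarrow> (nat \<Rightarrow> 'w) \<Rightarrow> (nat \<Rightarrow> 'w)" where
  "P_act P Pm \<phi> p =
    (\<lambda>i. let n = (LEAST n. rows_within \<phi> i n) in Pm (K_pow n) (K_pow i) (block \<phi> i n) (p n))"

definition specialization_of ::
    "(('a::field, 'a vec) module \<Rightarrow> ('a, 'w) module) \<Rightarrow>
      (('a, 'a vec) module \<Rightarrow> ('a, 'a vec) module \<Rightarrow> ('a vec \<Rightarrow> 'a vec) \<Rightarrow> 'w \<Rightarrow> 'w) \<Rightarrow>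
      (nat \<Rightarrow> 'w) \<Rightarrow> (nat \<Rightarrow> 'w) \<Rightarrow> bool" where
  "specialization_of P Pm p q \<longleftrightarrow> (\<exists>\<phi>\<in>row_finite_matrices. p = P_act P Pm \<phi> q)"

definition GL_orbit ::
    "(('a::field, 'a vec) module \<Rightarrow> ('a, 'w) module) \<Rightarrow>
      (('a, 'a vec) module \<Rightarrow> ('a, 'a vec) module \<Rightarrow> ('a vec \<Rightarrow> 'a vec) \<Rightarrow> 'w \<Rightarrow> 'w) \<Rightarrow>
      (nat \<Rightarrow> 'w) \<Rightarrow> (nat \<Rightarrow> 'w) set" where
  "GL_orbit P Pm p = (\<lambda>g. P_act P Pm g p) ` GL_inf"

definition dense_orbit ::
    "(('a::field, 'a vec) module \<Rightarrow> ('a, 'w) module) \<Rightarrow>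
      (('a, 'a vec) module \<Rightarrow> ('a, 'a vec) module \<Rightarrow> ('a vec \<Rightarrow> 'a vec) \<Rightarrow> 'w \<Rightarrow> 'w) \<Rightarrow>
      (nat \<Rightarrow> 'w) \<Rightarrow> bool" where
  "dense_orbit P Pm p \<longleftrightarrow> P_inf_topology P Pm closure_of GL_orbit P Pm p = P_inf P Pm"

lemma GL_inf_row_finite: "GL_inf \<subseteq> row_finite_matrices"
proof
  fix \<phi> :: "nat \<Rightarrow> nat \<Rightarrow> 'a" assume "\<phi> \<in> GL_inf"
  then obtain n g where \<phi>:
    "\<phi> = (\<lambda>i j. if i < n \<and> j < n then g $$ (i, j) else if i = j then 1 else 0)"
    unfolding GL_inf_def by blast
  have "{j. \<phi> i j \<noteq> 0} \<subseteq> {..max n i}" for i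
    unfolding \<phi> by (auto split: if_splits)
  then show "\<phi> \<in> row_finite_matrices"
    unfolding row_finite_matrices_def by (auto intro: finite_subset)
qed

lemma rows_within_exists: "\<phi> \<in> row_finite_matrices \<Longrightarrow> \<exists>n. rows_within \<phi> i n"
proof -
  assume "\<phi> \<in> row_finite_matrices"
  then have "finite (\<Union>r<i. {c. \<phi> r c \<noteq> 0})"
    unfolding row_finite_matrices_def by auto
  then obtain n where "\<forall>c\<in>(\<Union>r<i. {c. \<phi> r c \<noteq> 0}). c < n"
    by (metis finite_nat_set_iff_bounded)
  then show ?thesis unfolding rows_within_def by auto
qed

lemma fd_space_K_pow: "fd_space (K_pow n :: ('a::field, 'a vec) module)"
  unfolding fd_space_def using vec_vs vec_space.fin_dim by blast

lemma block_Hom: "block \<phi> i n \<in> Hom (K_pow n) (K_pow i)"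
  unfolding Hom_def block_def LinearCombinations.module_hom_def
  by (auto simp: module_vec_simps mult_add_distrib_mat_vec[where nr = i and nc = n]
      mult_mat_vec[where nr = i and nc = n] intro!: mult_mat_vec_carrier[where n = n])

lemma forget_last_eq_block:
  "forget_last n = block (\<lambda>i j. if i = j then 1 else 0 :: 'a::field) n (Suc n)"
proof -
  have "mat n (Suc n) (\<lambda>(i, j). if i = j then 1 else 0) *\<^sub>v v = vec_first v n"
    if "v \<in> carrier_vec (Suc n)" for v :: "'a vec"
  proof (rule eq_vecI)
    fix i assume i: "i < dim_vec (vec_first v n)"
    have "(mat n (Suc n) (\<lambda>(i, j). if i = j then 1 else 0) *\<^sub>v v) $ i =
        (\<Sum>j\<in>{0..<Suc n}. (if i = j then 1 else 0) * v $ j)"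
      using i that by (auto simp: scalar_prod_def vec_first_def intro!: sum.cong)
    also have "\<dots> = (\<Sum>j\<in>{0..<Suc n}. if i = j then v $ j else 0)"
      by (intro sum.cong) auto
    also have "\<dots> = v $ i" using i by (simp add: vec_first_def)
    finally show "(mat n (Suc n) (\<lambda>(i, j). if i = j then 1 else 0) *\<^sub>v v) $ i = vec_first v n $ i"
      using i by (simp add: vec_first_def)
  qed (simp add: vec_first_def)
  then show ?thesis
    unfolding forget_last_def block_def by (intro restrict_ext) simp
qed

lemma block_compose_forget_last:
  assumes "rows_within \<phi> i n"
  shows "block \<phi> i (Suc n) = compose (carrier (K_pow (Suc n))) (block \<phi> i n) (forget_last n)"
proof -
  have "mat i (Suc n) (\<lambda>(r, c). \<phi> r c) *\<^sub>v v = mat i n (\<lambda>(r, c). \<phi> r c) *\<^sub>v vec_first v n"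
    if v: "v \<in> carrier_vec (Suc n)" for v
  proof (rule eq_vecI)
    fix r assume r: "r < dim_vec (mat i n (\<lambda>(r, c). \<phi> r c) *\<^sub>v vec_first v n)"
    then have 0: "\<phi> r n = 0"
      using assms unfolding rows_within_def by auto
    show "(mat i (Suc n) (\<lambda>(r, c). \<phi> r c) *\<^sub>v v) $ r =
        (mat i n (\<lambda>(r, c). \<phi> r c) *\<^sub>v vec_first v n) $ r"
      using r v 0 by (simp add: scalar_prod_def vec_first_def)
  qed simp
  then show ?thesis
    unfolding block_def forget_last_def compose_def
    by (intro ext) (auto simp: module_vec_simps vec_first_def restrict_def)
qed

context
  fixes P :: "('a::field, 'a vec) module \<Rightarrow> ('a, 'w) module" and Pm
  assumes PF: "polynomial_functor P Pm"
begin

lemma block_step: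
  assumes p: "p \<in> P_inf P Pm" and n: "rows_within \<phi> i n"
  shows "Pm (K_pow (Suc n)) (K_pow i) (block \<phi> i (Suc n)) (p (Suc n)) =
    Pm (K_pow n) (K_pow i) (block \<phi> i n) (p n)"
  using p polynomial_functor.mor_comp[OF PF fd_space_K_pow[of "Suc n"] fd_space_K_pow[of n]
      fd_space_K_pow[of i] _ block_Hom[of \<phi> i n], of "forget_last n"]
  unfolding block_compose_forget_last[OF n]
  by (auto simp: forget_last_eq_block block_Hom compose_def P_inf_def)

lemma P_act_eq:
  assumes p: "p \<in> P_inf P Pm" and n: "rows_within \<phi> i n"
  shows "P_act P Pm \<phi> p i = Pm (K_pow n) (K_pow i) (block \<phi> i n) (p n)"
proof -
  define m where "m = (LEAST n. rows_within \<phi> i n)"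
  have m: "rows_within \<phi> i m" unfolding m_def by (rule LeastI[where P = "rows_within \<phi> i", OF n])
  have "m \<le> n" unfolding m_def by (rule Least_le[where P = "rows_within \<phi> i", OF n])
  then have "Pm (K_pow n) (K_pow i) (block \<phi> i n) (p n) =
      Pm (K_pow m) (K_pow i) (block \<phi> i m) (p m)"
  proof (induction n rule: dec_induct)
    case (step k)
    then have "rows_within \<phi> i k" using m unfolding rows_within_def by force
    then show ?case using block_step[OF p] step by simp
  qed simp
  then show ?thesis unfolding P_act_def m_def by (simp add: Let_def)
qed

lemma P_act_in_P_inf:
  assumes p: "p \<in> P_inf P Pm" and \<phi>: "\<phi> \<in> row_finite_matrices"
  shows "P_act P Pm \<phi> p \<in> P_inf P Pm"
proof -
  have "P_act P Pm \<phi> p i \<in> carrier (P (K_pow i)) \<and>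
      Pm (K_pow (Suc i)) (K_pow i) (forget_last i) (P_act P Pm \<phi> p (Suc i)) = P_act P Pm \<phi> p i"
    for i
  proof -
    obtain n where n: "rows_within \<phi> (Suc i) n" using rows_within_exists[OF \<phi>] by blast
    then have n': "rows_within \<phi> i n" unfolding rows_within_def using less_SucI by blast
    have pn: "p n \<in> carrier (P (K_pow n))" using p unfolding P_inf_def by blast
    have H: "Pm (K_pow n) (K_pow i) (block \<phi> i n) \<in> Hom (P (K_pow n)) (P (K_pow i))"
      by (rule polynomial_functor.mor[OF PF fd_space_K_pow fd_space_K_pow block_Hom])
    then have "Pm (K_pow n) (K_pow i) (block \<phi> i n) (p n) \<in> carrier (P (K_pow i))"
      using pn unfolding Hom_def LinearCombinations.module_hom_def by auto
    moreover have "block \<phi> i n =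
        compose (carrier (K_pow n)) (forget_last i) (block \<phi> (Suc i) n)"
      unfolding block_def forget_last_def compose_def
      by (intro ext) (auto simp: module_vec_simps restrict_def vec_first_def
          intro!: eq_vecI mult_mat_vec_carrier[where n = n])
    then have "Pm (K_pow n) (K_pow i) (block \<phi> i n) (p n) =
        Pm (K_pow (Suc i)) (K_pow i) (forget_last i)
          (Pm (K_pow n) (K_pow (Suc i)) (block \<phi> (Suc i) n) (p n))"
      using pn polynomial_functor.mor_comp[OF PF fd_space_K_pow[of n] fd_space_K_pow[of "Suc i"]
          fd_space_K_pow[of i] block_Hom[of \<phi> "Suc i" n], of "forget_last i"]
      by (simp add: forget_last_eq_block block_Hom compose_def)
    ultimately show ?thesis
      using P_act_eq[OF p n] P_act_eq[OF p n'] by simp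
  qed
  then show ?thesis unfolding P_inf_def by blast
qed

end

end

theory Submission
  imports Defs "HOL-Library.Function_Algebras" "HOL-Library.Countable"
begin

text \<open>
  In coordinates, \<open>P\<close> becomes a family of maps \<open>T m n A\<close> between coordinate spaces whose entries
  are forms of degree \<open>d\<close> in the entries of the matrix \<open>A\<close>. The orbit of \<open>q\<close> is dense if and only
  if \<open>q\<close> covers, i.e. every point of every \<open>P(K\<^sup>n)\<close> is the image of \<open>q\<close> under some matrix: maps
  close to a diagonal one \<open>t\<^sub>i \<mapsto> t\<^sub>i\<^sup>d\<close> are surjective, and conversely a matrix reaching a point can
  be perturbed to rows of an invertible one.

  The minimal element is a sum of basis vectors of all \<open>P(K\<^sup>n)\<close> in disjoint blocks of
  variables. Any covering \<open>q\<close> specialises to it block by block: copies of the new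
  summand are found in \<open>q\<close>, and the mixed terms, forms of degree less than \<open>d\<close> in the coefficients
  of these copies, vanish at a point where \<open>\<Sum>\<^sub>i t\<^sub>i\<^sup>d = 1\<close>. That point exists because over \<open>K\<close>
  a bounded number of forms of degree less than \<open>d\<close> can be diagonalised on a large subspace on which
  \<open>\<Sum>\<^sub>i t\<^sub>i\<^sup>d\<close> keeps its shape.

  The maximal element is a sum of weight vectors over the paths of a forest of variables, so that
  an arbitrary \<open>q\<close> is obtained by a matrix that sends finitely many variables to each variable.
\<close>

section \<open>Forms\<close>

text \<open>Density yields only open conditions, whereas specialisation asks for equality at
  infinitely many levels at once, by a matrix with finite rows. Covering mediates: it is exact, but
  concerns one level at a time. To reach all levels, rows once chosen must never be revised, so each
  new block has to be hit exactly while the old rows stay fixed. This is why the mixed terms must be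
  killed exactly, at a point where the power sum is still 1. The number of mixed terms is known
  before the copies are chosen, their coefficients are not; hence all solvability bounds are uniform
  in the coefficients.

  On the maximal side, private variables for every monomial would not do: infinitely many monomials
  involve a given variable, so its row would be infinite. Sharing variables along common prefixes
  leaves, for each index and each type of monomial, only the finitely many increasing lists that end
  in this index. The last vertex of a path still determines the path, so a coefficient can be placed
  there by extracting a root.\<close>

definition mon :: "nat \<Rightarrow> (nat \<Rightarrow> nat) \<Rightarrow> (nat \<Rightarrow> 'a::comm_semiring_1) \<Rightarrow> 'a" where
  "mon k \<alpha> s = (\<Prod>i<k. s i ^ \<alpha> i)"

text \<open>Exponents are functions on all of \<open>nat\<close> that vanish from \<open>k\<close>
  on, so that equality of functions is equality of exponent vectors and each degree bound leaves
  finitely many of them.\<close>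

definition expos :: "nat \<Rightarrow> nat \<Rightarrow> (nat \<Rightarrow> nat) set" where
  "expos k d = {\<alpha>. (\<forall>i\<ge>k. \<alpha> i = 0) \<and> sum \<alpha> {..<k} \<le> d}"

definition hexpos :: "nat \<Rightarrow> nat \<Rightarrow> (nat \<Rightarrow> nat) set" where
  "hexpos k d = {\<alpha>. (\<forall>i\<ge>k. \<alpha> i = 0) \<and> sum \<alpha> {..<k} = d}"

text \<open>Forms are kept as functions, without coefficients, and the zero function belongs to
  every degree. Coefficients are recovered from the values by \<open>form_coeffs\<close> and
  \<open>hexpos_coeffs_unique\<close>.\<close>

inductive form :: "nat \<Rightarrow> nat \<Rightarrow> ((nat \<Rightarrow> 'a::comm_semiring_1) \<Rightarrow> 'a) \<Rightarrow> bool" for k where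
  form_zero: "form k d (\<lambda>_. 0)"
| form_const: "form k 0 (\<lambda>_. c)"
| form_var: "i < k \<Longrightarrow> form k d f \<Longrightarrow> form k (Suc d) (\<lambda>s. s i * f s)"
| form_add: "form k d f \<Longrightarrow> form k d g \<Longrightarrow> form k d (\<lambda>s. f s + g s)"

lemma finite_expos: "finite (expos k d)"
proof (rule finite_subset)
  show "expos k d \<subseteq> (\<lambda>g i. if i < k then g i else 0) ` ({..<k} \<rightarrow>\<^sub>E {..d})"
  proof
    fix \<alpha> assume a: "\<alpha> \<in> expos k d"
    then have "\<alpha> i \<le> d" if "i < k" for i
      using member_le_sum[of i "{..<k}" \<alpha>] that by (auto simp: expos_def)
    then have "restrict \<alpha> {..<k} \<in> {..<k} \<rightarrow>\<^sub>E {..d}" by auto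
    moreover have "\<alpha> = (\<lambda>i. if i < k then restrict \<alpha> {..<k} i else 0)"
      using a by (auto simp: expos_def fun_eq_iff)
    ultimately show "\<alpha> \<in> (\<lambda>g i. if i < k then g i else 0) ` ({..<k} \<rightarrow>\<^sub>E {..d})" by blast
  qed
qed (auto intro: finite_PiE)

lemma hexpos_subset: "hexpos k d \<subseteq> expos k d"
  by (auto simp: hexpos_def expos_def)

lemma finite_hexpos: "finite (hexpos k d)"
  using finite_subset[OF hexpos_subset finite_expos] .

lemma expos_0: "expos k 0 = {\<lambda>_. 0}"
proof -
  have "\<alpha> = (\<lambda>_. 0)" if "\<alpha> \<in> expos k 0" for \<alpha>
  proof
    fix i show "\<alpha> i = 0" using that by (cases "i < k") (auto simp: expos_def)
  qed
  then show ?thesis by (auto simp: expos_def)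
qed

definition inc :: "nat \<Rightarrow> (nat \<Rightarrow> nat) \<Rightarrow> nat \<Rightarrow> nat" where
  "inc i \<alpha> = \<alpha>(i := Suc (\<alpha> i))"

lemma sum_inc: "i < k \<Longrightarrow> sum (inc i \<alpha>) {..<k} = Suc (sum \<alpha> {..<k})"
  by (simp add: sum.remove[of "{..<k}" i] inc_def)

lemma mon_inc: "i < k \<Longrightarrow> mon k (inc i \<alpha>) s = s i * mon k \<alpha> s"
  by (simp add: inc_def mon_def prod.remove[of "{..<k}" i] mult.assoc)

lemma hexpos_inc: "i < k \<Longrightarrow> \<alpha> \<in> hexpos k d \<Longrightarrow> inc i \<alpha> \<in> hexpos k (Suc d)"
  unfolding hexpos_def by (simp only: mem_Collect_eq sum_inc) (auto simp: inc_def)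

lemma expos_inc: "i < k \<Longrightarrow> \<alpha> \<in> expos k d \<Longrightarrow> inc i \<alpha> \<in> expos k (Suc d)"
  unfolding expos_def by (simp only: mem_Collect_eq sum_inc) (auto simp: inc_def)

lemma mon_cong: "(\<And>i. i < k \<Longrightarrow> \<alpha> i = \<beta> i) \<Longrightarrow> (\<And>i. i < k \<Longrightarrow> s i = t i) \<Longrightarrow> mon k \<alpha> s = mon k \<beta> t"
  by (simp add: mon_def)

lemma mon_zero: "mon k (\<lambda>_. 0) s = 1"
  by (simp add: mon_def)

lemma mon_one: "mon k \<alpha> (\<lambda>_. 1) = 1"
  by (simp add: mon_def)

lemma mon_add: "mon k (\<lambda>i. \<alpha> i + \<beta> i) s = mon k \<alpha> s * mon k \<beta> s"
  by (simp add: mon_def power_add prod.distrib)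

lemma mon_mult: "mon k \<alpha> (\<lambda>i. c i * s i) = mon k \<alpha> c * mon k \<alpha> s"
  by (simp add: mon_def power_mult_distrib prod.distrib)

lemma form_scale: "form k d f \<Longrightarrow> form k d (\<lambda>s. c * f s)"
proof (induction rule: form.induct)
  case (form_var i d f)
  then show ?case using form.form_var[of i k d "\<lambda>s. c * f s"] by (simp add: mult.left_commute)
qed (auto intro: form.intros simp: distrib_left)

lemma form_sum: "(\<And>x. x \<in> S \<Longrightarrow> form k d (f x)) \<Longrightarrow> form k d (\<lambda>s. \<Sum>x\<in>S. f x s)"
  by (induction S rule: infinite_finite_induct) (auto intro: form.intros)

lemma form_mult: "form k d f \<Longrightarrow> form k e g \<Longrightarrow> form k (d + e) (\<lambda>s. f s * g s)"
proof (induction rule: form.induct)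
  case (form_var i d f)
  then show ?case using form.form_var[of i k "d + e" "\<lambda>s. f s * g s"] by (simp add: mult.assoc)
next
  case (form_add d f g)
  then show ?case using form.form_add[of k "d + e"] by (simp add: distrib_right)
qed (auto intro: form.intros form_scale)

lemma form_subst:
  "form k d f \<Longrightarrow> (\<And>i. i < k \<Longrightarrow> form m 1 (\<lambda>s. L s i)) \<Longrightarrow> form m d (\<lambda>s. f (L s))"
proof (induction rule: form.induct)
  case (form_var i d f)
  then show ?case using form_mult[of m 1 "\<lambda>s. L s i" d "\<lambda>s. f (L s)"] by simp
qed (auto intro: form.intros)

lemma form_proj: "i < k \<Longrightarrow> form k 1 (\<lambda>s. s i)"
  using form_var[OF _ form_const[of k 1]] by simp

lemma form_mon: "form k (sum \<alpha> {..<k}) (mon k \<alpha>)"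
proof -
  have "form k (sum \<alpha> {..<m}) (\<lambda>s. \<Prod>i<m. s i ^ \<alpha> i)" if "m \<le> k" for m using that
  proof (induction m)
    case 0
    then show ?case using form_const[of k 1] by simp
  next
    case (Suc m)
    have "form k e (\<lambda>s. s m ^ e)" for e
    proof (induction e)
      case 0
      then show ?case using form_const[of k 1] by simp
    next
      case (Suc e)
      then show ?case using form_var[of m k e] \<open>Suc m \<le> k\<close> by simp
    qed
    then show ?case using form_mult Suc by force
  qed
  then show ?thesis unfolding mon_def by blast
qed

section \<open>Expansions of forms and uniqueness of their coefficients\<close>

lemma sum_shift_index:
  fixes h :: "'i \<Rightarrow> 'i" and c :: "'i \<Rightarrow> 'b::semiring_0"
  assumes "finite S" "finite T" "h ` S \<subseteq> T"
  shows "(\<Sum>\<alpha>\<in>S. m (h \<alpha>) * c \<alpha>) = (\<Sum>\<beta>\<in>T. m \<beta> * (\<Sum>\<alpha>\<in>S. if h \<alpha> = \<beta> then c \<alpha> else 0))"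
proof -
  have "(\<Sum>\<beta>\<in>T. m \<beta> * (\<Sum>\<alpha>\<in>S. if h \<alpha> = \<beta> then c \<alpha> else 0)) =
      (\<Sum>\<beta>\<in>T. \<Sum>\<alpha>\<in>S. if \<beta> = h \<alpha> then m \<beta> * c \<alpha> else 0)"
    by (auto simp: sum_distrib_left intro!: sum.cong)
  also have "\<dots> = (\<Sum>\<alpha>\<in>S. \<Sum>\<beta>\<in>T. if \<beta> = h \<alpha> then m \<beta> * c \<alpha> else 0)" by (rule sum.swap)
  also have "\<dots> = (\<Sum>\<alpha>\<in>S. m (h \<alpha>) * c \<alpha>)" using assms by (intro sum.cong) (auto simp: sum.delta)
  finally show ?thesis by simp
qed

text \<open>This is where mixed terms come from: with the variables split into two groups, a term of
  degree \<open>sum \<alpha> {..<m}\<close> in the first group has a coefficient of the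
  complementary degree in the second, and mixed terms are those with both degrees positive.\<close>

lemma form_expand:
  assumes "form (m + k) g F"
  shows "\<exists>G. (\<forall>\<alpha>\<in>expos m g. form k (g - sum \<alpha> {..<m}) (G \<alpha>)) \<and>
    (\<forall>u v. F (\<lambda>i. if i < m then u i else v (i - m)) = (\<Sum>\<alpha>\<in>expos m g. mon m \<alpha> u * G \<alpha> v))"
  using assms
proof (induction rule: form.induct)
  case (form_zero d)
  show ?case by (rule exI[of _ "\<lambda>_ _. 0"]) (auto intro: form.form_zero)
next
  case (form_const c)
  have "expos m 0 = {\<lambda>_. 0}" by (rule expos_0)
  then show ?case by (intro exI[of _ "\<lambda>_ _. c"]) (auto intro: form.form_const simp: mon_zero)
next
  case (form_var i d f)
  then obtain G where G: "\<And>\<alpha>. \<alpha>\<in>expos m d \<Longrightarrow> form k (d - sum \<alpha> {..<m}) (G \<alpha>)"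
    "\<And>u v. f (\<lambda>i. if i < m then u i else v (i - m)) = (\<Sum>\<alpha>\<in>expos m d. mon m \<alpha> u * G \<alpha> v)" by blast
  show ?case
  proof (cases "i < m")
    case True
    let ?h = "inc i"
    \<comment> \<open>\<open>inc i\<close> is injective, so at most one summand survives; exponents
      outside its image get coefficient 0.\<close>
    let ?G = "\<lambda>\<beta> v. \<Sum>\<alpha>\<in>expos m d. if ?h \<alpha> = \<beta> then G \<alpha> v else 0"
    have "form k (Suc d - sum \<beta> {..<m}) (?G \<beta>)" for \<beta>
    proof (rule form_sum)
      fix \<alpha> assume a: "\<alpha> \<in> expos m d"
      show "form k (Suc d - sum \<beta> {..<m}) (\<lambda>v. if ?h \<alpha> = \<beta> then G \<alpha> v else 0)"
      proof (cases "?h \<alpha> = \<beta>")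
        case t: True
        have "Suc d - sum \<beta> {..<m} = d - sum \<alpha> {..<m}"
          using sum_inc[OF True, of \<alpha>] t by simp
        then show ?thesis using t G(1)[OF a] by simp
      qed (auto intro: form.form_zero)
    qed
    moreover have "u i * f (\<lambda>i. if i < m then u i else v (i - m)) =
        (\<Sum>\<beta>\<in>expos m (Suc d). mon m \<beta> u * ?G \<beta> v)" for u v
      unfolding G(2) using sum_shift_index[of "expos m d" "expos m (Suc d)" ?h "\<lambda>\<beta>. mon m \<beta> u" "\<lambda>\<alpha>. G \<alpha> v"]
        expos_inc[OF True, of _ d]
      by (simp add: finite_expos image_subset_iff sum_distrib_left[of "u i"] mon_inc[OF True] mult.assoc)
    ultimately show ?thesis using True by (intro exI[of _ ?G]) auto
  next
    case False
    \<comment> \<open>The sum now runs over \<open>expos m (Suc d)\<close>, whose additional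
      exponents carry no coefficient.\<close>
    let ?G = "\<lambda>\<alpha> v. if \<alpha> \<in> expos m d then v (i - m) * G \<alpha> v else 0"
    have "form k (Suc d - sum \<beta> {..<m}) (?G \<beta>)" for \<beta>
    proof (cases "\<beta> \<in> expos m d")
      case True
      then have e: "Suc d - sum \<beta> {..<m} = Suc (d - sum \<beta> {..<m})"
        unfolding expos_def by (simp add: Suc_diff_le)
      have "i - m < k" using False \<open>i < m + k\<close> by linarith
      from form.form_var[OF this G(1)[OF True]] show ?thesis unfolding e using True by simp
    next
      case False
      then show ?thesis using form.form_zero by simp
    qed
    moreover have "v (i - m) * f (\<lambda>i. if i < m then u i else v (i - m)) =
        (\<Sum>\<beta>\<in>expos m (Suc d). mon m \<beta> u * ?G \<beta> v)" for u v
    proof -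
      have "(\<Sum>\<beta>\<in>expos m (Suc d). mon m \<beta> u * ?G \<beta> v) = (\<Sum>\<beta>\<in>expos m d. mon m \<beta> u * ?G \<beta> v)"
        by (rule sum.mono_neutral_right[OF finite_expos]) (auto simp: expos_def)
      then show ?thesis unfolding G(2) by (simp add: sum_distrib_left mult.left_commute)
    qed
    ultimately show ?thesis using False by (intro exI[of _ ?G]) auto
  qed
next
  case (form_add d f g)
  then obtain G H where G: "\<And>\<alpha>. \<alpha>\<in>expos m d \<Longrightarrow> form k (d - sum \<alpha> {..<m}) (G \<alpha>)"
    "\<And>u v. f (\<lambda>i. if i < m then u i else v (i - m)) = (\<Sum>\<alpha>\<in>expos m d. mon m \<alpha> u * G \<alpha> v)"
    and H: "\<And>\<alpha>. \<alpha>\<in>expos m d \<Longrightarrow> form k (d - sum \<alpha> {..<m}) (H \<alpha>)"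
    "\<And>u v. g (\<lambda>i. if i < m then u i else v (i - m)) = (\<Sum>\<alpha>\<in>expos m d. mon m \<alpha> u * H \<alpha> v)" by blast
  then show ?case by (intro exI[of _ "\<lambda>\<alpha> v. G \<alpha> v + H \<alpha> v"])
      (auto intro: form.form_add simp: distrib_left sum.distrib)
qed

lemma form_coeffs:
  assumes "form k d f"
  shows "\<exists>c. \<forall>s. f s = (\<Sum>\<alpha>\<in>hexpos k d. c \<alpha> * mon k \<alpha> s)"
  using assms
proof (induction rule: form.induct)
  case (form_zero d)
  show ?case by (rule exI[of _ "\<lambda>_. 0"]) auto
next
  case (form_const c)
  have "hexpos k 0 = {\<lambda>_. 0}" using expos_0[of k] by (simp add: hexpos_def expos_def)
  then show ?case by (intro exI[of _ "\<lambda>_. c"]) (auto simp: mon_zero)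
next
  case (form_var i d f)
  then obtain c where c: "\<And>s. f s = (\<Sum>\<alpha>\<in>hexpos k d. c \<alpha> * mon k \<alpha> s)" by blast
  let ?h = "inc i"
  have "s i * f s = (\<Sum>\<beta>\<in>hexpos k (Suc d). mon k \<beta> s * (\<Sum>\<alpha>\<in>hexpos k d. if ?h \<alpha> = \<beta> then c \<alpha> else 0))" for s
  proof -
    have "s i * f s = (\<Sum>\<alpha>\<in>hexpos k d. mon k (?h \<alpha>) s * c \<alpha>)"
      unfolding c sum_distrib_left by (intro sum.cong) (simp_all add: mon_inc[OF form_var(1)] mult_ac)
    then show ?thesis
      using sum_shift_index[of "hexpos k d" "hexpos k (Suc d)" ?h "\<lambda>\<beta>. mon k \<beta> s" c]
        hexpos_inc[OF form_var(1), of _ d] by (simp add: finite_hexpos image_subset_iff)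
  qed
  then show ?case
    by (intro exI[of _ "\<lambda>\<beta>. \<Sum>\<alpha>\<in>hexpos k d. if ?h \<alpha> = \<beta> then c \<alpha> else 0"]) (simp add: mult.commute)
next
  case (form_add d f g)
  then obtain a b where "\<And>s. f s = (\<Sum>\<alpha>\<in>hexpos k d. a \<alpha> * mon k \<alpha> s)"
    "\<And>s. g s = (\<Sum>\<alpha>\<in>hexpos k d. b \<alpha> * mon k \<alpha> s)" by blast
  then show ?case by (intro exI[of _ "\<lambda>\<alpha>. a \<alpha> + b \<alpha>"]) (simp add: sum.distrib distrib_right)
qed

lemma mon_Suc: "mon (Suc k) \<alpha> s = mon k \<alpha> s * s k ^ \<alpha> k"
  by (simp add: mon_def)

text \<open>Induction on the number of variables. With the first \<open>k\<close> variables fixed,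
  the sum is a univariate polynomial in the last one that vanishes everywhere on an infinite domain.
  Its coefficients therefore vanish, and they are sums of the same kind in fewer variables.\<close>

lemma monomials_independent:
  fixes c :: "(nat \<Rightarrow> nat) \<Rightarrow> 'a::{idom,ring_char_0}"
  assumes "finite S" "\<And>\<alpha> i. \<alpha> \<in> S \<Longrightarrow> k \<le> i \<Longrightarrow> \<alpha> i = 0"
    and "\<And>s. (\<Sum>\<alpha>\<in>S. c \<alpha> * mon k \<alpha> s) = 0" and "\<alpha> \<in> S"
  shows "c \<alpha> = 0"
  using assms
proof (induction k arbitrary: S c \<alpha>)
  case 0
  have "\<beta> = \<alpha>" if "\<beta> \<in> S" for \<beta>
    using 0(2)[OF that] 0(2)[OF 0(4)] by (intro ext) simp
  then have "S = {\<alpha>}" using 0(4) by blast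
  then show ?case using 0(3)[of "\<lambda>_. 0"] by (simp add: mon_def)
next
  case (Suc k)
  define j where "j = \<alpha> k"
  define T where "T = (\<lambda>j. {\<beta>\<in>S. \<beta> k = j})"
  have fT: "finite (T j)" for j using Suc.prems by (simp add: T_def)
  have z: "(\<Sum>\<beta>\<in>T j. c \<beta> * mon k \<beta> s) = 0" for s
  proof -
    define p where "p = (\<Sum>i\<in>(\<lambda>\<beta>. \<beta> k) ` S. monom (\<Sum>\<beta>\<in>T i. c \<beta> * mon k \<beta> s) i)"
    have "poly p x = 0" for x
    proof -
      have "mon k \<beta> (s(k := x)) = mon k \<beta> s" for \<beta> by (rule mon_cong) auto
      then have "0 = (\<Sum>\<beta>\<in>S. c \<beta> * mon k \<beta> s * x ^ \<beta> k)"
        using Suc.prems(3)[of "s(k := x)"] by (simp add: mon_Suc mult.assoc del: fun_upd_apply) simp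
      also have "\<dots> = (\<Sum>i\<in>(\<lambda>\<beta>. \<beta> k) ` S. \<Sum>\<beta>\<in>T i. c \<beta> * mon k \<beta> s * x ^ \<beta> k)"
        unfolding T_def using Suc.prems by (intro sum.image_gen)
      also have "\<dots> = poly p x"
        unfolding p_def poly_sum poly_monom
        by (intro sum.cong) (auto simp: T_def sum_distrib_right intro!: sum.cong)
      finally show ?thesis by simp
    qed
    then have "p = 0" using poly_all_0_iff_0 by blast
    moreover have "coeff p j = (\<Sum>\<beta>\<in>T j. c \<beta> * mon k \<beta> s)"
      unfolding p_def using Suc.prems
      by (auto simp: coeff_sum j_def sum.delta)
    ultimately show ?thesis by simp
  qed
  have inj: "inj_on (\<lambda>\<beta>. \<beta>(k := 0)) (T j)"
  proof (rule inj_onI)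
    fix \<beta> \<gamma> assume "\<beta> \<in> T j" "\<gamma> \<in> T j" and e: "\<beta>(k := 0) = \<gamma>(k := 0)"
    then have "\<beta> k = \<gamma> k" by (simp add: T_def)
    then have "\<beta> = (\<beta>(k := 0))(k := \<gamma> k)" by (metis fun_upd_triv fun_upd_upd)
    then show "\<beta> = \<gamma>" unfolding e by simp
  qed
  \<comment> \<open>The exponents with last entry \<open>j\<close> become exponents in
    \<open>k\<close> variables by erasing this entry; putting \<open>j\<close> back recovers the
    coefficient.\<close>
  have "c ((\<alpha>(k := 0))(k := j)) = 0"
  proof (rule Suc.IH[of "(\<lambda>\<beta>. \<beta>(k := 0)) ` T j" "\<lambda>\<beta>. c (\<beta>(k := j))"])
    show "(\<Sum>\<alpha>\<in>(\<lambda>\<beta>. \<beta>(k := 0)) ` T j. c (\<alpha>(k := j)) * mon k \<alpha> s) = 0" for s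
    proof -
      have "c (\<beta>(k := j)) = c \<beta> \<and> mon k (\<beta>(k := 0)) s = mon k \<beta> s" if "\<beta> \<in> T j" for \<beta>
        using that by (auto simp: T_def fun_upd_idem intro!: mon_cong arg_cong[of _ _ c])
      then show ?thesis using z[of s] by (simp add: sum.reindex[OF inj])
    qed
    show "\<And>\<alpha> i. \<alpha> \<in> (\<lambda>\<beta>. \<beta>(k := 0)) ` T j \<Longrightarrow> k \<le> i \<Longrightarrow> \<alpha> i = 0"
    proof -
      fix \<alpha> i assume "\<alpha> \<in> (\<lambda>\<beta>. \<beta>(k := 0)) ` T j" "k \<le> i"
      then obtain \<beta> where "\<beta> \<in> S" "\<alpha> = \<beta>(k := 0)" unfolding T_def by blast
      then show "\<alpha> i = 0" using Suc.prems(2)[of \<beta> i] \<open>k \<le> i\<close> by (cases "i = k") auto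
    qed
    show "finite ((\<lambda>\<beta>. \<beta>(k := 0)) ` T j)" using fT by simp
    show "\<alpha>(k := 0) \<in> (\<lambda>\<beta>. \<beta>(k := 0)) ` T j" using Suc.prems(4) by (intro imageI) (simp add: T_def j_def)
  qed
  then show ?case by (simp add: j_def)
qed

lemma hexpos_coeffs_unique:
  fixes c :: "(nat \<Rightarrow> nat) \<Rightarrow> 'a::{idom,ring_char_0}"
  assumes "\<And>s. (\<Sum>\<alpha>\<in>hexpos k d. c \<alpha> * mon k \<alpha> s) = (\<Sum>\<alpha>\<in>hexpos k d. c' \<alpha> * mon k \<alpha> s)"
    and "\<alpha> \<in> hexpos k d"
  shows "c \<alpha> = c' \<alpha>"
proof -
  have "(\<Sum>\<alpha>\<in>hexpos k d. (c \<alpha> - c' \<alpha>) * mon k \<alpha> s) = 0" for s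
    using assms(1)[of s] by (simp add: left_diff_distrib sum_subtractf)
  from monomials_independent[OF finite_hexpos _ this assms(2)] have "c \<alpha> - c' \<alpha> = 0"
    by (simp add: hexpos_def)
  then show ?thesis by simp
qed

lemma form_at_zero: "form k d f \<Longrightarrow> 0 < d \<Longrightarrow> f (\<lambda>_. 0) = 0"
  by (induction rule: form.induct) auto

lemma form_scaled: "form k d f \<Longrightarrow> f (\<lambda>i. c * s i) = c ^ d * f s"
  by (induction rule: form.induct) (auto simp: algebra_simps)

section \<open>Polynomial functions\<close>

text \<open>Polynomials are treated inside the space of all functions, so that spans, independence
  and dimension counts are available for them.\<close>

interpretation fun_vs: vector_space "\<lambda>(c::'a::field) (f::'b \<Rightarrow> 'a) t. c * f t"
  by unfold_locales (auto simp: fun_eq_iff algebra_simps)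

declare fun_vs.scale_scale [simp del] fun_vs.scale_one [simp del] fun_vs.scale_zero_left [simp del]
  fun_vs.scale_zero_right [simp del] fun_vs.scale_minus_left [simp del]
  fun_vs.scale_minus_right [simp del] fun_vs.scale_eq_0_iff [simp del]
  fun_vs.scale_cancel_left [simp del] fun_vs.scale_cancel_right [simp del]

definition polys :: "nat \<Rightarrow> ((nat \<Rightarrow> 'a::field) \<Rightarrow> 'a) set" where
  "polys k = fun_vs.span (mon k ` {\<alpha>. \<forall>i\<ge>k. \<alpha> i = 0})"

lemma polys_add: "f \<in> polys k \<Longrightarrow> g \<in> polys k \<Longrightarrow> (\<lambda>t. f t + g t) \<in> polys k"
  using fun_vs.span_add unfolding polys_def plus_fun_def by blast

lemma polys_scale: "f \<in> polys k \<Longrightarrow> (\<lambda>t. c * f t) \<in> polys k"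
  using fun_vs.span_scale unfolding polys_def by blast

lemma polys_zero: "(\<lambda>_. 0) \<in> polys k"
  using fun_vs.span_zero unfolding polys_def zero_fun_def by blast

lemma polys_const: "(\<lambda>_. c) \<in> polys k"
proof -
  have "mon k (\<lambda>_. 0) \<in> polys k" unfolding polys_def by (intro fun_vs.span_base) auto
  from polys_scale[OF this, of c] show ?thesis by (simp add: mon_zero)
qed

lemma fun_vs_span_mult:
  assumes "f \<in> fun_vs.span S" "\<And>x. x \<in> S \<Longrightarrow> (\<lambda>t. g t * x t) \<in> fun_vs.span T"
  shows "(\<lambda>t. g t * f t) \<in> fun_vs.span T"
  using assms(1)
proof (induction rule: fun_vs.span_induct_alt)
  case base
  then show ?case using fun_vs.span_zero by (simp add: zero_fun_def)
next
  case (step c x y)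
  have "(\<lambda>t. c * (g t * x t)) + (\<lambda>t. g t * y t) \<in> fun_vs.span T"
    by (intro fun_vs.span_add fun_vs.span_scale step assms(2))
  then show ?case by (simp add: plus_fun_def algebra_simps)
qed

lemma polys_mult:
  fixes f g :: "(nat \<Rightarrow> 'a::field) \<Rightarrow> 'a"
  shows "f \<in> polys k \<Longrightarrow> g \<in> polys k \<Longrightarrow> (\<lambda>t. f t * g t) \<in> polys k"
  unfolding polys_def
proof (rule fun_vs_span_mult, assumption)
  fix x :: "(nat \<Rightarrow> 'a) \<Rightarrow> 'a"
  assume f: "f \<in> fun_vs.span (mon k ` {\<alpha>. \<forall>i\<ge>k. \<alpha> i = 0})"
    and x: "x \<in> mon k ` {\<alpha>. \<forall>i\<ge>k. \<alpha> i = 0}"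
  have "(\<lambda>t. x t * f t) \<in> fun_vs.span (mon k ` {\<alpha>. \<forall>i\<ge>k. \<alpha> i = 0})"
  proof (rule fun_vs_span_mult[OF f])
    fix y :: "(nat \<Rightarrow> 'a) \<Rightarrow> 'a" assume "y \<in> mon k ` {\<alpha>. \<forall>i\<ge>k. \<alpha> i = 0}"
    then obtain \<alpha> \<beta> where "x = mon k \<alpha>" "y = mon k \<beta>" "\<forall>i\<ge>k. \<alpha> i + \<beta> i = 0"
      using x by auto
    then show "(\<lambda>t. x t * y t) \<in> fun_vs.span (mon k ` {\<alpha>. \<forall>i\<ge>k. \<alpha> i = 0})"
      by (intro fun_vs.span_base image_eqI[of _ _ "\<lambda>i. \<alpha> i + \<beta> i"]) (auto simp: mon_add)
  qed
  then show "(\<lambda>t. f t * x t) \<in> fun_vs.span (mon k ` {\<alpha>. \<forall>i\<ge>k. \<alpha> i = 0})"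
    by (simp add: mult.commute)
qed

lemma polys_sum: "(\<And>x. x \<in> S \<Longrightarrow> f x \<in> polys k) \<Longrightarrow> (\<lambda>t. \<Sum>x\<in>S. f x t) \<in> polys k"
  by (induction S rule: infinite_finite_induct) (auto intro: polys_zero polys_add)

lemma polys_prod: "(\<And>x. x \<in> S \<Longrightarrow> f x \<in> polys k) \<Longrightarrow> (\<lambda>t. \<Prod>x\<in>S. f x t) \<in> polys k"
  by (induction S rule: infinite_finite_induct) (auto intro: polys_const polys_mult)

lemma polys_var: "i < k \<Longrightarrow> (\<lambda>t. t i) \<in> polys k"
proof -
  assume i: "i < k"
  have "mon k (inc i (\<lambda>_. 0)) \<in> polys k"
    unfolding polys_def using i by (intro fun_vs.span_base) (auto simp: inc_def)
  then show ?thesis using mon_inc[OF i, of "\<lambda>_. 0"] by (simp add: mon_zero mon_inc[OF i, abs_def])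
qed

lemma polys_det:
  fixes e :: "(nat \<Rightarrow> 'a::field) \<Rightarrow> nat \<Rightarrow> nat \<Rightarrow> 'a"
  assumes "\<And>i j. i < n \<Longrightarrow> j < n \<Longrightarrow> (\<lambda>t. e t i j) \<in> polys k"
  shows "(\<lambda>t. det (mat n n (\<lambda>(i, j). e t i j))) \<in> polys k"
proof -
  have "(\<lambda>t. \<Sum>p\<in>{p. p permutes {0..<n}}. signof p * (\<Prod>i = 0..<n. e t i (p i))) \<in> polys k"
    using assms by (intro polys_sum polys_scale polys_prod) (auto simp: permutes_in_image)
  moreover have "det (mat n n (\<lambda>(i, j). e t i j)) =
      (\<Sum>p\<in>{p. p permutes {0..<n}}. signof p * (\<Prod>i = 0..<n. e t i (p i)))" for t
    by (subst det_def'[of _ n]) (auto intro!: sum.cong prod.cong simp: permutes_in_image)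
  ultimately show ?thesis by simp
qed

text \<open>Zero rows pad the system to a square matrix. Since row \<open>N\<close> is zero, the
  determinant vanishes, and a singular matrix has a nonzero kernel vector.\<close>

lemma underdetermined_system:
  fixes a :: "nat \<Rightarrow> nat \<Rightarrow> 'a::field"
  assumes "N < M"
  shows "\<exists>z. (\<exists>i<M. z i \<noteq> 0) \<and> (\<forall>j<N. (\<Sum>i<M. a j i * z i) = 0)"
proof -
  define A where "A = mat M M (\<lambda>(j, i). if j < N then a j i else 0)"
  have A: "A \<in> carrier_mat M M" by (simp add: A_def)
  have "det A = (\<Sum>p\<in>{p. p permutes {0..<M}}. signof p * (\<Prod>i = 0..<M. A $$ (i, p i)))"
    by (rule det_def'[OF A])
  also have "\<dots> = 0"
  proof (intro sum.neutral ballI)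
    fix p assume "p \<in> {p. p permutes {0..<M}}"
    then have "p N < M" using assms permutes_in_image[of p "{0..<M}" N] by auto
    then have "A $$ (N, p N) = 0" using assms by (simp add: A_def)
    then have "(\<Prod>i = 0..<M. A $$ (i, p i)) = 0" using assms by (intro prod_zero) auto
    then show "signof p * (\<Prod>i = 0..<M. A $$ (i, p i)) = 0" by simp
  qed
  finally obtain v where v: "v \<in> carrier_vec M" "v \<noteq> 0\<^sub>v M" "A *\<^sub>v v = 0\<^sub>v M"
    using det_0_iff_vec_prod_zero[OF A] by blast
  have "\<exists>i<M. v $ i \<noteq> 0"
  proof (rule ccontr)
    assume "\<not> ?thesis"
    then have "v = 0\<^sub>v M" using v(1) by (intro eq_vecI) auto
    then show False using v(2) by simp
  qed
  moreover have "(\<Sum>i<M. a j i * v $ i) = 0" if "j < N" for j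
  proof -
    have "0 = (A *\<^sub>v v) $ j" using v that assms by simp
    also have "\<dots> = (\<Sum>i<M. a j i * v $ i)"
      using v(1) that assms by (auto simp: A_def scalar_prod_def lessThan_atLeast0 intro!: sum.cong)
    finally show ?thesis by simp
  qed
  ultimately show ?thesis by (intro exI[of _ "\<lambda>i. v $ i"]) auto
qed

section \<open>Zeros of proper ideals\<close>

definition pideal :: "nat \<Rightarrow> ((nat \<Rightarrow> 'a::field) \<Rightarrow> 'a) set \<Rightarrow> bool" where
  "pideal k J \<longleftrightarrow> (\<lambda>_. 0) \<in> J \<and> (\<forall>f\<in>J. \<forall>g\<in>J. (\<lambda>t. f t + g t) \<in> J) \<and>
    (\<forall>f\<in>J. \<forall>h\<in>polys k. (\<lambda>t. h t * f t) \<in> J)"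

lemma pideal_add: "pideal k J \<Longrightarrow> f \<in> J \<Longrightarrow> g \<in> J \<Longrightarrow> (\<lambda>t. f t + g t) \<in> J"
  unfolding pideal_def by blast

lemma pideal_mult: "pideal k J \<Longrightarrow> f \<in> J \<Longrightarrow> h \<in> polys k \<Longrightarrow> (\<lambda>t. h t * f t) \<in> J"
  unfolding pideal_def by blast

lemma pideal_sum:
  "pideal k J \<Longrightarrow> (\<And>x. x \<in> S \<Longrightarrow> f x \<in> J) \<Longrightarrow> (\<lambda>t. \<Sum>x\<in>S. f x t) \<in> J"
  by (induction S rule: infinite_finite_induct) (auto intro: pideal_add simp: pideal_def)

lemma polys_poly: "x \<in> polys k \<Longrightarrow> (\<lambda>t. poly p (x t)) \<in> polys k"
  by (induction p) (auto intro: polys_zero polys_add polys_mult polys_const)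

lemma pideal_adjoin:
  assumes J: "pideal k J" and x: "x \<in> polys k"
  shows "pideal k {\<lambda>t. j t + x t * g t | j g. j \<in> J \<and> g \<in> polys k}" (is "pideal k ?J'")
    and "J \<subseteq> {\<lambda>t. j t + x t * g t | j g. j \<in> J \<and> g \<in> polys k}"
    and "x \<in> {\<lambda>t. j t + x t * g t | j g. j \<in> J \<and> g \<in> polys k}"
proof -
  have z: "(\<lambda>_. 0) \<in> J" using J by (simp add: pideal_def)
  show "J \<subseteq> ?J'"
  proof
    fix j assume "j \<in> J"
    then show "j \<in> ?J'" by (intro CollectI exI[of _ j] exI[of _ "\<lambda>_. 0"] conjI polys_zero) auto
  qed
  then have "(\<lambda>_. 0) \<in> ?J'" using z by blast
  moreover have "(\<lambda>t. f t + g t) \<in> ?J'" if "f \<in> ?J'" "g \<in> ?J'" for f g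
  proof -
    from that obtain j j' h h' where *: "j \<in> J" "j' \<in> J" "h \<in> polys k" "h' \<in> polys k"
      "f = (\<lambda>t. j t + x t * h t)" "g = (\<lambda>t. j' t + x t * h' t)" by blast
    show ?thesis
      by (rule CollectI, rule exI[of _ "\<lambda>t. j t + j' t"], rule exI[of _ "\<lambda>t. h t + h' t"])
        (intro conjI pideal_add[OF J] polys_add * ext, simp add: *(5,6) algebra_simps)
  qed
  moreover have "(\<lambda>t. h' t * f t) \<in> ?J'" if "f \<in> ?J'" "h' \<in> polys k" for f h'
  proof -
    from that obtain j h where *: "j \<in> J" "h \<in> polys k" "f = (\<lambda>t. j t + x t * h t)" by blast
    show ?thesis
      by (rule CollectI, rule exI[of _ "\<lambda>t. h' t * j t"], rule exI[of _ "\<lambda>t. h' t * h t"])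
        (intro conjI pideal_mult[OF J] polys_mult that(2) *(1,2) ext, simp add: *(3) algebra_simps)
  qed
  ultimately show "pideal k ?J'" unfolding pideal_def by blast
  show "x \<in> ?J'" by (intro CollectI exI[of _ "\<lambda>_. 0"] exI[of _ "\<lambda>_. 1"] conjI z polys_const) simp
qed

text \<open>If adjoining \<open>x - \<tau>\<close> for a root \<tau> of \<open>p\<close> produces 1,
  then \<open>x - \<tau>\<close> is invertible modulo \<open>J\<close> and this factor can be
  cancelled from \<open>p\<close>. Were all factors cancelled, a nonzero constant would lie in
  \<open>J\<close>.\<close>

lemma proper_pideal_extend:
  fixes x :: "(nat \<Rightarrow> 'a::alg_closed_field) \<Rightarrow> 'a"
  assumes J: "pideal k J" "(\<lambda>_. 1) \<notin> J" and x: "x \<in> polys k"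
    and p: "p \<noteq> 0" "(\<lambda>t. poly p (x t)) \<in> J"
  shows "\<exists>\<tau>. (\<lambda>_. 1) \<notin> {\<lambda>t. j t + (x t - \<tau>) * g t | j g. j \<in> J \<and> g \<in> polys k}"
  using p
proof (induction "degree p" arbitrary: p)
  case 0
  obtain a where "p = [:a:]" using degree_eq_zeroE[OF 0(1)[symmetric]] by blast
  with 0(2) have a: "p = [:a:]" "a \<noteq> 0" by auto
  have "(\<lambda>t. (1 / a) * poly p (x t)) \<in> J" by (rule pideal_mult[OF J(1) 0(3) polys_const])
  moreover have "(\<lambda>t. (1 / a) * poly p (x t)) = (\<lambda>_. 1)" using a by simp
  ultimately show ?case using J(2) by simp
next
  case (Suc n)
  obtain \<tau> where "poly p \<tau> = 0"
    using alg_closed_imp_poly_has_root[of p] Suc(2) by auto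
  then obtain p' where p': "p = [:-\<tau>, 1:] * p'" using poly_eq_0_iff_dvd by (metis dvdE)
  have p0: "p' \<noteq> 0" using p' Suc(3) by auto
  have n: "n = degree p'"
  proof -
    have "degree p = degree [:-\<tau>, 1:] + degree p'" unfolding p' using p0 by (intro degree_mult_eq) auto
    then show ?thesis using Suc(2) by simp
  qed
  show ?case
  proof (cases "(\<lambda>_. 1) \<in> {\<lambda>t. j t + (x t - \<tau>) * g t | j g. j \<in> J \<and> g \<in> polys k}")
    case True
    then obtain j g where jg: "(\<lambda>_. 1) = (\<lambda>t. j t + (x t - \<tau>) * g t)" "j \<in> J" "g \<in> polys k" by blast
    \<comment> \<open>This is \<open>p'(x)\<close> times the equation 1 = j + (x - \<tau>) g,
      because \<open>p'(x)\<close> times x - \<tau> is \<open>p(x)\<close>.\<close>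
    have "(\<lambda>t. poly p' (x t) * j t + g t * poly p (x t)) \<in> J"
      using jg by (intro pideal_add[OF J(1)] pideal_mult[OF J(1)] polys_poly x Suc(4)) auto
    moreover have "poly p' (x t) * j t + g t * poly p (x t) = poly p' (x t)" for t
    proof -
      have "poly p' (x t) * j t + g t * poly p (x t) = poly p' (x t) * (j t + (x t - \<tau>) * g t)"
        unfolding p' by (simp add: algebra_simps)
      then show ?thesis using fun_cong[OF jg(1), of t] by simp
    qed
    ultimately have "(\<lambda>t. poly p' (x t)) \<in> J" by simp
    then show ?thesis using Suc(1)[OF n p0] by blast
  qed blast
qed

lemma form_mod_pideal:
  assumes J: "pideal k J" and \<tau>: "\<And>i. i < k \<Longrightarrow> (\<lambda>t. t i - \<tau> i) \<in> J" and "form k d f"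
  shows "(\<lambda>t. f t - f \<tau>) \<in> J"
  using assms(3)
proof (induction rule: form.induct)
  case (form_var i d f)
  have "(\<lambda>t. t i * (f t - f \<tau>) + f \<tau> * (t i - \<tau> i)) \<in> J"
    using form_var by (intro pideal_add[OF J] pideal_mult[OF J] polys_var polys_const \<tau>)
  then show ?case by (simp add: algebra_simps)
next
  case (form_add d f g)
  from pideal_add[OF J form_add(3,4)] show ?case by (simp add: algebra_simps)
qed (use J in \<open>auto simp: pideal_def\<close>)

text \<open>
  A weak Nullstellensatz for ideals of finite codimension: the coordinates are specialised one
  after the other, keeping the ideal proper.
\<close>

lemma pideal_common_zero:
  fixes J :: "((nat \<Rightarrow> 'a::alg_closed_field) \<Rightarrow> 'a) set"
  assumes J: "pideal k J" "(\<lambda>_. 1) \<notin> J"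
    and alg: "\<And>i. i < k \<Longrightarrow> \<exists>p. p \<noteq> 0 \<and> (\<lambda>t. poly p (t i)) \<in> J"
  shows "\<exists>\<tau>. \<forall>f c d. form k d f \<longrightarrow> (\<lambda>t. f t - c) \<in> J \<longrightarrow> f \<tau> = c"
proof -
  have "\<exists>J' \<tau>. pideal k J' \<and> J \<subseteq> J' \<and> (\<lambda>_. 1) \<notin> J' \<and> (\<forall>i<m. (\<lambda>t. t i - \<tau> i) \<in> J')"
    if "m \<le> k" for m using that
  proof (induction m)
    case 0
    then show ?case using J by auto
  next
    case (Suc m)
    then obtain J' \<tau> where J': "pideal k J'" "J \<subseteq> J'" "(\<lambda>_. 1) \<notin> J'" "\<forall>i<m. (\<lambda>t. t i - \<tau> i) \<in> J'"
      by auto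
    obtain p where p: "p \<noteq> 0" "(\<lambda>t. poly p (t m)) \<in> J'" using alg[of m] Suc(2) J'(2) by auto
    have m: "(\<lambda>t. t m) \<in> polys k" using Suc(2) by (intro polys_var) auto
    obtain a where a: "(\<lambda>_. 1) \<notin> {\<lambda>t. j t + (t m - a) * g t | j g. j \<in> J' \<and> g \<in> polys k}"
      using proper_pideal_extend[OF J'(1,3) m p] by blast
    have m': "(\<lambda>t. t m - a) \<in> polys k" using polys_add[OF m polys_const[of "-a"]] by simp
    define J2 where "J2 = {\<lambda>t. j t + (t m - a) * g t | j g. j \<in> J' \<and> g \<in> polys k}"
    note adj = pideal_adjoin[OF J'(1) m', folded J2_def]
    have "(\<lambda>t. t i - (\<tau>(m := a)) i) \<in> J2" if i: "i < Suc m" for i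
    proof (cases "i = m")
      case True
      then show ?thesis using adj(3) by simp
    next
      case False
      then have "(\<lambda>t. t i - (\<tau>(m := a)) i) \<in> J'" using J'(4) i by simp
      then show ?thesis using adj(2) by blast
    qed
    moreover have "J \<subseteq> J2" using J'(2) adj(2) by (rule order_trans)
    ultimately show ?case using adj(1) a[folded J2_def] by blast
  qed
  from this[of k] obtain J' \<tau> where J': "pideal k J'" "J \<subseteq> J'" "(\<lambda>_. 1) \<notin> J'"
    "\<And>i. i < k \<Longrightarrow> (\<lambda>t. t i - \<tau> i) \<in> J'" by auto
  have "f \<tau> = c" if f: "form k d f" "(\<lambda>t. f t - c) \<in> J" for f c d
  proof (rule ccontr)
    assume ne: "f \<tau> \<noteq> c"
    \<comment> \<open>Two constants congruent to \<open>f\<close> modulo the ideal differ by an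
      element of it; a nonzero difference could be inverted, giving 1.\<close>
    have "(\<lambda>t. (f t - c) + (-1) * (f t - f \<tau>)) \<in> J'"
      using f J'(2) form_mod_pideal[OF J'(1,4) f(1)]
      by (intro pideal_add[OF J'(1)] pideal_mult[OF J'(1)] polys_const) auto
    then have "(\<lambda>_. f \<tau> - c) \<in> J'" by simp
    from pideal_mult[OF J'(1) this polys_const[of "1 / (f \<tau> - c)"]] show False
      using ne J'(3) by simp
  qed
  then show ?thesis by blast
qed

section \<open>Surjectivity of nearly diagonal maps\<close>

lemma fun_vs_span_base_eq: "x \<in> S \<Longrightarrow> x = y \<Longrightarrow> y \<in> fun_vs.span S"
  using fun_vs.span_base by blast

lemma expos_mono: "m \<le> n \<Longrightarrow> expos k m \<subseteq> expos k n"
  by (auto simp: expos_def)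

lemma sum_funs: "(\<Sum>x\<in>S. f x) = (\<lambda>t. \<Sum>x\<in>S. f x t :: 'a::comm_monoid_add)"
  by (induction S rule: infinite_finite_induct) (auto simp: zero_fun_def plus_fun_def)

lemma inj_on_mon: "inj_on (mon k :: _ \<Rightarrow> (nat \<Rightarrow> 'a::field_char_0) \<Rightarrow> 'a) {\<alpha>. \<forall>i\<ge>k. \<alpha> i = 0}"
proof (rule inj_onI, rule ccontr)
  fix \<alpha> \<beta> :: "nat \<Rightarrow> nat" assume a: "\<alpha> \<in> {\<alpha>. \<forall>i\<ge>k. \<alpha> i = 0}" "\<beta> \<in> {\<alpha>. \<forall>i\<ge>k. \<alpha> i = 0}"
    and e: "mon k \<alpha> = (mon k \<beta> :: (nat \<Rightarrow> 'a) \<Rightarrow> 'a)" and ne: "\<alpha> \<noteq> \<beta>"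
  have "(if \<alpha> = \<alpha> then 1 else - 1 :: 'a) = 0"
    by (rule monomials_independent[of "{\<alpha>, \<beta>}" k "\<lambda>\<gamma>. if \<gamma> = \<alpha> then 1 else - 1"]) (use a e ne in auto)
  then show False by simp
qed

lemma independent_mon:
  assumes "S \<subseteq> {\<alpha>. \<forall>i\<ge>k. \<alpha> i = 0}"
  shows "fun_vs.independent ((mon k :: _ \<Rightarrow> (nat \<Rightarrow> 'a::field_char_0) \<Rightarrow> 'a) ` S)"
proof
  assume "fun_vs.dependent ((mon k :: _ \<Rightarrow> (nat \<Rightarrow> 'a::field_char_0) \<Rightarrow> 'a) ` S)"
  then obtain t :: "((nat \<Rightarrow> 'a) \<Rightarrow> 'a) set" and u v where t: "finite t" "t \<subseteq> mon k ` S"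
    and z: "(\<Sum>v\<in>t. (\<lambda>s. u v * v s)) = 0" and v: "v \<in> t" "u v \<noteq> 0"
    unfolding fun_vs.dependent_explicit by blast
  obtain S' where S': "S' \<subseteq> S" "t = mon k ` S'" using t(2) by (meson subset_image_iff)
  have inj: "inj_on (mon k :: _ \<Rightarrow> (nat \<Rightarrow> 'a) \<Rightarrow> 'a) S'" 
    by (rule inj_on_subset[OF inj_on_mon]) (use S'(1) assms in auto)
  obtain \<alpha> where \<alpha>: "\<alpha> \<in> S'" "v = mon k \<alpha>" using v(1) S'(2) by blast
  have "u (mon k \<alpha>) = 0"
  proof (rule monomials_independent[of S' k "\<lambda>\<alpha>. u (mon k \<alpha>)" \<alpha>])
    show "finite S'" using t(1) inj S'(2) finite_imageD by blast
    show "(\<Sum>\<alpha>\<in>S'. u (mon k \<alpha>) * mon k \<alpha> s) = 0" for s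
      using fun_cong[OF z, of s] unfolding S'(2) sum.reindex[OF inj] by (simp add: sum_funs)
    show "\<beta> i = 0" if "\<beta> \<in> S'" "k \<le> i" for \<beta> i using that S'(1) assms by blast
    show "\<alpha> \<in> S'" by (rule \<alpha>(1))
  qed
  then show False using \<alpha>(2) v(2) by simp
qed

text \<open>\<open>low_degree\<close> consists of finitely many linear conditions. They hold if each
  \<open>F i\<close> is the \<open>d\<close>-th power of the \<open>i\<close>-th variable, since a
  monomial is then either reduced (all exponents below \<open>d\<close>) or a multiple of some
  \<open>F i\<close>, and they survive a generic change of \<open>F\<close>.\<close>

locale spanning_system =
  fixes k d :: nat and F :: "nat \<Rightarrow> (nat \<Rightarrow> 'a::{alg_closed_field,field_char_0}) \<Rightarrow> 'a"
  assumes d: "0 < d" and F: "\<And>i. i < k \<Longrightarrow> form k d (F i)"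
    and low_degree: "\<And>n \<beta>. n \<le> Suc (k * (d - 1)) \<Longrightarrow> \<beta> \<in> expos k n \<Longrightarrow>
      mon k \<beta> \<in> fun_vs.span (mon k ` {\<alpha> \<in> expos k n. \<forall>i. \<alpha> i < d} \<union>
        {\<lambda>t. mon k \<nu> t * F i t | \<nu> i. i < k \<and> d \<le> n \<and> \<nu> \<in> expos k (n - d)})"
begin

definition gens :: "nat \<Rightarrow> ((nat \<Rightarrow> 'a) \<Rightarrow> 'a) set" where
  "gens n = mon k ` {\<alpha> \<in> expos k n. \<forall>i. \<alpha> i < d} \<union>
    {\<lambda>t. mon k \<nu> t * F i t | \<nu> i. i < k \<and> d \<le> n \<and> \<nu> \<in> expos k (n - d)}"

lemma gens_mono: "m \<le> n \<Longrightarrow> gens m \<subseteq> gens n"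
proof
  fix x assume mn: "m \<le> n" and "x \<in> gens m"
  then consider \<alpha> where "\<alpha> \<in> expos k m" "\<forall>i. \<alpha> i < d" "x = mon k \<alpha>"
    | \<nu> i where "i < k" "d \<le> m" "\<nu> \<in> expos k (m - d)" "x = (\<lambda>t. mon k \<nu> t * F i t)"
    unfolding gens_def by blast
  then show "x \<in> gens n"
  proof cases
    case 1
    then show ?thesis unfolding gens_def using expos_mono[OF mn, of k] by blast
  next
    case 2
    then have "d \<le> n" "\<nu> \<in> expos k (n - d)" using expos_mono[OF diff_le_mono[OF mn], of k d] mn by auto
    then show ?thesis unfolding gens_def using 2 by blast
  qed
qed

lemma gens_F: "i < k \<Longrightarrow> d \<le> n \<Longrightarrow> \<nu> \<in> expos k (n - d) \<Longrightarrow> (\<lambda>t. mon k \<nu> t * F i t) \<in> gens n"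
  unfolding gens_def by blast

lemma gensE:
  assumes "x \<in> gens n"
  obtains \<alpha> where "\<alpha> \<in> expos k n" "\<And>i. \<alpha> i < d" "x = mon k \<alpha>"
  | \<nu> i where "i < k" "d \<le> n" "\<nu> \<in> expos k (n - d)" "x = (\<lambda>t. mon k \<nu> t * F i t)"
  using assms unfolding gens_def by blast

text \<open>Reduced monomials have degree at most \<open>k * (d - 1)\<close>, so one more variable
  keeps them within the bound of \<open>low_degree\<close>, while multiples of \<open>F i\<close>
  stay multiples. Thus the property climbs from each degree to the next, and the bound is exactly
  what this step requires.\<close>

lemma mon_span_gens: "\<beta> \<in> expos k n \<Longrightarrow> mon k \<beta> \<in> fun_vs.span (gens n)"
proof (induction n arbitrary: \<beta>)
  case 0
  then show ?case using low_degree[of 0 \<beta>] by (simp add: gens_def)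
next
  case (Suc n)
  show ?case
  proof (cases "Suc n \<le> Suc (k * (d - 1))")
    case True
    then show ?thesis using low_degree[of "Suc n" \<beta>] Suc.prems by (simp add: gens_def)
  next
    case False
    show ?thesis
    proof (cases "\<beta> \<in> expos k n")
      case True
      then show ?thesis using Suc.IH fun_vs.span_mono[OF gens_mono[of n "Suc n"]] by auto
    next
      case 2: False
      then have s: "sum \<beta> {..<k} = Suc n" using Suc.prems by (auto simp: expos_def)
      then obtain j where j: "j < k" "\<beta> j \<noteq> 0" by (metis lessThan_iff nat.distinct(1) sum.neutral)
      define \<beta>' where "\<beta>' = \<beta>(j := \<beta> j - 1)"
      have \<beta>: "\<beta> = inc j \<beta>'" using j by (auto simp: inc_def \<beta>'_def fun_eq_iff)
      have "sum \<beta>' {..<k} = n" using sum_inc[OF j(1), of \<beta>'] s \<beta> by simp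
      moreover have "\<beta>' i = 0" if "k \<le> i" for i using Suc.prems that j(1) by (simp add: expos_def \<beta>'_def)
      ultimately have b: "\<beta>' \<in> expos k n" by (simp add: expos_def)
      have "(\<lambda>t. t j * mon k \<beta>' t) \<in> fun_vs.span (gens (Suc n))"
      proof (rule fun_vs_span_mult[OF Suc.IH[OF b]])
        fix x assume "x \<in> gens n"
        then show "(\<lambda>t. t j * x t) \<in> fun_vs.span (gens (Suc n))"
        proof (cases rule: gensE)
          case (1 \<alpha>)
          have "sum \<alpha> {..<k} \<le> (\<Sum>i<k. d - 1)"
            proof (rule sum_mono)
            fix i show "\<alpha> i \<le> d - 1" using 1(2)[of i] by linarith
          qed
          then have "inc j \<alpha> \<in> expos k (Suc (k * (d - 1)))"
            using expos_inc[OF j(1), of \<alpha> "k * (d - 1)"] 1(1) by (simp add: expos_def)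
          from low_degree[OF order_refl this]
          have "mon k (inc j \<alpha>) \<in> fun_vs.span (gens (Suc (k * (d - 1))))" by (simp add: gens_def)
          then show ?thesis
            using fun_vs.span_mono[OF gens_mono[of "Suc (k * (d - 1))" "Suc n"]] False
            by (auto simp: 1(3) mon_inc[OF j(1), symmetric])
        next
          case (2 \<nu> i)
          have "inc j \<nu> \<in> expos k (Suc n - d)" using expos_inc[OF j(1) 2(3)] 2(2) by (simp add: Suc_diff_le)
          from gens_F[OF 2(1) _ this] 2(2) show ?thesis
            using fun_vs_span_base_eq[of "\<lambda>t. mon k (inc j \<nu>) t * F i t" "gens (Suc n)"
                "\<lambda>t. t j * x t"] by (simp add: 2(4) mon_inc[OF j(1)] mult.assoc)
        qed
      qed
      then show ?thesis unfolding \<beta> by (simp add: mon_inc[OF j(1), abs_def])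
    qed
  qed
qed

text \<open>The products F^\<gamma> t^\<alpha>. For pure powers \<open>F i\<close>, the indices in
  the sets \<open>I n\<close> below give every monomial exactly once, by division of exponents with
  remainder.\<close>

definition G :: "(nat \<Rightarrow> nat) \<times> (nat \<Rightarrow> nat) \<Rightarrow> (nat \<Rightarrow> 'a) \<Rightarrow> 'a" where
  "G x = (\<lambda>t. mon k (fst x) (\<lambda>i. F i t) * mon k (snd x) t)"

definition I :: "nat \<Rightarrow> ((nat \<Rightarrow> nat) \<times> (nat \<Rightarrow> nat)) set" where
  "I n = {(\<gamma>, \<alpha>). (\<forall>i\<ge>k. \<gamma> i = 0) \<and> (\<forall>i\<ge>k. \<alpha> i = 0) \<and> (\<forall>i. \<alpha> i < d) \<and>
    d * sum \<gamma> {..<k} + sum \<alpha> {..<k} \<le> n}"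

text \<open>A multiple of \<open>F i\<close> has a cofactor of degree at most \<open>n - d\<close>,
  which is expanded by induction; multiplying the expansion by \<open>F i\<close> raises one entry
  of \<gamma>. The degree drops because \<open>d\<close> is positive.\<close>

lemma mon_span_G: "\<beta> \<in> expos k n \<Longrightarrow> mon k \<beta> \<in> fun_vs.span (G ` I n)"
proof (induction n arbitrary: \<beta> rule: less_induct)
  case (less n)
  have "gens n \<subseteq> fun_vs.span (G ` I n)"
  proof
    fix x assume "x \<in> gens n"
    then show "x \<in> fun_vs.span (G ` I n)"
    proof (cases rule: gensE)
      case (1 \<alpha>)
      then have "(\<lambda>_. 0, \<alpha>) \<in> I n" by (auto simp: I_def expos_def)
      moreover have "x = G (\<lambda>_. 0, \<alpha>)" unfolding 1(3) G_def by (rule ext) (simp add: mon_zero)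
      ultimately show ?thesis by (simp add: fun_vs.span_base)
    next
      case (2 \<nu> i)
      then have "mon k \<nu> \<in> fun_vs.span (G ` I (n - d))" using less.IH[of "n - d"] d by simp
      then have "(\<lambda>t. F i t * mon k \<nu> t) \<in> fun_vs.span (G ` I n)"
      proof (rule fun_vs_span_mult)
        fix x assume "x \<in> G ` I (n - d)"
        then obtain \<gamma> \<alpha> where x: "x = G (\<gamma>, \<alpha>)" "(\<gamma>, \<alpha>) \<in> I (n - d)" by auto
        have "(inc i \<gamma>, \<alpha>) \<in> I n"
          using x(2) \<open>i < k\<close> \<open>d \<le> n\<close> unfolding I_def mem_Collect_eq case_prod_conv sum_inc[OF \<open>i < k\<close>]
          by (auto simp: inc_def)
        moreover have "(\<lambda>t. F i t * x t) = G (inc i \<gamma>, \<alpha>)"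
          unfolding x G_def by (rule ext) (simp add: mon_inc[OF \<open>i < k\<close>] mult.assoc)
        ultimately show "(\<lambda>t. F i t * x t) \<in> fun_vs.span (G ` I n)"
          by (simp add: fun_vs.span_base)
      qed
      moreover have "(\<lambda>t. F i t * mon k \<nu> t) = x" unfolding 2(4) by (rule ext) (rule mult.commute)
      ultimately show ?thesis by simp
    qed
  qed
  then have "fun_vs.span (gens n) \<subseteq> fun_vs.span (G ` I n)"
    by (simp add: fun_vs.span_minimal)
  then show ?case using mon_span_gens[OF less.prems] by blast
qed

text \<open>Division with remainder of exponents by \<open>d\<close>.\<close>

lemma I_inj: "inj_on (\<lambda>(\<gamma>, \<alpha>). \<lambda>i. d * \<gamma> i + \<alpha> i) (I n)"
  "(\<lambda>(\<gamma>, \<alpha>). \<lambda>i. d * \<gamma> i + \<alpha> i) ` I n \<subseteq> expos k n"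
proof -
  show "inj_on (\<lambda>(\<gamma>, \<alpha>). \<lambda>i. d * \<gamma> i + \<alpha> i) (I n)"
  proof (rule inj_onI, clarify)
    fix \<gamma> \<alpha> \<gamma>' \<alpha>' assume a: "(\<gamma>, \<alpha>) \<in> I n" "(\<gamma>', \<alpha>') \<in> I n"
      and e: "(\<lambda>i. d * \<gamma> i + \<alpha> i) = (\<lambda>i. d * \<gamma>' i + \<alpha>' i)"
    have "\<gamma> i = \<gamma>' i \<and> \<alpha> i = \<alpha>' i" for i
    proof -
      have "\<alpha> i < d" "\<alpha>' i < d" using a by (auto simp: I_def)
      moreover have "d * \<gamma> i + \<alpha> i = d * \<gamma>' i + \<alpha>' i" using fun_cong[OF e, of i] by simp
      ultimately show ?thesis 
        by (metis add_left_cancel d div_less div_mult_self4 less_numeral_extra(3) add_0_right add.commute)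
    qed
    then show "\<gamma> = \<gamma>' \<and> \<alpha> = \<alpha>'" by auto
  qed
  show "(\<lambda>(\<gamma>, \<alpha>). \<lambda>i. d * \<gamma> i + \<alpha> i) ` I n \<subseteq> expos k n"
    by (auto simp: I_def expos_def sum.distrib sum_distrib_left)
qed

lemma finite_I: "finite (I n)"
  using finite_imageD[OF finite_subset[OF I_inj(2) finite_expos] I_inj(1)] .

lemma card_I: "card (I n) \<le> card (expos k n)"
  using card_inj_on_le[OF I_inj finite_expos] .

lemma expos_supp: "expos k n \<subseteq> {\<alpha>. \<forall>i\<ge>k. \<alpha> i = 0}"
  by (auto simp: expos_def)

text \<open>A spanning set with at most as many elements as a basis is independent.\<close>

lemma G_independent: "inj_on G (I n)" "fun_vs.independent (G ` I n)"
proof -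
  let ?M = "mon k ` expos k n :: ((nat \<Rightarrow> 'a) \<Rightarrow> 'a) set"
  have M: "fun_vs.independent ?M" by (rule independent_mon[OF expos_supp])
  have cM: "card ?M = card (expos k n)"
    by (rule card_image[OF inj_on_subset[OF inj_on_mon expos_supp]])
  have sp: "?M \<subseteq> fun_vs.span (G ` I n)" using mon_span_G by blast
  have fG: "finite (G ` I n)" using finite_I by simp
  have c: "card (expos k n) \<le> card (G ` I n)"
    using fun_vs.independent_span_bound[OF fG M sp] cM by simp
  then show "inj_on G (I n)"
    using card_I[of n] card_image_le[OF finite_I, of G n] by (intro eq_card_imp_inj_on[OF finite_I]) simp
  show "fun_vs.independent (G ` I n)"
  proof
    assume "fun_vs.dependent (G ` I n)"
    then obtain a where a: "a \<in> G ` I n" "a \<in> fun_vs.span (G ` I n - {a})"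
      unfolding fun_vs.dependent_def by blast
    have "G ` I n \<subseteq> fun_vs.span (G ` I n - {a})"
    proof
      fix x assume "x \<in> G ` I n"
      then show "x \<in> fun_vs.span (G ` I n - {a})"
        using a(2) by (cases "x = a") (auto intro: fun_vs.span_base)
    qed
    then have "fun_vs.span (G ` I n) \<subseteq> fun_vs.span (G ` I n - {a})"
      by (simp add: fun_vs.span_minimal)
    with sp have "?M \<subseteq> fun_vs.span (G ` I n - {a})" by blast
    from fun_vs.independent_span_bound[OF _ M this] fG cM
    have "card (expos k n) \<le> card (G ` I n - {a})" by simp
    also have "\<dots> < card (G ` I n)" using a(1) fG by (rule card_Diff1_less[rotated])
    also have "\<dots> \<le> card (expos k n)" using card_image_le[OF finite_I, of G n] card_I[of n] by simp
    finally show False by simp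
  qed
qed

lemma I_mono: "m \<le> n \<Longrightarrow> I m \<subseteq> I n"
  by (auto simp: I_def)

lemma G_independent_all: "inj_on G (\<Union>n. I n)" "fun_vs.independent (G ` (\<Union>n. I n))"
proof -
  have "inj_on G (\<Union>n\<in>UNIV. I n)"
  proof (rule inj_on_UNION_chain)
    show "I m \<subseteq> I n \<or> I n \<subseteq> I m" for m n using I_mono nat_le_linear by blast
  qed (rule G_independent(1))
  then show "inj_on G (\<Union>n. I n)" .
  have "fun_vs.independent (\<Union>(range (\<lambda>n. G ` I n)))"
  proof (rule fun_vs.independent_Union_directed)
    fix c d assume "c \<in> range (\<lambda>n. G ` I n)" "d \<in> range (\<lambda>n. G ` I n)"
    then obtain m n where "c = G ` I m" "d = G ` I n" by blast
    then show "c \<subseteq> d \<or> d \<subseteq> c" using I_mono[of m n] I_mono[of n m] nat_le_linear[of m n] by blast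
  qed (use G_independent(2) in blast)
  then show "fun_vs.independent (G ` (\<Union>n. I n))" by (simp add: image_UN)
qed

section \<open>The ideal of a fibre of \<open>F\<close>: properness and finite codimension\<close>

definition J :: "(nat \<Rightarrow> 'a) \<Rightarrow> ((nat \<Rightarrow> 'a) \<Rightarrow> 'a) set" where
  "J c = {\<lambda>t. \<Sum>i<k. (F i t - c i) * h i t | h. \<forall>i<k. h i \<in> polys k}"

lemma pideal_J: "pideal k (J c)"
  unfolding pideal_def
proof (intro conjI ballI)
  show "(\<lambda>_. 0) \<in> J c"
    unfolding J_def by (intro CollectI exI[of _ "\<lambda>_ _. 0"]) (auto intro: polys_zero)
next
  fix f g assume "f \<in> J c" "g \<in> J c"
  then obtain h h' where *: "\<And>i. i < k \<Longrightarrow> h i \<in> polys k" "\<And>i. i < k \<Longrightarrow> h' i \<in> polys k"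
    "f = (\<lambda>t. \<Sum>i<k. (F i t - c i) * h i t)" "g = (\<lambda>t. \<Sum>i<k. (F i t - c i) * h' i t)"
    unfolding J_def by blast
  show "(\<lambda>t. f t + g t) \<in> J c"
    unfolding J_def
  proof (rule CollectI, rule exI[of _ "\<lambda>i t. h i t + h' i t"], intro conjI allI impI)
    show "(\<lambda>t. f t + g t) = (\<lambda>t. \<Sum>i<k. (F i t - c i) * (h i t + h' i t))"
      unfolding * by (simp add: distrib_left sum.distrib)
    show "(\<lambda>t. h i t + h' i t) \<in> polys k" if "i < k" for i using that * by (intro polys_add) auto
  qed
next
  fix f g :: "(nat \<Rightarrow> 'a) \<Rightarrow> 'a" assume "f \<in> J c" and g: "g \<in> polys k"
  then obtain h where *: "\<And>i. i < k \<Longrightarrow> h i \<in> polys k" "f = (\<lambda>t. \<Sum>i<k. (F i t - c i) * h i t)"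
    unfolding J_def by blast
  show "(\<lambda>t. g t * f t) \<in> J c"
    unfolding J_def
  proof (rule CollectI, rule exI[of _ "\<lambda>i t. g t * h i t"], intro conjI allI impI)
    show "(\<lambda>t. g t * f t) = (\<lambda>t. \<Sum>i<k. (F i t - c i) * (g t * h i t))"
      unfolding * sum_distrib_left by (simp add: mult.left_commute)
    show "(\<lambda>t. g t * h i t) \<in> polys k" if "i < k" for i using that * g by (intro polys_mult) auto
  qed
qed

lemma J_mult: "i < k \<Longrightarrow> h \<in> polys k \<Longrightarrow> (\<lambda>t. (F i t - c i) * h t) \<in> J c"
  unfolding J_def
proof (rule CollectI, rule exI[of _ "\<lambda>j t. if j = i then h t else 0"], intro conjI allI impI ext)
  assume i: "i < k" and h: "h \<in> polys k"
  show "(F i t - c i) * h t = (\<Sum>j<k. (F j t - c j) * (if j = i then h t else 0))" for t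
    using i by (simp add: if_distrib[of "(*) _"] sum.delta cong: if_cong)
  show "(\<lambda>t. if j = i then h t else 0) \<in> polys k" for j using h polys_zero by (cases "j = i") auto
qed

lemma polys_span_G: "h \<in> polys k \<Longrightarrow> h \<in> fun_vs.span (G ` (\<Union>n. I n))"
proof -
  have "mon k \<alpha> \<in> fun_vs.span (G ` (\<Union>n. I n))" if "\<forall>i\<ge>k. \<alpha> i = 0" for \<alpha>
  proof -
    have "\<alpha> \<in> expos k (sum \<alpha> {..<k})" using that by (auto simp: expos_def)
    from mon_span_G[OF this] show ?thesis
      by (rule set_mp[OF fun_vs.span_mono, rotated]) blast
  qed
  then show "h \<in> polys k \<Longrightarrow> h \<in> fun_vs.span (G ` (\<Union>n. I n))"
    unfolding polys_def
    using fun_vs.span_minimal[OF _ fun_vs.subspace_span, of "mon k ` {\<alpha>. \<forall>i\<ge>k. \<alpha> i = 0}"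
        "G ` (\<Union>n. I n)"] by blast
qed

text \<open>
  The functional sending \<open>F\<^sup>\<gamma> t\<^sup>\<alpha>\<close> to \<open>c\<^sup>\<gamma>\<close> for \<open>\<alpha> = 0\<close> and to 0 for the other remainders \<open>\<alpha>\<close>
  vanishes on the ideal, but not at 1.
\<close>

lemma J_proper: "(\<lambda>_. 1) \<notin> J c"
proof
  have ring: "(f - e) * (b * x + y) = b * (f * x) + (- (b * e)) * x + (f - e) * y" for f e b x y :: 'a
    by (simp add: algebra_simps)
  interpret vp: vector_space_pair "\<lambda>(c::'a) (f::(nat \<Rightarrow> 'a) \<Rightarrow> 'a) t. c * f t" "(*) :: 'a \<Rightarrow> 'a \<Rightarrow> 'a"
    by unfold_locales (auto simp: algebra_simps)
  define w where "w = (\<lambda>x::(nat \<Rightarrow> nat) \<times> (nat \<Rightarrow> nat). if snd x = (\<lambda>_. 0) then mon k (fst x) c else 0)"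
  obtain \<psi> where \<psi>: "Vector_Spaces.linear (\<lambda>(c::'a) (f::(nat \<Rightarrow> 'a) \<Rightarrow> 'a) t. c * f t) (*) \<psi>"
    "\<And>y. y \<in> G ` (\<Union>n. I n) \<Longrightarrow> \<psi> y = w (inv_into (\<Union>n. I n) G y)"
    using vp.linear_independent_extend[OF G_independent_all(2), of "\<lambda>y. w (inv_into (\<Union>n. I n) G y)"] by blast
  interpret l: Vector_Spaces.linear "\<lambda>(c::'a) (f::(nat \<Rightarrow> 'a) \<Rightarrow> 'a) t. c * f t" "(*)" \<psi> by fact
  have G: "\<psi> (G x) = w x" if "x \<in> (\<Union>n. I n)" for x
    using \<psi>(2)[of "G x"] that inv_into_f_f[OF G_independent_all(1) that] by simp
  \<comment> \<open>Multiplication by \<open>F i\<close> raises entry \<open>i\<close> of \<gamma>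
    by one and so multiplies the value of \<psi> by \<open>c i\<close>. Hence \<psi> kills
    \<open>F i - c i\<close> times every product F^\<gamma> t^\<alpha>, and these products
    span.\<close>
  have z: "\<psi> (\<lambda>t. (F i t - c i) * h t) = 0" if i: "i < k" and h: "h \<in> polys k" for i h
    using polys_span_G[OF h]
  proof (induction rule: fun_vs.span_induct_alt)
    case base
    have "(\<lambda>t. (F i t - c i) * 0 t) = (0 :: (nat \<Rightarrow> 'a) \<Rightarrow> 'a)" by (simp add: fun_eq_iff)
    then show ?case by (simp add: l.zero)
  next
    case (step b x y)
    then obtain \<gamma> \<alpha> n where x: "x = G (\<gamma>, \<alpha>)" "(\<gamma>, \<alpha>) \<in> I n" by auto
    have "(inc i \<gamma>, \<alpha>) \<in> I (n + d)"
      using x(2) i unfolding I_def mem_Collect_eq case_prod_conv sum_inc[OF i]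
      by (auto simp: inc_def)
    then have 1: "\<psi> (G (inc i \<gamma>, \<alpha>)) = c i * w (\<gamma>, \<alpha>)"
      by (subst G) (auto simp: w_def mon_inc[OF i])
    have 2: "\<psi> (G (\<gamma>, \<alpha>)) = w (\<gamma>, \<alpha>)" using x(2) by (intro G) blast
    have 3: "F i t * x t = G (inc i \<gamma>, \<alpha>) t" for t
      unfolding x(1) G_def fst_conv snd_conv mon_inc[OF i] by (rule mult.assoc[symmetric])
    have "(\<lambda>t. (F i t - c i) * ((\<lambda>t. b * x t) + y) t) =
        (\<lambda>t. b * G (inc i \<gamma>, \<alpha>) t) + (\<lambda>t. (- (b * c i)) * x t) + (\<lambda>t. (F i t - c i) * y t)"
      unfolding plus_fun_def 3[symmetric] by (rule ext) (rule ring)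
    then have "\<psi> (\<lambda>t. (F i t - c i) * ((\<lambda>t. b * x t) + y) t) =
        b * \<psi> (G (inc i \<gamma>, \<alpha>)) + (- (b * c i)) * \<psi> x + \<psi> (\<lambda>t. (F i t - c i) * y t)"
      by (simp only: l.add l.scale)
    also have "\<dots> = 0" unfolding 1 step(2) x(1) 2 by simp
    finally show ?case .
  qed
  assume "(\<lambda>_. 1) \<in> J c"
  then obtain h where h: "\<And>i. i < k \<Longrightarrow> h i \<in> polys k" "(\<lambda>_. 1) = (\<lambda>t. \<Sum>i<k. (F i t - c i) * h i t)"
    unfolding J_def by blast
  have "(\<lambda>_. 0, \<lambda>_. 0) \<in> I 0" using d by (auto simp: I_def)
  then have "\<psi> (G (\<lambda>_. 0, \<lambda>_. 0)) = w (\<lambda>_. 0, \<lambda>_. 0)" by (intro G) blast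
  moreover have "G (\<lambda>_. 0, \<lambda>_. 0) = (\<lambda>_. 1)" by (auto simp: G_def mon_zero)
  ultimately have 1: "\<psi> (\<lambda>_. 1) = 1" by (simp add: w_def mon_zero)
  have "(\<lambda>t. \<Sum>i<k. (F i t - c i) * h i t) = (\<Sum>i<k. (\<lambda>t. (F i t - c i) * h i t))"
    by (simp add: sum_funs)
  then have "\<psi> (\<lambda>_. 1) = (\<Sum>i<k. \<psi> (\<lambda>t. (F i t - c i) * h i t))"
    unfolding h(2) by (simp add: l.sum)
  also have "\<dots> = 0" using z h(1) by simp
  finally show False using 1 by simp
qed

definition Box :: "(nat \<Rightarrow> nat) set" where
  "Box = {\<alpha>. (\<forall>i\<ge>k. \<alpha> i = 0) \<and> (\<forall>i. \<alpha> i < d)}"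

lemma finite_Box: "finite Box"
proof (rule finite_subset)
  show "Box \<subseteq> expos k (\<Sum>i<k. d)"
    by (auto simp: Box_def expos_def less_imp_le simp del: sum_constant intro!: sum_mono)
qed (rule finite_expos)

text \<open>Modulo the ideal, \<open>F i\<close> can be replaced by the constant \<open>c i\<close>,
  which lowers the degree. So the finitely many reduced monomials span the quotient.\<close>

lemma reduce_mod_J:
  assumes "h \<in> polys k"
  shows "\<exists>a. (\<lambda>t. h t - (\<Sum>\<alpha>\<in>Box. a \<alpha> * mon k \<alpha> t)) \<in> J c"
proof -
  define N where "N = {h. \<exists>a. (\<lambda>t. h t - (\<Sum>\<alpha>\<in>Box. a \<alpha> * mon k \<alpha> t)) \<in> J c}"
  have J0: "(\<lambda>_. 0) \<in> J c" using pideal_J by (simp add: pideal_def)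
  have N: "fun_vs.subspace N"
    unfolding fun_vs.subspace_def
  proof (intro conjI ballI allI)
    show "0 \<in> N" unfolding N_def by (intro CollectI exI[of _ "\<lambda>_. 0"]) (simp add: J0)
  next
    fix f g assume "f \<in> N" "g \<in> N"
    then obtain a b where "(\<lambda>t. f t - (\<Sum>\<alpha>\<in>Box. a \<alpha> * mon k \<alpha> t)) \<in> J c"
      "(\<lambda>t. g t - (\<Sum>\<alpha>\<in>Box. b \<alpha> * mon k \<alpha> t)) \<in> J c" unfolding N_def by blast
    from pideal_add[OF pideal_J this] show "f + g \<in> N"
      unfolding N_def by (intro CollectI exI[of _ "\<lambda>\<alpha>. a \<alpha> + b \<alpha>"])
        (simp add: distrib_right sum.distrib algebra_simps)
  next
    fix f :: "(nat \<Rightarrow> 'a) \<Rightarrow> 'a" and b :: 'a assume "f \<in> N"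
    then obtain a where "(\<lambda>t. f t - (\<Sum>\<alpha>\<in>Box. a \<alpha> * mon k \<alpha> t)) \<in> J c" unfolding N_def by blast
    from pideal_mult[OF pideal_J this polys_const[of b]] show "(\<lambda>t. b * f t) \<in> N"
      unfolding N_def by (intro CollectI exI[of _ "\<lambda>\<alpha>. b * a \<alpha>"])
        (simp add: right_diff_distrib sum_distrib_left mult.assoc)
  qed
  have mon: "mon k \<beta> \<in> N" if "\<beta> \<in> expos k n" for n \<beta> using that
  proof (induction n arbitrary: \<beta> rule: less_induct)
    case (less n)
    have "gens n \<subseteq> N"
    proof
      fix x assume "x \<in> gens n"
      then show "x \<in> N"
      proof (cases rule: gensE)
        case (1 \<alpha>)
        then have \<alpha>: "\<alpha> \<in> Box" by (auto simp: Box_def expos_def)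
        have "(\<lambda>t. x t - (\<Sum>\<beta>\<in>Box. (if \<beta> = \<alpha> then 1 else 0) * mon k \<beta> t)) = (\<lambda>_. 0)"
          using \<alpha> finite_Box by (simp add: 1(3) if_distrib[of "\<lambda>x. x * _"] cong: if_cong)
        then show ?thesis unfolding N_def using J0 by (intro CollectI exI[of _ "\<lambda>\<beta>. if \<beta> = \<alpha> then 1 else 0"]) simp
      next
        case (2 \<nu> i)
        then have "mon k \<nu> \<in> N" using less.IH[of "n - d"] d by simp
        then obtain a where a: "(\<lambda>t. mon k \<nu> t - (\<Sum>\<alpha>\<in>Box. a \<alpha> * mon k \<alpha> t)) \<in> J c" unfolding N_def by blast
        have "mon k \<nu> \<in> polys k"
          unfolding polys_def using 2(3) by (intro fun_vs.span_base) (auto simp: expos_def)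
        \<comment> \<open>First \<open>F i\<close> is replaced by \<open>c i\<close>, then the
          remaining monomial by its own reduction.\<close>
        from pideal_add[OF pideal_J J_mult[OF 2(1) this] pideal_mult[OF pideal_J a polys_const[of "c i"]]]
        have "(\<lambda>t. x t - (\<Sum>\<alpha>\<in>Box. c i * a \<alpha> * mon k \<alpha> t)) \<in> J c"
          unfolding 2(4) by (simp add: algebra_simps sum_distrib_left)
        then show ?thesis unfolding N_def by (intro CollectI exI[of _ "\<lambda>\<alpha>. c i * a \<alpha>"])
      qed
    qed
    then have "fun_vs.span (gens n) \<subseteq> N" using N by (rule fun_vs.span_minimal)
    then show ?case using mon_span_gens[OF less.prems] by blast
  qed
  have "mon k ` {\<alpha>. \<forall>i\<ge>k. \<alpha> i = 0} \<subseteq> N"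
  proof clarify
    fix \<alpha> :: "nat \<Rightarrow> nat" assume "\<forall>i\<ge>k. \<alpha> i = 0"
    then have "\<alpha> \<in> expos k (sum \<alpha> {..<k})" by (auto simp: expos_def)
    then show "mon k \<alpha> \<in> N" by (rule mon)
  qed
  then have "polys k \<subseteq> N" unfolding polys_def using N by (rule fun_vs.span_minimal)
  then show ?thesis using assms unfolding N_def by blast
qed

text \<open>The quotient is spanned by \<open>B\<close> reduced monomials, so the
  \<open>B + 1\<close> powers of the coordinate with exponents 0 to \<open>B\<close> satisfy a
  linear relation there.\<close>

lemma coordinate_algebraic:
  assumes i: "i < k"
  shows "\<exists>p. p \<noteq> 0 \<and> (\<lambda>t. poly p (t i)) \<in> J c"
proof -
  define B where "B = card Box"
  obtain e where e: "bij_betw e {..<B} Box"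
    using ex_bij_betw_nat_finite[OF finite_Box] unfolding B_def lessThan_atLeast0 by blast
  have "(\<lambda>t. t i ^ l) \<in> polys k" for l
    by (induction l) (auto intro: polys_const polys_mult polys_var[OF i])
  then have "\<forall>l. \<exists>a. (\<lambda>t. t i ^ l - (\<Sum>\<alpha>\<in>Box. a \<alpha> * mon k \<alpha> t)) \<in> J c"
    by (intro allI reduce_mod_J)
  from choice[OF this] obtain a where a: "\<And>l. (\<lambda>t. t i ^ l - (\<Sum>\<alpha>\<in>Box. a l \<alpha> * mon k \<alpha> t)) \<in> J c"
    by blast
  obtain z where z: "\<exists>l<Suc B. z l \<noteq> 0" "\<And>j. j < B \<Longrightarrow> (\<Sum>l<Suc B. a l (e j) * z l) = 0"
    using underdetermined_system[of B "Suc B" "\<lambda>j l. a l (e j)"] by auto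
  define p where "p = (\<Sum>l<Suc B. monom (z l) l)"
  have "coeff p l = z l" if "l < Suc B" for l
    using that by (simp add: p_def coeff_sum sum.delta)
  with z(1) have "p \<noteq> 0" by (metis coeff_0)
  moreover have "poly p (t i) = (\<Sum>l<Suc B. z l * (t i ^ l - (\<Sum>\<alpha>\<in>Box. a l \<alpha> * mon k \<alpha> t)))" for t
  proof -
    have "(\<Sum>l<Suc B. z l * (\<Sum>\<alpha>\<in>Box. a l \<alpha> * mon k \<alpha> t)) = (\<Sum>\<alpha>\<in>Box. (\<Sum>l<Suc B. a l \<alpha> * z l) * mon k \<alpha> t)"
      unfolding sum_distrib_left sum_distrib_right by (subst sum.swap) (simp add: mult_ac)
    also have "\<dots> = 0"
    proof (intro sum.neutral ballI)
      fix \<alpha> assume "\<alpha> \<in> Box"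
      then obtain j where "j < B" "\<alpha> = e j" using e unfolding bij_betw_def by blast
      then show "(\<Sum>l<Suc B. a l \<alpha> * z l) * mon k \<alpha> t = 0" using z(2)[of j] by (simp only: mult_zero_left)
    qed
    finally show ?thesis by (simp add: p_def poly_sum poly_monom right_diff_distrib sum_subtractf del: sum.lessThan_Suc)
  qed
  moreover have "(\<lambda>t. \<Sum>l<Suc B. z l * (t i ^ l - (\<Sum>\<alpha>\<in>Box. a l \<alpha> * mon k \<alpha> t))) \<in> J c"
    by (intro pideal_sum[OF pideal_J] pideal_mult[OF pideal_J a polys_const])
  ultimately show ?thesis by auto
qed

theorem surjective: "\<exists>t. \<forall>i<k. F i t = c i"
proof -
  obtain \<tau> where \<tau>: "\<And>f b e. form k e f \<Longrightarrow> (\<lambda>t. f t - b) \<in> J c \<Longrightarrow> f \<tau> = b"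
    using pideal_common_zero[OF pideal_J J_proper coordinate_algebraic] by blast
  have "F i \<tau> = c i" if "i < k" for i
    using \<tau>[OF F[OF that]] J_mult[OF that polys_const[of 1], of c] by simp
  then show ?thesis by blast
qed

end

text \<open>
  Surjectivity is an open condition at the diagonal map: rewriting the monomials of degree at most
  \<open>k (d - 1) + 1\<close> by \<open>t\<^sub>i\<^sup>d \<mapsto> F\<^sub>i\<close> is a linear map, the identity in the diagonal case, and
  the determinants of these maps are polynomial in the parameter.
\<close>

lemma generic_surjective:
  fixes F :: "nat \<Rightarrow> nat \<Rightarrow> (nat \<Rightarrow> 'a::{alg_closed_field,field_char_0}) \<Rightarrow> 'a"
  assumes d: "0 < d" and F: "\<And>j i. j < L \<Longrightarrow> i < k \<Longrightarrow> form k d (F j i)"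
    and x0: "\<And>i t. i < k \<Longrightarrow> (\<Sum>j<L. x0 j * F j i t) = t i ^ d"
  shows "\<exists>R\<in>polys L. R x0 \<noteq> 0 \<and> (\<forall>x. R x \<noteq> 0 \<longrightarrow> (\<forall>c. \<exists>t. \<forall>i<k. (\<Sum>j<L. x j * F j i t) = c i))"
proof -
  have "\<exists>c. \<forall>t. F j i t = (\<Sum>\<gamma>\<in>hexpos k d. c \<gamma> * mon k \<gamma> t)" if "j < L" "i < k" for j i
    by (rule form_coeffs[OF F[OF that]])
  then obtain c where c: "\<And>j i t. j < L \<Longrightarrow> i < k \<Longrightarrow> F j i t = (\<Sum>\<gamma>\<in>hexpos k d. c j i \<gamma> * mon k \<gamma> t)"
    by metis
  define C where "C = (\<lambda>x i \<gamma>. \<Sum>j<L. x j * c j i \<gamma>)"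
  have C: "(\<Sum>j<L. x j * F j i t) = (\<Sum>\<gamma>\<in>hexpos k d. C x i \<gamma> * mon k \<gamma> t)" if "i < k" for x i t
    unfolding C_def sum_distrib_right
    by (subst sum.swap, intro sum.cong refl) (simp add: c that sum_distrib_left mult_ac)
  define pt where "pt = (\<lambda>i::nat. (\<lambda>_. 0::nat)(i := d))"
  have pt: "pt i \<in> hexpos k d" "mon k (pt i) t = t i ^ d" if "i < k" for i and t :: "nat \<Rightarrow> 'a"
  proof -
    show "pt i \<in> hexpos k d" using that by (auto simp: pt_def hexpos_def sum.delta)
    have "mon k (pt i) t = (\<Prod>j<k. if j = i then t i ^ d else 1)"
      unfolding mon_def pt_def by (intro prod.cong) auto
    then show "mon k (pt i) t = t i ^ d" using that by (simp add: prod.delta)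
  qed
  have C0: "C x0 i \<gamma> = (if \<gamma> = pt i then 1 else 0)" if "i < k" "\<gamma> \<in> hexpos k d" for i \<gamma>
  proof (rule hexpos_coeffs_unique[OF _ that(2)])
    fix t
    show "(\<Sum>\<alpha>\<in>hexpos k d. C x0 i \<alpha> * mon k \<alpha> t) =
        (\<Sum>\<alpha>\<in>hexpos k d. (if \<alpha> = pt i then 1 else 0) * mon k \<alpha> t)"
      unfolding C[OF that(1), symmetric] x0[OF that(1)] using pt[OF that(1)]
      by (simp add: if_distrib[of "\<lambda>x. x * _"] finite_hexpos cong: if_cong)
  qed
  \<comment> \<open>A monomial that is not reduced is rewritten at the first position with exponent
    at least \<open>d\<close>: \<open>red\<close> removes a \<open>d\<close>-th power there, and the
    form of that position takes its place.\<close>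
  define pv where "pv = (\<lambda>\<alpha>::nat \<Rightarrow> nat. LEAST i. d \<le> \<alpha> i)"
  define red where "red = (\<lambda>\<alpha>::nat \<Rightarrow> nat. \<alpha>(pv \<alpha> := \<alpha> (pv \<alpha>) - d))"
  have pv: "d \<le> \<alpha> (pv \<alpha>)" "pv \<alpha> < k" "d \<le> n" "red \<alpha> \<in> expos k (n - d)" "(\<lambda>i. red \<alpha> i + pt (pv \<alpha>) i) = \<alpha>"
    if \<alpha>: "\<alpha> \<in> expos k n" and "\<not> (\<forall>i. \<alpha> i < d)" for \<alpha> n
  proof -
    show 1: "d \<le> \<alpha> (pv \<alpha>)" unfolding pv_def by (rule LeastI_ex) (use that in \<open>auto simp: not_less\<close>)
    show 2: "pv \<alpha> < k"
    proof (rule ccontr)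
      assume "\<not> pv \<alpha> < k"
      then have "\<alpha> (pv \<alpha>) = 0" using \<alpha> by (simp add: expos_def)
      then show False using 1 d by simp
    qed
    show 3: "(\<lambda>i. red \<alpha> i + pt (pv \<alpha>) i) = \<alpha>" using 1 by (auto simp: red_def pt_def)
    have "sum \<alpha> {..<k} = sum (red \<alpha>) {..<k} + sum (pt (pv \<alpha>)) {..<k}"
      by (subst 3[symmetric]) (simp add: sum.distrib)
    also have "sum (pt (pv \<alpha>)) {..<k} = d" using pt(1)[OF 2] by (simp add: hexpos_def)
    finally have s: "sum (red \<alpha>) {..<k} + d \<le> n" using \<alpha> by (simp add: expos_def)
    then show "d \<le> n" by simp
    have "red \<alpha> i = 0" if "k \<le> i" for i using \<alpha> that 2 by (simp add: red_def expos_def)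
    then show "red \<alpha> \<in> expos k (n - d)" using s by (simp add: expos_def)
  qed
  \<comment> \<open>Row \<alpha> holds the coefficients of the rewritten monomial; reduced monomials
    are left alone. At \<open>x0\<close> the replacing form is the removed power itself, so the
    matrix is the identity.\<close>
  define ent where "ent = (\<lambda>x \<alpha> \<beta>. if \<forall>i. \<alpha> i < d then if \<alpha> = \<beta> then 1 else 0 else
    (\<Sum>\<gamma>\<in>hexpos k d. if (\<lambda>i. red \<alpha> i + \<gamma> i) = \<beta> then C x (pv \<alpha>) \<gamma> else 0))"
  have ent0: "ent x0 \<alpha> \<beta> = (if \<alpha> = \<beta> then 1 else 0)" if "\<alpha> \<in> expos k n" for \<alpha> \<beta> n
  proof (cases "\<forall>i. \<alpha> i < d")
    case False
    note pv = pv[OF that False]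
    have "ent x0 \<alpha> \<beta> = (\<Sum>\<gamma>\<in>hexpos k d. if \<gamma> = pt (pv \<alpha>) then if \<alpha> = \<beta> then 1 else 0 else 0)"
      unfolding ent_def if_not_P[OF False] by (intro sum.cong refl) (use C0[OF pv(2)] pv(5) in auto)
    then show ?thesis using pt(1)[OF pv(2)] finite_hexpos by simp
  qed (simp add: ent_def)
  have ent_polys: "(\<lambda>x. ent x \<alpha> \<beta>) \<in> polys L" for \<alpha> \<beta>
  proof (cases "\<forall>i. \<alpha> i < d")
    case True
    then show ?thesis unfolding ent_def by (simp add: polys_const)
  next
    case False
    have "(\<lambda>x. C x i \<gamma>) \<in> polys L" for i \<gamma>
      unfolding C_def by (intro polys_sum polys_mult polys_var polys_const) auto
    then have "(\<lambda>x. if b then C x i \<gamma> else 0) \<in> polys L" for b i \<gamma> by (cases b) (auto intro: polys_zero)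
    then show ?thesis unfolding ent_def if_not_P[OF False] by (intro polys_sum)
  qed
  define N where "N = (\<lambda>n. card (expos k n))"
  have "\<exists>e. bij_betw e {..<N n} (expos k n)" for n
    using ex_bij_betw_nat_finite[OF finite_expos] unfolding N_def lessThan_atLeast0 by blast
  then obtain e where e: "\<And>n. bij_betw (e n) {..<N n} (expos k n)" by metis
  have e_in: "e n a \<in> expos k n" if "a < N n" for n a using e[of n] that unfolding bij_betw_def by auto
  define A where "A = (\<lambda>n x. mat (N n) (N n) (\<lambda>(a, b). ent x (e n a) (e n b)))"
  define \<delta> where "\<delta> = Suc (k * (d - 1))"
  \<comment> \<open>One determinant for every degree bound in \<open>low_degree\<close>; a nonzero
    product makes all the matrices invertible together.\<close>
  define R where "R = (\<lambda>x. \<Prod>n\<le>\<delta>. det (A n x))"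
  have "R \<in> polys L" unfolding R_def A_def by (intro polys_prod polys_det ent_polys)
  moreover have "R x0 \<noteq> 0"
  proof -
    have "A n x0 = 1\<^sub>m (N n)" for n
    proof (rule eq_matI)
      fix a b assume ab: "a < dim_row (1\<^sub>m (N n))" "b < dim_col (1\<^sub>m (N n))"
      then have "e n a = e n b \<longleftrightarrow> a = b" using e[of n] unfolding bij_betw_def inj_on_def by auto
      then show "A n x0 $$ (a, b) = 1\<^sub>m (N n) $$ (a, b)"
        using ab ent0[OF e_in[of a n]] by (simp add: A_def)
    qed (auto simp: A_def)
    then show ?thesis by (simp add: R_def)
  qed
  moreover have "\<exists>t. \<forall>i<k. (\<Sum>j<L. x j * F j i t) = y i" if R: "R x \<noteq> 0" for x y
  proof -
    let ?F = "\<lambda>i t. \<Sum>j<L. x j * F j i t"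
    have "spanning_system k d ?F"
    proof
      show "0 < d" by (rule d)
      show "form k d (?F i)" if "i < k" for i
        using that F by (intro form_sum form_scale) auto
      fix n \<beta> assume n: "n \<le> Suc (k * (d - 1))" and \<beta>: "\<beta> \<in> expos k n"
      let ?S = "mon k ` {\<alpha> \<in> expos k n. \<forall>i. \<alpha> i < d} \<union>
        {\<lambda>t. mon k \<nu> t * ?F i t | \<nu> i. i < k \<and> d \<le> n \<and> \<nu> \<in> expos k (n - d)}"
      have row: "(\<lambda>t. \<Sum>b<N n. ent x \<alpha> (e n b) * mon k (e n b) t) \<in> ?S" if \<alpha>: "\<alpha> \<in> expos k n" for \<alpha>
      proof -
        have eq: "(\<Sum>b<N n. ent x \<alpha> (e n b) * mon k (e n b) t) = (\<Sum>\<beta>\<in>expos k n. ent x \<alpha> \<beta> * mon k \<beta> t)" for t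
          using sum.reindex_bij_betw[OF e[of n], of "\<lambda>\<beta>. ent x \<alpha> \<beta> * mon k \<beta> t"] .
        show ?thesis
        proof (cases "\<forall>i. \<alpha> i < d")
          case True
          then have "(\<Sum>\<beta>\<in>expos k n. ent x \<alpha> \<beta> * mon k \<beta> t) = mon k \<alpha> t" for t
            using \<alpha> finite_expos[of k n] by (simp add: ent_def if_distrib[of "\<lambda>x. x * _"] cong: if_cong)
          then show ?thesis unfolding eq using True \<alpha> by simp
        next
          case False
          note pv = pv[OF \<alpha> False]
          have im: "(\<lambda>\<gamma> i. red \<alpha> i + \<gamma> i) ` hexpos k d \<subseteq> expos k n"
            using pv(3,4) by (auto simp: expos_def hexpos_def sum.distrib)
          have "(\<Sum>\<beta>\<in>expos k n. ent x \<alpha> \<beta> * mon k \<beta> t) = mon k (red \<alpha>) t * ?F (pv \<alpha>) t" for t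
          proof -
            have "(\<Sum>\<beta>\<in>expos k n. ent x \<alpha> \<beta> * mon k \<beta> t) =
                (\<Sum>\<gamma>\<in>hexpos k d. mon k (\<lambda>i. red \<alpha> i + \<gamma> i) t * C x (pv \<alpha>) \<gamma>)"
              unfolding sum_shift_index[OF finite_hexpos finite_expos im, of "\<lambda>\<beta>. mon k \<beta> t"]
                ent_def if_not_P[OF False] by (simp add: mult.commute)
            then show ?thesis unfolding C[OF pv(2)] by (simp add: mon_add sum_distrib_left mult_ac)
          qed
          then show ?thesis unfolding eq using pv(2,3,4) by blast
        qed
      qed
      have "det (A n x) \<noteq> 0"
        using R n unfolding R_def \<delta>_def by (metis atMost_iff finite_atMost prod_zero_iff)
      moreover have A: "A n x \<in> carrier_mat (N n) (N n)" by (simp add: A_def)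
      ultimately obtain B where B: "B \<in> carrier_mat (N n) (N n)" "B * A n x = 1\<^sub>m (N n)"
        using det_non_zero_imp_unit[OF A] unfolding Units_def ring_mat_def by auto
      obtain b where b: "b < N n" "\<beta> = e n b" using \<beta> e[of n] unfolding bij_betw_def by auto
      \<comment> \<open>The inverse matrix writes each monomial as a combination of the rows, and by
        \<open>row\<close> these are the generators required in
        \<open>spanning_system\<close>.\<close>
      have "mon k \<beta> t = (\<Sum>a<N n. B $$ (b, a) * (\<Sum>b'<N n. ent x (e n a) (e n b') * mon k (e n b') t))" for t
      proof -
        have "(\<Sum>a<N n. B $$ (b, a) * (\<Sum>b'<N n. ent x (e n a) (e n b') * mon k (e n b') t)) =
            (\<Sum>b'<N n. (\<Sum>a<N n. B $$ (b, a) * ent x (e n a) (e n b')) * mon k (e n b') t)"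
          unfolding sum_distrib_left sum_distrib_right by (subst sum.swap) (simp add: mult.assoc)
        also have "\<dots> = (\<Sum>b'<N n. (B * A n x) $$ (b, b') * mon k (e n b') t)"
          using B(1) b(1) by (intro sum.cong refl)
            (auto simp: A_def scalar_prod_def lessThan_atLeast0 intro!: arg_cong[of _ _ "\<lambda>x. x * _"] sum.cong)
        also have "\<dots> = mon k \<beta> t"
          unfolding B(2) using b by (simp add: if_distrib[of "\<lambda>x. x * _"] cong: if_cong)
        finally show ?thesis by simp
      qed
      then have "mon k \<beta> = (\<Sum>a<N n. (\<lambda>t. B $$ (b, a) * (\<Sum>b'<N n. ent x (e n a) (e n b') * mon k (e n b') t)))"
        unfolding sum_funs by (rule ext)
      also have "\<dots> \<in> fun_vs.span ?S"
        by (intro fun_vs.span_sum fun_vs.span_scale fun_vs.span_base row e_in) simp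
      finally show "mon k \<beta> \<in> fun_vs.span ?S" .
    qed
    then interpret spanning_system k d ?F .
    show ?thesis by (rule surjective)
  qed
  ultimately show ?thesis by blast
qed

section \<open>Power sums on zero sets of forms of lower degree\<close>

lemma card_simple_roots:
  fixes p :: "'a::alg_closed_field poly"
  assumes "p \<noteq> 0" "\<And>x. poly p x = 0 \<Longrightarrow> poly (pderiv p) x \<noteq> 0"
  shows "degree p \<le> card {x. poly p x = 0}"
  using assms
proof (induction "degree p" arbitrary: p)
  case (Suc n)
  obtain x where x: "poly p x = 0" using alg_closed_imp_poly_has_root[of p] Suc(2) by auto
  then obtain q where q: "p = [:-x, 1:] * q" using poly_eq_0_iff_dvd by (metis dvdE)
  have q0: "q \<noteq> 0" using q Suc(3) by auto
  have "degree p = degree [:-x, 1:] + degree q" unfolding q using q0 by (intro degree_mult_eq) auto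
  then have n: "n = degree q" using Suc(2) by simp
  \<comment> \<open>The product rule shows both that the roots of \<open>q\<close> are simple and
    that \<open>x\<close> is not among them, so the count grows with the degree.\<close>
  have pd: "poly (pderiv p) y = poly q y + (y - x) * poly (pderiv q) y" for y
    unfolding q pderiv_mult by (simp add: pderiv_pCons algebra_simps)
  have "poly (pderiv q) y \<noteq> 0" if "poly q y = 0" for y
    using Suc(4)[of y] that pd[of y] by (auto simp: q)
  then have IH: "n \<le> card {y. poly q y = 0}" using Suc(1)[OF n q0] n by simp
  have "poly q x \<noteq> 0" using Suc(4)[OF x] pd[of x] by simp
  moreover have "{y. poly p y = 0} = insert x {y. poly q y = 0}" unfolding q by auto
  moreover have "finite {y. poly q y = 0}" using poly_roots_finite[OF q0] .
  ultimately show ?case using IH Suc(2) by simp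
qed simp

text \<open>In characteristic 0 there are \<open>e\<close> distinct roots of x^e - 1. If they all
  satisfied x^d = 1, they would be roots of x^r - 1 for the remainder r = d mod e, which is positive
  and smaller than \<open>e\<close>.\<close>

lemma exists_root_of_unity:
  assumes "0 < e" "\<not> e dvd d"
  shows "\<exists>\<zeta>::'a::{alg_closed_field,field_char_0}. \<zeta> ^ e = 1 \<and> \<zeta> ^ d \<noteq> 1"
proof (rule ccontr)
  assume "\<not> ?thesis"
  then have all: "\<zeta> ^ d = 1" if "\<zeta> ^ e = 1" for \<zeta> :: 'a using that by blast
  define r where "r = d mod e"
  have r: "0 < r" "r < e" using assms by (simp_all add: r_def mod_greater_zero_iff_not_dvd)
  have r1: "\<zeta> ^ r = 1" if "\<zeta> ^ e = 1" for \<zeta> :: 'a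
  proof -
    have "\<zeta> ^ d = \<zeta> ^ (e * (d div e) + r)" by (simp add: r_def)
    then show ?thesis using all[OF that] that by (simp add: power_add power_mult)
  qed
  let ?p = "\<lambda>n. monom 1 n - 1 :: 'a poly"
  have p: "poly (?p n) x = x ^ n - 1" for n x by (simp add: poly_monom)
  have deg: "degree (?p n) = n" if "0 < n" for n
    using that degree_add_eq_left[of "- 1" "monom (1::'a) n"] by (simp add: degree_monom_eq)
  have ne: "?p n \<noteq> 0" if "0 < n" for n using deg[OF that] that by auto
  have "poly (pderiv (?p e)) x \<noteq> 0" if "poly (?p e) x = 0" for x
  proof -
    have "x ^ e = 1" using that p by simp
    then have "x \<noteq> 0" using assms(1) by (auto simp: power_0_left)
    then show ?thesis using assms(1) by (simp add: pderiv_diff pderiv_monom poly_monom)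
  qed
  then have "e \<le> card {x. poly (?p e) x = 0}"
    using card_simple_roots[OF ne[OF assms(1)]] deg[OF assms(1)] by simp
  also have "\<dots> \<le> card {x. poly (?p r) x = 0}"
    using r1 poly_roots_finite[OF ne[OF r(1)]] by (intro card_mono) (auto simp: poly_monom)
  also have "\<dots> \<le> r" using card_poly_roots_bound[OF ne[OF r(1)]] deg[OF r(1)] by simp
  finally show False using r(2) by simp
qed

section \<open>Power sums on linear subspaces and on zero sets of diagonal forms\<close>

lemma underdetermined_system_on:
  fixes a :: "nat \<Rightarrow> 'i \<Rightarrow> 'a::field"
  assumes "finite T" "N < card T"
  shows "\<exists>z. (\<forall>l. l \<notin> T \<longrightarrow> z l = 0) \<and> (\<exists>l\<in>T. z l \<noteq> 0) \<and> (\<forall>j<N. (\<Sum>l\<in>T. a j l * z l) = 0)"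
proof -
  obtain e where e: "bij_betw e {..<card T} T"
    using ex_bij_betw_nat_finite[OF assms(1)] unfolding lessThan_atLeast0 by blast
  obtain z where z: "\<exists>i<card T. z i \<noteq> 0" "\<And>j. j < N \<Longrightarrow> (\<Sum>i<card T. a j (e i) * z i) = 0"
    using underdetermined_system[OF assms(2), of "\<lambda>j i. a j (e i)"] by auto
  define z' where "z' = (\<lambda>l. if l \<in> T then z (inv_into {..<card T} e l) else 0)"
  have z': "z' (e i) = z i" if "i < card T" for i
    using that e by (auto simp: z'_def bij_betw_def)
  have "(\<Sum>l\<in>T. a j l * z' l) = (\<Sum>i<card T. a j (e i) * z i)" for j
    by (subst sum.reindex_bij_betw[OF e, symmetric]) (simp add: z')
  then have "\<forall>j<N. (\<Sum>l\<in>T. a j l * z' l) = 0" using z(2) by simp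
  moreover have "\<exists>l\<in>T. z' l \<noteq> 0" using z(1) z' e by (metis bij_betwE lessThan_iff)
  ultimately show ?thesis by (intro exI[of _ z']) (auto simp: z'_def)
qed

text \<open>Choose a maximal set \<open>S\<close> of coordinates that can be prescribed freely on
  the kernel \<open>W\<close>. At most \<open>N\<close> coordinates are left over, since a nonzero
  vector of \<open>W\<close> supported off \<open>S\<close> would enlarge \<open>S\<close>. So
  \<open>S\<close> has more than \<open>N\<close> elements and carries a nonzero \<open>v\<close> in
  \<open>W\<close>. If \<open>v a\<close> is nonzero and \<open>z\<close> in \<open>W\<close>
  restricts on \<open>S\<close> to the unit vector at \<open>a\<close>, then the derivative at 0 of
  the power sum along \<open>z + s v\<close> is \<open>k\<close> times \<open>v a\<close>: off
  \<open>S\<close> the vector \<open>v\<close> vanishes, and on \<open>S\<close> away from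
  \<open>a\<close> the factor \<open>z l ^ (k - 1)\<close> does.\<close>

lemma power_sum_on_kernel:
  fixes c :: "nat \<Rightarrow> nat \<Rightarrow> 'a::field_char_0"
  assumes k: "2 \<le> k" and m: "2 * N < m"
  shows "\<exists>z. (\<forall>j<N. (\<Sum>l<m. c j l * z l) = 0) \<and> (\<Sum>l<m. z l ^ k) \<noteq> 0"
proof -
  define W where "W = {z. \<forall>j<N. (\<Sum>l<m. c j l * z l) = 0}"
  define free where "free = (\<lambda>S. S \<subseteq> {..<m} \<and> (\<forall>x. \<exists>z\<in>W. \<forall>l\<in>S. z l = x l))"
  have W_add: "(\<lambda>l. z l + b * v l) \<in> W" if "z \<in> W" "v \<in> W" for z v b
  proof -
    have "(\<Sum>l<m. c j l * (z l + b * v l)) = (\<Sum>l<m. c j l * z l) + b * (\<Sum>l<m. c j l * v l)" for j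
      by (simp add: distrib_left sum.distrib sum_distrib_left mult.left_commute)
    then show ?thesis using that by (simp add: W_def)
  qed
  have supp: "\<exists>v\<in>W. (\<forall>l. l \<notin> T \<longrightarrow> v l = 0) \<and> (\<exists>l\<in>T. v l \<noteq> 0)" if T: "T \<subseteq> {..<m}" "N < card T" for T
  proof -
    have "finite T" using T(1) finite_subset by blast
    then obtain v where v: "\<forall>l. l \<notin> T \<longrightarrow> v l = 0" "\<exists>l\<in>T. v l \<noteq> 0" "\<forall>j<N. (\<Sum>l\<in>T. c j l * v l) = 0"
      using underdetermined_system_on[of T N c] T(2) by blast
    have "(\<Sum>l<m. c j l * v l) = (\<Sum>l\<in>T. c j l * v l)" for j
      using v(1) T(1) by (intro sum.mono_neutral_right) auto
    then have "v \<in> W" using v(3) by (simp add: W_def)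
    then show ?thesis using v(1,2) by blast
  qed
  have "free {}" by (auto simp: free_def W_def intro!: exI[of _ "\<lambda>_. 0"])
  moreover have "finite {S. free S}"
    by (rule finite_subset[of _ "Pow {..<m}"]) (auto simp: free_def)
  ultimately obtain S where S: "free S" and max: "\<And>S'. free S' \<Longrightarrow> S \<subseteq> S' \<Longrightarrow> S' = S"
    using finite_has_maximal[of "{S. free S}"] by blast
  have Sm: "S \<subseteq> {..<m}" using S by (simp add: free_def)
  have "card ({..<m} - S) \<le> N"
  proof (rule ccontr)
    assume "\<not> ?thesis"
    then obtain v where v: "v \<in> W" "\<forall>l. l \<notin> {..<m} - S \<longrightarrow> v l = 0" "\<exists>l\<in>{..<m} - S. v l \<noteq> 0"
      using supp[of "{..<m} - S"] by auto
    then obtain a where a: "a < m" "a \<notin> S" "v a \<noteq> 0" by auto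
    have "\<exists>z\<in>W. \<forall>l\<in>insert a S. z l = x l" for x
    proof -
      have "\<exists>z\<in>W. \<forall>l\<in>S. z l = x l" using S unfolding free_def by blast
      then obtain z where z: "z \<in> W" "\<forall>l\<in>S. z l = x l" by blast
      have "\<forall>l\<in>insert a S. z l + (x a - z a) / v a * v l = x l"
        using z(2) v(2) a by auto
      then show ?thesis using W_add[OF z(1) v(1), of "(x a - z a) / v a"] by (rule bexI)
    qed
    then have "free (insert a S)" using Sm a(1) by (simp add: free_def)
    then show False using max a(2) by blast
  qed
  then have "N < card S"
    using m card_Diff_subset[OF finite_subset[OF Sm] Sm] by simp
  then obtain v where v: "v \<in> W" "\<And>l. l \<notin> S \<Longrightarrow> v l = 0" "\<exists>l\<in>S. v l \<noteq> 0" using supp[OF Sm] by blast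
  then obtain a where a: "a \<in> S" "v a \<noteq> 0" by blast
  obtain z where z: "z \<in> W" "\<And>l. l \<in> S \<Longrightarrow> z l = (if l = a then 1 else 0)"
  proof -
    have "\<forall>x. \<exists>z\<in>W. \<forall>l\<in>S. z l = x l" using S by (simp add: free_def)
    from spec[OF this, of "\<lambda>l. if l = a then 1 else 0"] show ?thesis using that by blast
  qed
  define p where "p = (\<Sum>l<m. [:z l, v l:] ^ k)"
  have pderiv_sum: "pderiv (\<Sum>l<n. f l) = (\<Sum>l<n. pderiv (f l))" for f :: "nat \<Rightarrow> 'a poly" and n
    by (induction n) (simp_all add: pderiv_add)
  have "poly (pderiv p) 0 = (\<Sum>l<m. of_nat k * z l ^ (k - 1) * v l)"
    unfolding p_def by (simp add: pderiv_sum pderiv_power pderiv_pCons poly_sum mult_ac)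
  also have "\<dots> = (\<Sum>l<m. if l = a then of_nat k * v a else 0)"
  proof (intro sum.cong refl)
    fix l show "of_nat k * z l ^ (k - 1) * v l = (if l = a then of_nat k * v a else 0)"
      using z(2)[of l] v(2)[of l] a k by (cases "l \<in> S") auto
  qed
  also have "\<dots> = of_nat k * v a" using a Sm by auto
  finally have "p \<noteq> 0" using a k by auto
  then obtain s where s: "poly p s \<noteq> 0" using poly_all_0_iff_0 by blast
  have "(\<Sum>l<m. (z l + s * v l) ^ k) = poly p s" by (simp add: p_def poly_sum)
  then show ?thesis using s W_add[OF z(1) v(1), of s] unfolding W_def
    by (intro exI[of _ "\<lambda>l. z l + s * v l"]) auto
qed

text \<open>In terms of the powers \<open>z l = u l ^ e\<close> the equations are linear. If
  \<open>e\<close> divides \<open>d\<close>, the \<open>d\<close>-th power sum of \<open>u\<close>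
  is a power sum of \<open>z\<close> with exponent at least 2. Otherwise a suitable
  \<open>e\<close>-th root of unity applied to one coordinate changes the power sum without changing
  \<open>z\<close>.\<close>

lemma power_sum_on_diagonal_forms:
  fixes c :: "nat \<Rightarrow> nat \<Rightarrow> 'a::{alg_closed_field,field_char_0}"
  assumes e: "0 < e" "e < d" and m: "2 * N < m"
  shows "\<exists>u. (\<forall>j<N. (\<Sum>l<m. c j l * u l ^ e) = 0) \<and> (\<Sum>l<m. u l ^ d) \<noteq> 0"
proof -
  have root: "\<exists>u. \<forall>l. u l ^ e = z l" for z :: "nat \<Rightarrow> 'a"
    by (intro choice allI nth_root_exists e(1))
  show ?thesis
  proof (cases "e dvd d")
    case True
    then obtain k where k: "d = e * k" by blast
    then have "2 \<le> k" using e by (cases k; cases "k - 1") auto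
    from power_sum_on_kernel[OF this m] obtain z where z: "\<forall>j<N. (\<Sum>l<m. c j l * z l) = 0" "(\<Sum>l<m. z l ^ k) \<noteq> 0"
      by blast
    obtain u where "\<And>l. u l ^ e = z l" using root by blast
    then show ?thesis using z by (intro exI[of _ u]) (simp add: k power_mult)
  next
    case False
    have "N < m" using m by simp
    from underdetermined_system[OF this, of c] obtain z
      where z: "\<exists>i<m. z i \<noteq> 0" "\<forall>j<N. (\<Sum>i<m. c j i * z i) = 0" by blast
    obtain u where u: "\<And>l. u l ^ e = z l" using root by blast
    show ?thesis
    proof (cases "(\<Sum>l<m. u l ^ d) = 0")
      case sz: True
      obtain a where a: "a < m" "z a \<noteq> 0" using z(1) by blast
      obtain \<zeta> :: 'a where \<zeta>: "\<zeta> ^ e = 1" "\<zeta> ^ d \<noteq> 1" using exists_root_of_unity[OF e(1) False] by blast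
      define w where "w = (\<lambda>l. if l = a then \<zeta> * u a else u l)"
      have "w l ^ e = z l" for l by (simp add: w_def power_mult_distrib \<zeta> u)
      moreover have "(\<Sum>l<m. w l ^ d) = (\<Sum>l<m. u l ^ d + (if l = a then (\<zeta> ^ d - 1) * u a ^ d else 0))"
        by (intro sum.cong) (auto simp: w_def power_mult_distrib algebra_simps)
      then have "(\<Sum>l<m. w l ^ d) = (\<zeta> ^ d - 1) * u a ^ d"
        using sz a(1) by (simp add: sum.distrib)
      moreover have "u a \<noteq> 0" using u[of a] a(2) e(1) by (metis power_0_left gr_implies_not0)
      ultimately show ?thesis using z(2) \<zeta>(2) by (intro exI[of _ w]) auto
    next
      case False
      then show ?thesis using u z(2) by (intro exI[of _ u]) simp
    qed
  qed
qed

lemma sum_lessThan_split: "(\<Sum>i<m + n. h i) = (\<Sum>i<m. h i) + (\<Sum>i<n. h (m + i))" for h :: "nat \<Rightarrow> 'a::comm_monoid_add"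
  by (induction n) (auto simp: add.assoc)

text \<open>The number \<open>M\<close> of variables depends on the number of forms but not on their
  coefficients: in the constructions below the coefficients depend on earlier choices, while the
  number is bounded beforehand.\<close>

definition lower_forms_solvable :: "'a::field itself \<Rightarrow> nat \<Rightarrow> nat \<Rightarrow> nat \<Rightarrow> nat \<Rightarrow> bool" where
  "lower_forms_solvable _ d e N M \<longleftrightarrow>
    (\<forall>\<F>::((nat \<Rightarrow> 'a) \<Rightarrow> 'a) set. finite \<F> \<longrightarrow> card \<F> \<le> N \<longrightarrow>
      (\<forall>f\<in>\<F>. \<exists>g. 1 \<le> g \<and> g \<le> e \<and> form M g f) \<longrightarrow>
      (\<exists>t. (\<forall>f\<in>\<F>. f t = 0) \<and> (\<Sum>i<M. t i ^ d) = 1))"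

lemma form_degree_0: "form k 0 f \<Longrightarrow> f s = f t"
  using form_scaled[of k 0 f 0 s] form_scaled[of k 0 f 0 t] by simp

text \<open>
  The vectors \<open>w\<^sub>l\<close> live in disjoint blocks of variables and are found one after the other; the
  mixed terms have degree at most \<open>e\<close> in the new block, so they can be made to vanish.
\<close>

lemma diagonalise_forms:
  fixes d e m N :: nat
  assumes low: "\<And>N. \<exists>M. lower_forms_solvable TYPE('a::field_char_0) d e N M"
  shows "\<exists>M. \<forall>\<F>::(nat \<times> ((nat \<Rightarrow> 'a) \<Rightarrow> 'a)) set. finite \<F> \<longrightarrow> card \<F> \<le> N \<longrightarrow>
    (\<forall>(g, f)\<in>\<F>. 1 \<le> g \<and> g \<le> Suc e \<and> form M g f) \<longrightarrow>
    (\<exists>w. (\<forall>u. (\<Sum>i<M. (\<Sum>l<m. u l * w l i) ^ d) = (\<Sum>l<m. u l ^ d)) \<and>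
      (\<forall>(g, f)\<in>\<F>. \<exists>c. (g \<le> e \<longrightarrow> c = (\<lambda>_. 0)) \<and>
        (\<forall>u. f (\<lambda>i. \<Sum>l<m. u l * w l i) = (\<Sum>l<m. c l * u l ^ Suc e))))"
proof (induction m)
  case 0
  show ?case
  proof (rule exI[of _ 0], intro allI impI, rule exI[of _ "\<lambda>_ _. 0"], intro conjI allI ballI)
    fix \<F> :: "(nat \<times> ((nat \<Rightarrow> 'a) \<Rightarrow> 'a)) set" and x
    assume *: "\<forall>(g, f)\<in>\<F>. 1 \<le> g \<and> g \<le> Suc e \<and> form 0 g f" "x \<in> \<F>"
    obtain g f where x: "x = (g, f)" by fastforce
    then have "f (\<lambda>_. 0) = 0" using * form_at_zero[of 0 g f] by auto
    then show "case x of (g, f) \<Rightarrow> \<exists>c. (g \<le> e \<longrightarrow> c = (\<lambda>_. 0)) \<and>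
        (\<forall>u. f (\<lambda>i. \<Sum>l<0. u l * 0) = (\<Sum>l<0. c l * u l ^ Suc e))"
      unfolding x by (intro case_prodI exI[of _ "\<lambda>_. 0"]) simp
  qed simp
next
  case (Suc m)
  from Suc.IH obtain M where
    "\<forall>\<F>::(nat \<times> ((nat \<Rightarrow> 'a) \<Rightarrow> 'a)) set. finite \<F> \<longrightarrow> card \<F> \<le> N \<longrightarrow>
    (\<forall>(g, f)\<in>\<F>. 1 \<le> g \<and> g \<le> Suc e \<and> form M g f) \<longrightarrow>
    (\<exists>w. (\<forall>u. (\<Sum>i<M. (\<Sum>l<m. u l * w l i) ^ d) = (\<Sum>l<m. u l ^ d)) \<and>
      (\<forall>(g, f)\<in>\<F>. \<exists>c. (g \<le> e \<longrightarrow> c = (\<lambda>_. 0)) \<and>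
        (\<forall>u. f (\<lambda>i. \<Sum>l<m. u l * w l i) = (\<Sum>l<m. c l * u l ^ Suc e))))"
    by (elim exE)
  note M = this[THEN spec, THEN mp, THEN mp, THEN mp]
  \<comment> \<open>At most one condition for each given form and each exponent in the coefficients
    of the old vectors.\<close>
  obtain M1 where M1: "lower_forms_solvable TYPE('a) d e (N * card (expos m (Suc e))) M1"
    using low by blast
  show ?case
  proof (rule exI[of _ "M + M1"], intro allI impI)
    fix \<F> :: "(nat \<times> ((nat \<Rightarrow> 'a) \<Rightarrow> 'a)) set"
    assume fin: "finite \<F>" and card: "card \<F> \<le> N"
      and forms: "\<forall>(g, f)\<in>\<F>. 1 \<le> g \<and> g \<le> Suc e \<and> form (M + M1) g f"
    define cut where "cut = (\<lambda>f::(nat \<Rightarrow> 'a) \<Rightarrow> 'a. \<lambda>u::nat \<Rightarrow> 'a. f (\<lambda>i. if i < M then u i else 0))"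
    let ?\<F>1 = "(\<lambda>(g, f). (g, cut f)) ` \<F>"
    have cut: "form M g (cut f)" if "form (M + M1) g f" for g f
      unfolding cut_def
    proof (rule form_subst[OF that])
      show "form M 1 (\<lambda>u::nat \<Rightarrow> 'a. if i < M then u i else 0)" for i
        by (cases "i < M") (auto intro: form_proj[simplified] form_zero)
    qed
    have "\<exists>w. (\<forall>u. (\<Sum>i<M. (\<Sum>l<m. u l * w l i) ^ d) = (\<Sum>l<m. u l ^ d)) \<and>
      (\<forall>(g, f)\<in>?\<F>1. \<exists>c. (g \<le> e \<longrightarrow> c = (\<lambda>_. 0)) \<and>
        (\<forall>u. f (\<lambda>i. \<Sum>l<m. u l * w l i) = (\<Sum>l<m. c l * u l ^ Suc e)))"
    proof (rule M)
      show "finite ?\<F>1" using fin by simp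
      show "card ?\<F>1 \<le> N" using card card_image_le[OF fin] le_trans by blast
      show "\<forall>(g, f)\<in>?\<F>1. 1 \<le> g \<and> g \<le> Suc e \<and> form M g f" using forms cut by fastforce
    qed
    then obtain w where w: "\<And>u. (\<Sum>i<M. (\<Sum>l<m. u l * w l i) ^ d) = (\<Sum>l<m. u l ^ d)"
      and wf: "\<forall>(g, f)\<in>?\<F>1. \<exists>c. (g \<le> e \<longrightarrow> c = (\<lambda>_. 0)) \<and>
        (\<forall>u. f (\<lambda>i. \<Sum>l<m. u l * w l i) = (\<Sum>l<m. c l * u l ^ Suc e))" by blast
    have wf': "\<exists>c. (g \<le> e \<longrightarrow> c = (\<lambda>_. 0)) \<and>
        (\<forall>u. cut f (\<lambda>i. \<Sum>l<m. u l * w l i) = (\<Sum>l<m. c l * u l ^ Suc e))" if "(g, f) \<in> \<F>" for g f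
      using wf that by force
    \<comment> \<open>The first \<open>m\<close> parameters are the coefficients of the old vectors,
      the remaining ones are the entries of the new block.\<close>
    define L where "L = (\<lambda>(s::nat \<Rightarrow> 'a) i. if i < M then \<Sum>l<m. s l * w l i else s (m + (i - M)))"
    have L: "form (m + M1) 1 (\<lambda>s. L s i)" if "i < M + M1" for i
    proof (cases "i < M")
      case True
      have "form (m + M1) 1 (\<lambda>s::nat \<Rightarrow> 'a. \<Sum>l<m. w l i * s l)"
        by (intro form_sum form_scale form_proj) auto
      then show ?thesis using True by (simp add: L_def mult.commute)
    next
      case False
      then have "m + (i - M) < m + M1" using that by simp
      from form_proj[OF this] show ?thesis using False by (simp add: L_def)
    qed
    have "\<exists>G. x \<in> \<F> \<longrightarrow> (\<forall>\<alpha>\<in>expos m (fst x). form M1 (fst x - sum \<alpha> {..<m}) (G \<alpha>)) \<and>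
      (\<forall>u v. snd x (L (\<lambda>i. if i < m then u i else v (i - m))) = (\<Sum>\<alpha>\<in>expos m (fst x). mon m \<alpha> u * G \<alpha> v))"
      for x
    proof (cases "x \<in> \<F>")
      case True
      then have "form (M + M1) (fst x) (snd x)" using forms by auto
      then have "form (m + M1) (fst x) (\<lambda>s. snd x (L s))" using L by (rule form_subst)
      from form_expand[OF this] show ?thesis by blast
    qed blast
    then have "\<forall>x. \<exists>G. x \<in> \<F> \<longrightarrow> (\<forall>\<alpha>\<in>expos m (fst x). form M1 (fst x - sum \<alpha> {..<m}) (G \<alpha>)) \<and>
      (\<forall>u v. snd x (L (\<lambda>i. if i < m then u i else v (i - m))) = (\<Sum>\<alpha>\<in>expos m (fst x). mon m \<alpha> u * G \<alpha> v))"
      by (rule allI)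
    from choice[OF this] obtain G where G': "\<forall>x\<in>\<F>. (\<forall>\<alpha>\<in>expos m (fst x). form M1 (fst x - sum \<alpha> {..<m}) (G x \<alpha>)) \<and>
      (\<forall>u v. snd x (L (\<lambda>i. if i < m then u i else v (i - m))) = (\<Sum>\<alpha>\<in>expos m (fst x). mon m \<alpha> u * G x \<alpha> v))"
      by blast
    have G: "form M1 (g - sum \<alpha> {..<m}) (G (g, f) \<alpha>)" if "(g, f) \<in> \<F>" "\<alpha> \<in> expos m g" for g f \<alpha>
      using bspec[OF G' that(1)] that(2) by simp
    have GL: "f (L (\<lambda>i. if i < m then u i else v (i - m))) =
        (\<Sum>\<alpha>\<in>expos m g. mon m \<alpha> u * G (g, f) \<alpha> v)" if "(g, f) \<in> \<F>" for g f u v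
      using bspec[OF G' that] by simp
    \<comment> \<open>Degree 0 in the new block belongs to the old part, and degree
      \<open>Suc e\<close> occurs only as the pure new term of a form of full degree. All degrees
      between them have to be killed.\<close>
    define mixed where "mixed = {((g, f), \<alpha>). (g, f) \<in> \<F> \<and> \<alpha> \<in> expos m (Suc e) \<and> \<alpha> \<in> expos m g \<and>
      1 \<le> g - sum \<alpha> {..<m} \<and> g - sum \<alpha> {..<m} \<le> e}"
    let ?\<F>2 = "(\<lambda>(x, \<alpha>). G x \<alpha>) ` mixed"
    have mixed: "mixed \<subseteq> \<F> \<times> expos m (Suc e)" by (auto simp: mixed_def)
    have finm: "finite mixed" by (rule finite_subset[OF mixed]) (simp add: fin finite_expos)
    have "\<exists>t. (\<forall>f\<in>?\<F>2. f t = 0) \<and> (\<Sum>i<M1. t i ^ d) = 1"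
    proof -
      have "card ?\<F>2 \<le> card mixed" by (rule card_image_le[OF finm])
      also have "\<dots> \<le> card (\<F> \<times> expos m (Suc e))" by (rule card_mono[OF _ mixed]) (simp add: fin finite_expos)
      also have "\<dots> \<le> N * card (expos m (Suc e))" using card by (simp add: card_cartesian_product)
      finally have "card ?\<F>2 \<le> N * card (expos m (Suc e))" .
      moreover have "\<forall>f\<in>?\<F>2. \<exists>g. 1 \<le> g \<and> g \<le> e \<and> form M1 g f"
      proof
        fix h assume "h \<in> ?\<F>2"
        then obtain g f \<alpha> where "(g, f) \<in> \<F>" "\<alpha> \<in> expos m g" "1 \<le> g - sum \<alpha> {..<m}"
          "g - sum \<alpha> {..<m} \<le> e" "h = G (g, f) \<alpha>" unfolding mixed_def by auto
        then show "\<exists>g. 1 \<le> g \<and> g \<le> e \<and> form M1 g h" using G by blast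
      qed
      ultimately show ?thesis using M1 finm unfolding lower_forms_solvable_def by blast
    qed
    then obtain v where v': "\<forall>h\<in>?\<F>2. h v = 0" and v1: "(\<Sum>i<M1. v i ^ d) = 1" by blast
    have "G x \<alpha> v = 0" if "(x, \<alpha>) \<in> mixed" for x \<alpha>
      using bspec[OF v', of "G x \<alpha>"] that by force
    note v = this v1
    define w' where "w' = (\<lambda>l i. if l < m then if i < M then w l i else 0 else if i < M then 0 else v (i - M))"
    have w': "(\<Sum>l<Suc m. u l * w' l i) = L (\<lambda>i. if i < m then u i else u m * v (i - m)) i" for u i
      by (cases "i < M") (simp_all add: w'_def L_def)
    show "\<exists>w. (\<forall>u. (\<Sum>i<M + M1. (\<Sum>l<Suc m. u l * w l i) ^ d) = (\<Sum>l<Suc m. u l ^ d)) \<and>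
      (\<forall>(g, f)\<in>\<F>. \<exists>c. (g \<le> e \<longrightarrow> c = (\<lambda>_. 0)) \<and>
        (\<forall>u. f (\<lambda>i. \<Sum>l<Suc m. u l * w l i) = (\<Sum>l<Suc m. c l * u l ^ Suc e)))"
    proof (rule exI[of _ w'], intro conjI allI)
      fix u
      have "(\<Sum>i<M + M1. (\<Sum>l<Suc m. u l * w' l i) ^ d) = (\<Sum>i<M. (\<Sum>l<m. u l * w l i) ^ d) + (\<Sum>i<M1. (u m * v i) ^ d)"
        unfolding w' sum_lessThan_split by (simp add: L_def)
      also have "\<dots> = (\<Sum>l<Suc m. u l ^ d)"
        unfolding w by (simp add: power_mult_distrib sum_distrib_left[symmetric] v(2))
      finally show "(\<Sum>i<M + M1. (\<Sum>l<Suc m. u l * w' l i) ^ d) = (\<Sum>l<Suc m. u l ^ d)" .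
    next
      have "\<exists>c. (g \<le> e \<longrightarrow> c = (\<lambda>_. 0)) \<and>
        (\<forall>u. f (\<lambda>i. \<Sum>l<Suc m. u l * w' l i) = (\<Sum>l<Suc m. c l * u l ^ Suc e))" if gf: "(g, f) \<in> \<F>" for g f
      proof -
        obtain c where c: "g \<le> e \<longrightarrow> c = (\<lambda>_. 0)"
          "\<And>u. cut f (\<lambda>i. \<Sum>l<m. u l * w l i) = (\<Sum>l<m. c l * u l ^ Suc e)" using wf'[OF gf] by blast
        have g: "1 \<le> g" "g \<le> Suc e" and fg: "form (M + M1) g f" using forms gf by auto
        \<comment> \<open>The value at \<open>v\<close> of the pure term in the new block becomes
          the new diagonal coefficient; a form of smaller degree has its pure term killed as
          well.\<close>
        define c' where "c' = (\<lambda>l. if l < m then c l else if g = Suc e then G (g, f) (\<lambda>_. 0) v else 0)"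
        have "f (\<lambda>i. \<Sum>l<Suc m. u l * w' l i) = (\<Sum>l<Suc m. c' l * u l ^ Suc e)" for u
        proof -
          let ?v = "\<lambda>b i. b * v i"
          \<comment> \<open>The cases are: a coefficient independent of the new block, one killed by
            the choice of \<open>v\<close>, and the pure term, which forces \<alpha> = 0 and full
            degree.\<close>
          have diff: "mon m \<alpha> u * G (g, f) \<alpha> (?v (u m)) = mon m \<alpha> u * G (g, f) \<alpha> (?v 0) +
              (if \<alpha> = (\<lambda>_. 0) then if g = Suc e then G (g, f) (\<lambda>_. 0) v * u m ^ Suc e else 0 else 0)"
            if \<alpha>: "\<alpha> \<in> expos m g" for \<alpha>
          proof -
            let ?\<delta> = "g - sum \<alpha> {..<m}"
            note sc = form_scaled[OF G[OF gf \<alpha>], of _ v]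
            consider "?\<delta> = 0" | "1 \<le> ?\<delta>" "?\<delta> \<le> e" | "e < ?\<delta>" by linarith
            then show ?thesis
            proof cases
              case 1
              then have "\<alpha> \<noteq> (\<lambda>_. 0)" using g by auto
              then show ?thesis using sc[of "u m"] sc[of 0] 1 by simp
            next
              case 2
              have "\<alpha> \<in> expos m (Suc e)" using \<alpha> g(2) expos_mono by blast
              then have "G (g, f) \<alpha> v = 0" using 2 \<alpha> gf by (intro v(1)) (auto simp: mixed_def)
              moreover have "\<not> (\<alpha> = (\<lambda>_. 0) \<and> g = Suc e)" using 2 by auto
              ultimately show ?thesis using sc[of "u m"] sc[of 0] by auto
            next
              case 3
              then have s: "sum \<alpha> {..<m} = 0" "g = Suc e" using g(2) by linarith+
              then have "\<alpha> i = 0" for i using \<alpha> by (cases "i < m") (auto simp: expos_def)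
              then have "\<alpha> = (\<lambda>_. 0)" by blast
              then show ?thesis using sc[of "u m"] sc[of 0] s by (simp add: mon_zero)
            qed
          qed
          have 0: "(\<lambda>_. 0) \<in> expos m g" by (simp add: expos_def)
          have "f (\<lambda>i. \<Sum>l<Suc m. u l * w' l i) = (\<Sum>\<alpha>\<in>expos m g. mon m \<alpha> u * G (g, f) \<alpha> (?v (u m)))"
            unfolding w' using GL[OF gf, of u "?v (u m)"] by simp
          also have "\<dots> = (\<Sum>\<alpha>\<in>expos m g. mon m \<alpha> u * G (g, f) \<alpha> (?v 0)) +
              (if g = Suc e then G (g, f) (\<lambda>_. 0) v * u m ^ Suc e else 0)"
            using 0 finite_expos[of m g] by (simp add: diff sum.distrib cong: sum.cong)
          also have "(\<Sum>\<alpha>\<in>expos m g. mon m \<alpha> u * G (g, f) \<alpha> (?v 0)) =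
              f (L (\<lambda>i. if i < m then u i else ?v 0 (i - m)))"
            using GL[OF gf, of u "?v 0"] by simp
          also have "\<dots> = cut f (\<lambda>i. \<Sum>l<m. u l * w l i)"
            unfolding cut_def by (rule arg_cong[of _ _ f]) (simp add: L_def fun_eq_iff, linarith)
          also have "\<dots> = (\<Sum>l<m. c l * u l ^ Suc e)" by (rule c(2))
          finally show ?thesis by (simp add: c'_def)
        qed
        moreover have "g \<le> e \<longrightarrow> c' = (\<lambda>_. 0)" using c(1) by (auto simp: c'_def)
        ultimately show ?thesis by blast
      qed
      then show "\<forall>(g, f)\<in>\<F>. \<exists>c. (g \<le> e \<longrightarrow> c = (\<lambda>_. 0)) \<and>
        (\<forall>u. f (\<lambda>i. \<Sum>l<Suc m. u l * w' l i) = (\<Sum>l<Suc m. c l * u l ^ Suc e))" by blast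
    qed
  qed
qed

text \<open>The step from \<open>e\<close> to \<open>Suc e\<close> diagonalises the forms on a space
  where the power sum keeps its shape: forms of degree at most \<open>e\<close> vanish there, and
  the others become combinations of powers \<open>u l ^ Suc e\<close>. A zero of these with nonzero
  power sum is rescaled to power sum 1.\<close>

lemma lower_forms_solvable_exists:
  "e < d \<Longrightarrow> \<exists>M. lower_forms_solvable TYPE('a::{alg_closed_field,field_char_0}) d e N M"
proof (induction e arbitrary: N)
  case 0
  \<comment> \<open>No degree lies between 1 and 0, so there are no forms, and one variable with
    value 1 suffices.\<close>
  show ?case
    unfolding lower_forms_solvable_def
    by (rule exI[of _ 1], intro allI impI exI[of _ "\<lambda>_. 1"]) force
next
  case (Suc e)
  \<comment> \<open>The least number of variables that \<open>power_sum_on_diagonal_forms\<close>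
    accepts for \<open>N\<close> equations.\<close>
  define m where "m = Suc (2 * N)"
  have "\<exists>M. lower_forms_solvable TYPE('a) d e N M" for N using Suc by simp
  from diagonalise_forms[OF this, where N = N and m = m] obtain M where
    "\<forall>\<F>::(nat \<times> ((nat \<Rightarrow> 'a) \<Rightarrow> 'a)) set. finite \<F> \<longrightarrow> card \<F> \<le> N \<longrightarrow>
    (\<forall>(g, f)\<in>\<F>. 1 \<le> g \<and> g \<le> Suc e \<and> form M g f) \<longrightarrow>
    (\<exists>w. (\<forall>u. (\<Sum>i<M. (\<Sum>l<m. u l * w l i) ^ d) = (\<Sum>l<m. u l ^ d)) \<and>
      (\<forall>(g, f)\<in>\<F>. \<exists>c. (g \<le> e \<longrightarrow> c = (\<lambda>_. 0)) \<and>
        (\<forall>u. f (\<lambda>i. \<Sum>l<m. u l * w l i) = (\<Sum>l<m. c l * u l ^ Suc e))))"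
    by (elim exE)
  note M = this[THEN spec, THEN mp, THEN mp, THEN mp]
  have "\<exists>t. (\<forall>f\<in>\<F>. f t = 0) \<and> (\<Sum>i<M. t i ^ d) = 1"
    if fin: "finite \<F>" and card: "card \<F> \<le> N" and forms: "\<forall>f\<in>\<F>. \<exists>g. 1 \<le> g \<and> g \<le> Suc e \<and> form M g f"
    for \<F> :: "((nat \<Rightarrow> 'a) \<Rightarrow> 'a) set"
  proof -
    obtain g where g: "\<And>f. f \<in> \<F> \<Longrightarrow> 1 \<le> g f \<and> g f \<le> Suc e \<and> form M (g f) f" using forms by metis
    have "card ((\<lambda>f. (g f, f)) ` \<F>) \<le> N" using card card_image_le[OF fin] le_trans by blast
    then obtain w where w: "\<And>u. (\<Sum>i<M. (\<Sum>l<m. u l * w l i) ^ d) = (\<Sum>l<m. u l ^ d)"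
      "\<And>f. f \<in> \<F> \<Longrightarrow> \<exists>c. \<forall>u. f (\<lambda>i. \<Sum>l<m. u l * w l i) = (\<Sum>l<m. c l * u l ^ Suc e)"
      using M[of "(\<lambda>f. (g f, f)) ` \<F>", OF finite_imageI[OF fin] _ _] g by force
    then have "\<forall>f. \<exists>c. f \<in> \<F> \<longrightarrow> (\<forall>u. f (\<lambda>i. \<Sum>l<m. u l * w l i) = (\<Sum>l<m. c l * u l ^ Suc e))" by blast
    from choice[OF this] obtain c where
      c: "\<And>f u. f \<in> \<F> \<Longrightarrow> f (\<lambda>i. \<Sum>l<m. u l * w l i) = (\<Sum>l<m. c f l * u l ^ Suc e)" by blast
    obtain h where h: "bij_betw h {..<card \<F>} \<F>"
      using ex_bij_betw_nat_finite[OF fin] unfolding lessThan_atLeast0 by blast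
    have "2 * card \<F> < m" using card by (simp add: m_def)
    then obtain u where u: "\<And>j. j < card \<F> \<Longrightarrow> (\<Sum>l<m. c (h j) l * u l ^ Suc e) = 0" "(\<Sum>l<m. u l ^ d) \<noteq> 0"
      using power_sum_on_diagonal_forms[of "Suc e" d "card \<F>" m "\<lambda>j. c (h j)"] Suc.prems by auto
    obtain b where b: "b ^ d = 1 / (\<Sum>l<m. u l ^ d)" using nth_root_exists[of d] Suc.prems by (metis gr_implies_not0 gr0I)
    define t where "t = (\<lambda>i. \<Sum>l<m. (b * u l) * w l i)"
    have "f t = 0" if "f \<in> \<F>" for f
    proof -
      obtain j where j: "j < card \<F>" "f = h j" using h \<open>f \<in> \<F>\<close> unfolding bij_betw_def by auto
      have "f t = b ^ Suc e * (\<Sum>l<m. c f l * u l ^ Suc e)"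
        unfolding t_def c[OF that] sum_distrib_left by (simp only: power_mult_distrib mult_ac)
      then show ?thesis using u(1)[OF j(1)] j(2) by simp
    qed
    moreover have "(\<Sum>i<M. t i ^ d) = b ^ d * (\<Sum>l<m. u l ^ d)"
      unfolding t_def w(1) sum_distrib_left by (simp only: power_mult_distrib)
    then have "(\<Sum>i<M. t i ^ d) = 1" using b u(2) by simp
    ultimately show ?thesis by blast
  qed
  then show ?case unfolding lower_forms_solvable_def by blast
qed

section \<open>Homogeneous polynomial functors in coordinates\<close>

text \<open>Matrices carry no size; the sizes are arguments of the operations. Restricting to fewer
  rows or columns is therefore a mere change of these arguments.\<close>

definition mmul :: "nat \<Rightarrow> (nat \<Rightarrow> nat \<Rightarrow> 'a::semiring_0) \<Rightarrow> (nat \<Rightarrow> nat \<Rightarrow> 'a) \<Rightarrow> nat \<Rightarrow> nat \<Rightarrow> 'a" where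
  "mmul k A B = (\<lambda>i j. \<Sum>l<k. A i l * B l j)"

text \<open>Read with \<open>m\<close> rows and \<open>n\<close> columns, this is the projection
  onto the first \<open>m\<close> coordinates if \<open>m \<le> n\<close>, and the inclusion as the
  first coordinates if \<open>n \<le> m\<close>. Likewise \<open>shift n\<close> below is the
  inclusion as the coordinates from \<open>n\<close> on.\<close>

definition idm :: "nat \<Rightarrow> nat \<Rightarrow> 'a::zero_neq_one" where
  "idm = (\<lambda>i j. if i = j then 1 else 0)"

definition shift :: "nat \<Rightarrow> nat \<Rightarrow> nat \<Rightarrow> 'a::zero_neq_one" where
  "shift n = (\<lambda>i j. if i = n + j then 1 else 0)"

definition coords :: "nat \<Rightarrow> (nat \<Rightarrow> 'a::zero) set" where
  "coords N = {x. \<forall>i\<ge>N. x i = 0}"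

definition unit :: "nat \<Rightarrow> nat \<Rightarrow> 'a::zero_neq_one" where
  "unit k = (\<lambda>i. if i = k then 1 else 0)"

lemma coordsD: "x \<in> coords N \<Longrightarrow> N \<le> i \<Longrightarrow> x i = 0"
  by (simp add: coords_def)

lemma unit_coords: "k < N \<Longrightarrow> unit k \<in> coords N"
  by (auto simp: unit_def coords_def)

lemma zero_coords: "(\<lambda>_. 0) \<in> coords N"
  by (simp add: coords_def)

lemma coords_expand: "x \<in> coords N \<Longrightarrow> x = (\<lambda>i. \<Sum>k<N. x k * unit k i)" for x :: "nat \<Rightarrow> 'a::semiring_1"
proof
  fix i assume x: "x \<in> coords N"
  have "(\<Sum>k<N. x k * unit k i) = (\<Sum>k<N. if k = i then x i else 0)"
    by (intro sum.cong) (auto simp: unit_def)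
  then show "x i = (\<Sum>k<N. x k * unit k i)" using x by (simp add: coordsD)
qed

lemma mmul_idm: "j < k \<Longrightarrow> mmul k A idm i j = A i j" for A :: "nat \<Rightarrow> nat \<Rightarrow> 'a::semiring_1"
  by (simp add: mmul_def idm_def if_distrib[of "\<lambda>x. _ * x"] cong: if_cong)

lemma idm_mmul: "i < k \<Longrightarrow> mmul k idm A i j = A i j" for A :: "nat \<Rightarrow> nat \<Rightarrow> 'a::semiring_1"
  by (simp add: mmul_def idm_def if_distrib[of "\<lambda>x. x * _"] cong: if_cong)

lemma idm_mmul_out: "k \<le> i \<Longrightarrow> mmul k idm A i j = 0" for A :: "nat \<Rightarrow> nat \<Rightarrow> 'a::semiring_1"
  unfolding mmul_def by (rule sum.neutral) (auto simp: idm_def)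

lemma mmul_idm_rows: "rows_within A n N \<Longrightarrow> i < n \<Longrightarrow> mmul N A idm i j = A i j" for A :: "nat \<Rightarrow> nat \<Rightarrow> 'a::semiring_1"
proof (cases "j < N")
  case False
  assume "rows_within A n N" "i < n"
  then have "A i j = 0" using False by (auto simp: rows_within_def)
  moreover have "mmul N A idm i j = 0"
    unfolding mmul_def using False by (intro sum.neutral) (auto simp: idm_def)
  ultimately show ?thesis by simp
qed (rule mmul_idm)

text \<open>\<open>T m n A\<close> is the value of the functor on the \<open>m\<close> by
  \<open>n\<close> block of \<open>A\<close>, and \<open>T_cong\<close> says that nothing outside
  this block matters. \<open>T_form\<close> is stated for linear systems of matrices with any number
  of parameters: one parameter gives homogeneity, several give the expansions into mixed
  terms.\<close>

locale matrix_functor =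
  fixes D :: "nat \<Rightarrow> nat"
    and T :: "nat \<Rightarrow> nat \<Rightarrow> (nat \<Rightarrow> nat \<Rightarrow> 'a::{alg_closed_field,field_char_0}) \<Rightarrow> (nat \<Rightarrow> 'a) \<Rightarrow> nat \<Rightarrow> 'a"
    and d :: nat
  assumes d: "0 < d"
    and T_in: "x \<in> coords (D n) \<Longrightarrow> T m n A x \<in> coords (D m)"
    and T_add: "x \<in> coords (D n) \<Longrightarrow> y \<in> coords (D n) \<Longrightarrow>
      T m n A (\<lambda>i. x i + y i) = (\<lambda>i. T m n A x i + T m n A y i)"
    and T_scale: "x \<in> coords (D n) \<Longrightarrow> T m n A (\<lambda>i. c * x i) = (\<lambda>i. c * T m n A x i)"
    and T_id: "x \<in> coords (D n) \<Longrightarrow> T n n idm x = x"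
    and T_comp: "x \<in> coords (D n) \<Longrightarrow> T l m A (T m n B x) = T l n (mmul m A B) x"
    and T_cong: "(\<And>i j. i < m \<Longrightarrow> j < n \<Longrightarrow> A i j = B i j) \<Longrightarrow> T m n A = T m n B"
    and T_form: "x \<in> coords (D n) \<Longrightarrow> form k d (\<lambda>s. T m n (\<lambda>i j. \<Sum>l<k. s l * As l i j) x b)"
begin

abbreviation V :: "nat \<Rightarrow> (nat \<Rightarrow> 'a) set" where
  "V n \<equiv> coords (D n)"

lemma T_zero_vec: "T m n A (\<lambda>_. 0) = (\<lambda>_. 0)"
  using T_scale[OF zero_coords, of m n A 0] by simp

lemma sum_coords: "(\<And>x. x \<in> S \<Longrightarrow> y x \<in> V n) \<Longrightarrow> (\<lambda>i. \<Sum>x\<in>S. c x * y x i) \<in> V n"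
  by (auto simp: coords_def intro!: sum.neutral)

lemma T_sum:
  "(\<And>x. x \<in> S \<Longrightarrow> y x \<in> V n) \<Longrightarrow>
    T m n A (\<lambda>i. \<Sum>x\<in>S. c x * y x i) = (\<lambda>i. \<Sum>x\<in>S. c x * T m n A (y x) i)"
proof (induction S rule: infinite_finite_induct)
  case (insert x S)
  have "T m n A (\<lambda>i. c x * y x i + (\<Sum>x\<in>S. c x * y x i)) =
      (\<lambda>i. T m n A (\<lambda>i. c x * y x i) i + T m n A (\<lambda>i. \<Sum>x\<in>S. c x * y x i) i)"
    using insert.prems by (intro T_add sum_coords) (auto simp: coords_def)
  then show ?case using insert by (simp add: T_scale)
qed (simp_all add: T_zero_vec)

lemma T_smult: "x \<in> V n \<Longrightarrow> T m n (\<lambda>i j. c * A i j) x = (\<lambda>i. c ^ d * T m n A x i)"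
proof
  fix b assume x: "x \<in> V n"
  have "form 1 d (\<lambda>s. T m n (\<lambda>i j. \<Sum>l<1. s l * A i j) x b)" by (rule T_form[OF x])
  from form_scaled[OF this, of c "\<lambda>_. 1"] show "T m n (\<lambda>i j. c * A i j) x b = c ^ d * T m n A x b" by simp
qed

lemma T_zero: "x \<in> V n \<Longrightarrow> (\<And>i j. i < m \<Longrightarrow> j < n \<Longrightarrow> A i j = 0) \<Longrightarrow> T m n A x = (\<lambda>_. 0)"
proof -
  assume x: "x \<in> V n" and 0: "\<And>i j. i < m \<Longrightarrow> j < n \<Longrightarrow> A i j = 0"
  have "T m n A = T m n (\<lambda>i j. 0 * A i j)" by (rule T_cong) (simp add: 0)
  then show ?thesis using T_smult[OF x, of m 0 A] d by (simp add: power_0_left)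
qed

definition Q :: "(nat \<Rightarrow> nat \<Rightarrow> 'a) set" where
  "Q = {q. \<forall>n. q n \<in> V n \<and> T n (Suc n) idm (q (Suc n)) = q n}"

lemma Q_V: "q \<in> Q \<Longrightarrow> q n \<in> V n"
  by (simp add: Q_def)

lemma T_idm_trans:
  assumes "n \<le> m" "x \<in> V l"
  shows "T n m idm (T m l idm x) = T n l idm x"
proof -
  have "T n l (mmul m idm idm) = T n l idm"
    using assms(1) by (intro T_cong) (simp add: idm_mmul)
  then show ?thesis using assms(2) by (simp add: T_comp)
qed

lemma Q_restrict:
  assumes q: "q \<in> Q" and "n \<le> m"
  shows "T n m idm (q m) = q n"
  using assms(2)
proof (induction m rule: dec_induct)
  case base
  then show ?case using T_id Q_V[OF q] by blast
next
  case (step m)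
  have "T n (Suc m) idm (q (Suc m)) = T n m idm (T m (Suc m) idm (q (Suc m)))"
    using step.hyps Q_V[OF q] by (simp add: T_idm_trans)
  then show ?case using q step.IH by (simp add: Q_def)
qed

lemma Q_rows:
  assumes q: "q \<in> Q" and A: "rows_within A n N" and "N \<le> N'"
  shows "T n N' A (q N') = T n N A (q N)"
proof -
  have "T n N A (q N) = T n N A (T N N' idm (q N'))" by (simp add: Q_restrict assms)
  also have "\<dots> = T n N' (mmul N A idm) (q N')" by (rule T_comp[OF Q_V[OF q]])
  also have "T n N' (mmul N A idm) = T n N' A" using A by (intro T_cong mmul_idm_rows)
  finally show ?thesis by simp
qed

text \<open>Zariski density at each finite level, for the set of images under arbitrary matrices
  instead of the orbit; density of the orbit implies it.\<close>

definition dense :: "(nat \<Rightarrow> nat \<Rightarrow> 'a) \<Rightarrow> bool" where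
  "dense q \<longleftrightarrow> (\<forall>n. \<forall>R\<in>polys (D n). (\<exists>y\<in>V n. R y \<noteq> 0) \<longrightarrow> (\<exists>N A. R (T n N A (q N)) \<noteq> 0))"

definition covers :: "(nat \<Rightarrow> nat \<Rightarrow> 'a) \<Rightarrow> bool" where
  "covers q \<longleftrightarrow> (\<forall>n. \<forall>y\<in>V n. \<exists>N A. T n N A (q N) = y)"

end

subsection \<open>Sums over blocks of variables\<close>

locale block_family = matrix_functor +
  fixes b :: "nat \<Rightarrow> nat" and s :: "nat \<Rightarrow> nat \<Rightarrow> 'a"
  assumes s: "s k \<in> V (b k)"
begin

definition off :: "nat \<Rightarrow> nat" where
  "off k = (\<Sum>j<k. b j)"

text \<open>The vector \<open>s k\<close> is moved to the variables from \<open>off k\<close> to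
  \<open>off (Suc k) - 1\<close>, disjoint from those of the earlier summands.\<close>

primrec bsum :: "nat \<Rightarrow> nat \<Rightarrow> 'a" where
  "bsum 0 = (\<lambda>_. 0)"
| "bsum (Suc k) = (\<lambda>i. T (off (Suc k)) (off k) idm (bsum k) i + T (off (Suc k)) (b k) (shift (off k)) (s k) i)"

lemma off_Suc: "off (Suc k) = off k + b k"
  by (simp add: off_def)

lemma off_mono: "k \<le> l \<Longrightarrow> off k \<le> off l"
  unfolding off_def by (intro sum_mono2) auto

lemma off_inside: "k < K \<Longrightarrow> i < b k \<Longrightarrow> off k + i < off K"
  using off_mono[of "Suc k" K] by (simp add: off_Suc)

lemma bsum_V: "bsum k \<in> V (off k)"
proof (induction k)
  case (Suc k)
  have "T (off (Suc k)) (off k) idm (bsum k) \<in> V (off (Suc k))"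
    "T (off (Suc k)) (b k) (shift (off k)) (s k) \<in> V (off (Suc k))"
    using T_in[OF Suc] T_in[OF s] by auto
  then show ?case by (simp add: coords_def)
qed (simp add: zero_coords)

lemma T_bsum_Suc:
  "T n (off (Suc k)) A (bsum (Suc k)) =
    (\<lambda>i. T n (off k) (mmul (off (Suc k)) A idm) (bsum k) i + T n (b k) (mmul (off (Suc k)) A (shift (off k))) (s k) i)"
  by (simp add: T_add T_in bsum_V s T_comp)

text \<open>All blocks with nonzero coefficient are identified with the same \<open>n\<close>
  variables, block \<open>k\<close> being scaled by \<open>c k\<close>; homogeneity turns the
  scalars into their \<open>d\<close>-th powers.\<close>

lemma bsum_eval:
  assumes "\<And>k. k < K \<Longrightarrow> c k \<noteq> 0 \<Longrightarrow> b k = n"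
  shows "T n (off K) (\<lambda>i j. \<Sum>k<K. c k * (if j = off k + i then 1 else 0)) (bsum K) =
    (\<lambda>i. \<Sum>k<K. c k ^ d * s k i)"
  using assms
proof (induction K)
  case (Suc K)
  let ?A = "\<lambda>K i j. \<Sum>k<K. c k * (if j = off k + i then 1 else 0 :: 'a)"
  have 1: "T n (off K) (mmul (off (Suc K)) (?A (Suc K)) idm) = T n (off K) (?A K)"
  proof (rule T_cong)
    fix i j assume "i < n" "j < off K"
    then show "mmul (off (Suc K)) (?A (Suc K)) idm i j = ?A K i j"
      by (subst mmul_idm) (auto simp: off_Suc)
  qed
  have 2: "T n (b K) (mmul (off (Suc K)) (?A (Suc K)) (shift (off K))) = T n (b K) (\<lambda>i j. c K * idm i j)"
  proof (rule T_cong)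
    fix i j assume i: "i < n" and j: "j < b K"
    have "mmul (off (Suc K)) (?A (Suc K)) (shift (off K)) i j = ?A (Suc K) i (off K + j)"
      unfolding mmul_def shift_def using j
      by (simp add: if_distrib[of "\<lambda>x. _ * x"] off_Suc del: sum.lessThan_Suc cong: if_cong)
    also have "\<dots> = c K * idm i j"
    proof -
      \<comment> \<open>A block with nonzero coefficient has size \<open>n\<close>, so for
        \<open>i < n\<close> its columns end before \<open>off K\<close>.\<close>
      have "c k * (if off K + j = off k + i then 1 else 0 :: 'a) = 0" if k: "k < K" for k
      proof (cases "c k = 0")
        case False
        then have "off k + i < off K" using Suc.prems[of k] k i off_inside[of k K i] by simp
        then show ?thesis by simp
      qed simp
      then have "(\<Sum>k<K. c k * (if off K + j = off k + i then 1 else 0 :: 'a)) = 0"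
        by (intro sum.neutral ballI) (simp only: lessThan_iff)
      then have "?A (Suc K) i (off K + j) = c K * (if off K + j = off K + i then 1 else 0)"
        unfolding sum.lessThan_Suc by simp
      moreover have "off K + j = off K + i \<longleftrightarrow> i = j" by auto
      ultimately show ?thesis by (simp only: idm_def)
    qed
    finally show "mmul (off (Suc K)) (?A (Suc K)) (shift (off K)) i j = c K * idm i j" .
  qed
  have 3: "T n (b K) (\<lambda>i j. c K * idm i j) (s K) = (\<lambda>i. c K ^ d * s K i)"
  proof (cases "c K = 0")
    case True
    then show ?thesis using T_zero[OF s[of K], of n "\<lambda>i j. 0"] d by (simp add: power_0_left)
  next
    case False
    then have "b K = n" using Suc.prems by simp
    then show ?thesis using T_smult[OF s[of K]] T_id[OF s[of K]] by simp
  qed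
  show ?case unfolding T_bsum_Suc 1 2 3 using Suc by simp
qed (simp add: T_zero_vec)

lemma bsum_restrict: "k \<le> l \<Longrightarrow> T (off k) (off l) idm (bsum l) = bsum k"
proof (induction l rule: dec_induct)
  case base
  then show ?case using T_id[OF bsum_V] .
next
  case (step l)
  have "T (off l) (off (Suc l)) idm (bsum (Suc l)) = bsum l"
  proof -
    have "T (off l) (off l) (mmul (off (Suc l)) idm idm) = T (off l) (off l) idm"
      by (intro T_cong idm_mmul) (simp add: off_Suc)
    moreover have "T (off l) (b l) (mmul (off (Suc l)) idm (shift (off l))) (s l) = (\<lambda>_. 0)"
      by (intro T_zero[OF s]) (simp add: idm_mmul off_Suc shift_def)
    ultimately show ?thesis unfolding T_bsum_Suc by (simp add: T_id[OF bsum_V])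
  qed
  then show ?case
    using step T_idm_trans[OF off_mono[OF step.hyps(1)] bsum_V, of "Suc l"] by simp
qed

end

context matrix_functor
begin

text \<open>
  Copies of a basis of the target in disjoint blocks make the restricted evaluation map diagonal,
  and a dense orbit meets the set where it is surjective.
\<close>

theorem dense_covers:
  assumes q: "q \<in> Q" and dense: "dense q"
  shows "covers q"
  unfolding covers_def
proof (intro allI ballI)
  fix n y assume y: "y \<in> V n"
  define s where "s = (\<lambda>k. if k < D n then unit k else (\<lambda>_. 0) :: nat \<Rightarrow> 'a)"
  interpret block_family D T d "\<lambda>_. n" s
    by unfold_locales (auto simp: s_def unit_coords zero_coords)
  define M where "M = off (D n)"
  define B where "B = (\<lambda>(t::nat \<Rightarrow> 'a) i j. \<Sum>k<D n. t k * (if j = off k + i then 1 else 0))"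
  \<comment> \<open>The coordinates of \<open>T n M (B t) x\<close> are linear in \<open>x\<close>,
    with coefficients \<open>F j i\<close> that are forms in \<open>t\<close>. So \<open>x\<close>
    plays the part of the parameter in \<open>generic_surjective\<close>, with
    \<open>bsum (D n)\<close> as the diagonal point.\<close>
  define F where "F = (\<lambda>j i t. T n M (B t) (unit j) i)"
  have F: "form (D n) d (F j i)" if "j < D M" for j i
    unfolding F_def B_def by (rule T_form[OF unit_coords[OF that]])
  have TF: "T n M (B t) x i = (\<Sum>j<D M. x j * F j i t)" if "x \<in> V M" for x t i
  proof -
    have "T n M (B t) x = T n M (B t) (\<lambda>i. \<Sum>k<D M. x k * unit k i)"
      using coords_expand[OF that] by simp
    also have "\<dots> = (\<lambda>i. \<Sum>k<D M. x k * T n M (B t) (unit k) i)"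
      by (rule T_sum) (simp add: unit_coords)
    finally show ?thesis by (simp add: F_def)
  qed
  have "(\<Sum>j<D M. bsum (D n) j * F j i t) = t i ^ d" if "i < D n" for i t
  proof -
    have "(\<Sum>j<D M. bsum (D n) j * F j i t) = T n (off (D n)) (B t) (bsum (D n)) i"
      using TF[of "bsum (D n)" t i] bsum_V[of "D n"] by (simp add: M_def)
    also have "\<dots> = (\<Sum>k<D n. t k ^ d * s k i)" unfolding B_def by (subst bsum_eval) auto
    also have "\<dots> = (\<Sum>k<D n. if k = i then t i ^ d else 0)"
      by (intro sum.cong) (auto simp: s_def unit_def)
    finally show ?thesis using that by simp
  qed
  from generic_surjective[OF d F this] obtain R where R: "R \<in> polys (D M)" "R (bsum (D n)) \<noteq> 0"
    "\<And>x c. R x \<noteq> 0 \<Longrightarrow> \<exists>t. \<forall>i<D n. (\<Sum>j<D M. x j * F j i t) = c i" by blast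
  have "bsum (D n) \<in> V M" unfolding M_def by (rule bsum_V)
  \<comment> \<open>\<open>R\<close> is nonzero at \<open>bsum (D n)\<close>, hence by density also
    at some image of \<open>q\<close>.\<close>
  then obtain N A where A: "R (T M N A (q N)) \<noteq> 0" using dense R(1,2) unfolding dense_def by blast
  have qN: "q N \<in> V N" by (rule Q_V[OF q])
  then have xM: "T M N A (q N) \<in> V M" by (rule T_in)
  obtain t where t: "\<forall>i<D n. (\<Sum>j<D M. T M N A (q N) j * F j i t) = y i" using R(3)[OF A] by blast
  have "T n N (mmul M (B t) A) (q N) = y"
  proof
    fix i
    have "T n N (mmul M (B t) A) (q N) i = T n M (B t) (T M N A (q N)) i" by (simp add: T_comp qN)
    also have "\<dots> = y i"
    proof (cases "i < D n")
      case True
      then show ?thesis using t TF[OF xM] by simp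
    next
      case False
      then show ?thesis using y T_in[OF xM, of n "B t"] by (simp add: coords_def)
    qed
    finally show "T n N (mmul M (B t) A) (q N) i = y i" .
  qed
  then show "\<exists>N A. T n N A (q N) = y" by blast
qed

text \<open>A covering \<open>q\<close> maps to the sum of \<open>M\<close> disjoint copies of
  \<open>s0\<close>; \<open>C l\<close> is the block of rows of this matrix that produces the copy
  \<open>l\<close>. Combining the blocks with scalars \<open>t l\<close> superposes the
  copies.\<close>

lemma covers_copies:
  fixes M :: nat
  assumes q: "q \<in> Q" and "covers q" and s0: "s0 \<in> V n"
  shows "\<exists>N C. \<forall>t. T n N (\<lambda>i j. \<Sum>l<M. t l * C l i j) (q N) = (\<lambda>i. (\<Sum>l<M. t l ^ d) * s0 i)"
proof -
  interpret block_family D T d "\<lambda>_. n" "\<lambda>_. s0"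
    by unfold_locales (rule s0)
  obtain N A where A: "T (off M) N A (q N) = bsum M"
    using assms(2) bsum_V[of M] unfolding covers_def by blast
  define C where "C = (\<lambda>l i j. A (off l + i) j)"
  have "T n N (\<lambda>i j. \<Sum>l<M. t l * C l i j) (q N) = (\<lambda>i. (\<Sum>l<M. t l ^ d) * s0 i)" for t
  proof -
    let ?B = "\<lambda>i j. \<Sum>k<M. t k * (if j = off k + i then 1 else 0 :: 'a)"
    have "T n N (\<lambda>i j. \<Sum>l<M. t l * C l i j) = T n N (mmul (off M) ?B A)"
    proof (rule T_cong)
      fix i j assume i: "i < n" and "j < N"
      have "mmul (off M) ?B A i j = (\<Sum>k<M. \<Sum>c<off M. if c = off k + i then t k * A c j else 0)"
        unfolding mmul_def sum_distrib_right by (subst sum.swap, intro sum.cong) auto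
      also have "\<dots> = (\<Sum>k<M. t k * C k i j)"
        using off_inside i by (intro sum.cong) (auto simp: C_def)
      finally show "(\<Sum>l<M. t l * C l i j) = mmul (off M) ?B A i j" by simp
    qed
    then have "T n N (\<lambda>i j. \<Sum>l<M. t l * C l i j) (q N) = T n (off M) ?B (T (off M) N A (q N))"
      by (simp add: T_comp Q_V[OF q])
    then show ?thesis unfolding A by (simp add: bsum_eval sum_distrib_right)
  qed
  then show ?thesis by blast
qed

text \<open>
  Substituting \<open>\<Sum> t\<^sub>l C\<^sub>l\<close> for the new variables gives \<open>\<Sum> t\<^sub>l\<^sup>d s0\<close> in the pure part,
  while the mixed part consists of forms in \<open>t\<close> of degrees strictly between 0 and \<open>d\<close>.
\<close>

lemma covers_extend:
  assumes q: "q \<in> Q" and cov: "covers q" and s0: "s0 \<in> V b"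
    and A: "rows_within A n N" and x: "T n N A (q N) = x"
  shows "\<exists>A' N'. (\<forall>i<n. A' i = A i) \<and> rows_within A' (n + b) N' \<and>
    T (n + b) N' A' (q N') = (\<lambda>i. T (n + b) n idm x i + T (n + b) b (shift n) s0 i)"
proof -
  let ?D = "D (n + b)"
  \<comment> \<open>One condition for each coordinate of the target and each exponent of the single
    parameter \<open>u 0\<close>; this number is fixed before the \<open>M\<close> copies are
    chosen.\<close>
  obtain M where M: "lower_forms_solvable TYPE('a) d (d - 1) (?D * card (expos 1 d)) M"
    using lower_forms_solvable_exists[of "d - 1" d] d by auto
  obtain N1 C where C: "\<And>t. T b N1 (\<lambda>i j. \<Sum>l<M. t l * C l i j) (q N1) = (\<lambda>i. (\<Sum>l<M. t l ^ d) * s0 i)"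
    using covers_copies[OF q cov s0] by blast
  define N2 where "N2 = max N N1"
  \<comment> \<open>Columns from \<open>N1\<close> on are cleared, since the choice of the copies
    says nothing about them and the new rows must be finite.\<close>
  define C0 where "C0 = (\<lambda>l i j. if j < N1 then C l i j else 0)"
  \<comment> \<open>The old rows share one common parameter, so that the degree in it separates old,
    new and mixed contributions.\<close>
  define As where "As = (\<lambda>l i j. if l = 0 then if i < n then A i j else 0
    else if n \<le> i then C0 (l - 1) (i - n) j else 0)"
  define mat where "mat = (\<lambda>u t i j. \<Sum>l<1 + M. (if l < 1 then u l else t (l - 1)) * As l i j)"
  have mat: "mat u t i j = (if i < n then u 0 * A i j else \<Sum>l<M. t l * C0 l (i - n) j)" for u t i j
    unfolding mat_def sum_lessThan_split[of _ 1 M] by (simp add: As_def)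
  have C0: "rows_within (\<lambda>i j. \<Sum>l<M. t l * C0 l i j) b N1" for t
    unfolding rows_within_def C0_def by (metis (mono_tags, lifting) mult_zero_right sum.neutral)
  have A2: "rows_within (mat u t) (n + b) N2" for u t
    unfolding rows_within_def
  proof (intro allI impI)
    fix r c assume r: "r < n + b" and ne: "mat u t r c \<noteq> 0"
    show "c < N2"
    proof (cases "r < n")
      case True
      then have "c < N" using ne A unfolding mat rows_within_def by auto
      then show ?thesis by (simp add: N2_def)
    next
      case False
      then have "r - n < b" using r by linarith
      moreover have "(\<Sum>l<M. t l * C0 l (r - n) c) \<noteq> 0" using ne False by (simp add: mat)
      ultimately have "c < N1" using C0[of t] unfolding rows_within_def by blast
      then show ?thesis by (simp add: N2_def)
    qed
  qed
  have q2: "q N2 \<in> V N2" by (rule Q_V[OF q])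
  have "\<exists>G. (\<forall>\<alpha>\<in>expos 1 d. form M (d - sum \<alpha> {..<1}) (G \<alpha>)) \<and>
    (\<forall>u t. T (n + b) N2 (mat u t) (q N2) c = (\<Sum>\<alpha>\<in>expos 1 d. mon 1 \<alpha> u * G \<alpha> t))" for c
    using form_expand[OF T_form[OF q2], where b1 = c and m1 = "n + b" and As1 = As and m = 1 and k = M]
    unfolding mat_def .
  then have "\<forall>c. \<exists>G. (\<forall>\<alpha>\<in>expos 1 d. form M (d - sum \<alpha> {..<1}) (G \<alpha>)) \<and>
    (\<forall>u t. T (n + b) N2 (mat u t) (q N2) c = (\<Sum>\<alpha>\<in>expos 1 d. mon 1 \<alpha> u * G \<alpha> t))" by (rule allI)
  from choice[OF this] obtain G where
    G: "\<And>c \<alpha>. \<alpha> \<in> expos 1 d \<Longrightarrow> form M (d - sum \<alpha> {..<1}) (G c \<alpha>)"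
    and TG: "\<And>c u t. T (n + b) N2 (mat u t) (q N2) c = (\<Sum>\<alpha>\<in>expos 1 d. mon 1 \<alpha> u * G c \<alpha> t)" by blast
  define mixed where "mixed = {(c, \<alpha>). c < ?D \<and> \<alpha> \<in> expos 1 d \<and> 0 < \<alpha> 0 \<and> \<alpha> 0 < d}"
  have mixed: "mixed \<subseteq> {..<?D} \<times> expos 1 d" by (auto simp: mixed_def)
  have finm: "finite mixed" by (rule finite_subset[OF mixed]) (simp add: finite_expos)
  let ?F = "(\<lambda>(c, \<alpha>). G c \<alpha>) ` mixed"
  have "\<exists>t. (\<forall>f\<in>?F. f t = 0) \<and> (\<Sum>i<M. t i ^ d) = 1"
  proof -
    have "card ?F \<le> card mixed" by (rule card_image_le[OF finm])
    also have "\<dots> \<le> card ({..<?D} \<times> expos 1 d)" by (rule card_mono[OF _ mixed]) (simp add: finite_expos)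
    finally have "card ?F \<le> ?D * card (expos 1 d)" by (simp add: card_cartesian_product)
    moreover have "\<forall>f\<in>?F. \<exists>g. 1 \<le> g \<and> g \<le> d - 1 \<and> form M g f"
    proof
      fix f assume "f \<in> ?F"
      then obtain c \<alpha> where c: "\<alpha> \<in> expos 1 d" "0 < \<alpha> 0" "\<alpha> 0 < d" "f = G c \<alpha>" by (auto simp: mixed_def)
      then have "form M (d - \<alpha> 0) f" using G[of \<alpha> c] by simp
      then show "\<exists>g. 1 \<le> g \<and> g \<le> d - 1 \<and> form M g f" using c by (intro exI[of _ "d - \<alpha> 0"]) auto
    qed
    ultimately show ?thesis using M finm unfolding lower_forms_solvable_def by blast
  qed
  then obtain t where t: "\<forall>f\<in>?F. f t = 0" and t1: "(\<Sum>i<M. t i ^ d) = 1" by blast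
  have G0: "G c \<alpha> t = 0" if "(c, \<alpha>) \<in> mixed" for c \<alpha>
    using bspec[OF t, of "G c \<alpha>"] that by force
  let ?one = "\<lambda>_::nat. 1::'a" and ?zero = "\<lambda>_::nat. 0::'a"
  \<comment> \<open>Exponent 0 of the old parameter gives the new part and exponent \<open>d\<close>
    the old part, with a constant coefficient. All other coefficients vanish at \<open>t\<close>, so
    the value is additive.\<close>
  have split: "T (n + b) N2 (mat ?one t) (q N2) c =
      T (n + b) N2 (mat ?one ?zero) (q N2) c + T (n + b) N2 (mat ?zero t) (q N2) c" for c
  proof (cases "c < ?D")
    case True
    have "mon 1 \<alpha> ?one * G c \<alpha> t = mon 1 \<alpha> ?one * G c \<alpha> ?zero + mon 1 \<alpha> ?zero * G c \<alpha> t"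
      if \<alpha>: "\<alpha> \<in> expos 1 d" for \<alpha>
    proof -
      have "\<alpha> 0 \<le> d" using \<alpha> by (simp add: expos_def)
      then consider "\<alpha> 0 = 0" | "\<alpha> 0 = d" | "0 < \<alpha> 0" "\<alpha> 0 < d" by linarith
      then show ?thesis
      proof cases
        case 1
        then have "G c \<alpha> ?zero = 0" using form_at_zero[OF G[OF \<alpha>]] d by simp
        then show ?thesis using 1 by (simp add: mon_def)
      next
        case 2
        then have "form M 0 (G c \<alpha>)" using G[OF \<alpha>, of c] by simp
        from form_degree_0[OF this, of t ?zero] show ?thesis using 2 d by (simp add: mon_def)
      next
        case 3
        then have "G c \<alpha> ?zero = 0" using form_at_zero[OF G[OF \<alpha>]] by simp
        moreover have "G c \<alpha> t = 0" using 3 True \<alpha> by (intro G0) (simp add: mixed_def)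
        ultimately show ?thesis by simp
      qed
    qed
    then show ?thesis unfolding TG sum.distrib[symmetric] by (rule sum.cong[OF refl])
  next
    case False
    then show ?thesis using T_in[OF q2] by (simp add: coords_def)
  qed
  have "T (n + b) N2 (mat ?one ?zero) (q N2) = T (n + b) n idm x"
  proof -
    have "T (n + b) N2 (mat ?one ?zero) = T (n + b) N2 (mmul n idm A)"
    proof (rule T_cong)
      fix i j show "mat ?one ?zero i j = mmul n idm A i j"
        by (cases "i < n") (simp_all add: mat idm_mmul idm_mmul_out)
    qed
    then have "T (n + b) N2 (mat ?one ?zero) (q N2) = T (n + b) n idm (T n N2 A (q N2))"
      by (simp add: T_comp[OF q2])
    also have "T n N2 A (q N2) = x" unfolding x[symmetric] by (rule Q_rows[OF q A]) (simp add: N2_def)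
    finally show ?thesis .
  qed
  moreover have "T (n + b) N2 (mat ?zero t) (q N2) = T (n + b) b (shift n) s0"
  proof -
    let ?C = "\<lambda>i j. \<Sum>l<M. t l * C0 l i j"
    have "T (n + b) N2 (mat ?zero t) = T (n + b) N2 (mmul b (shift n) ?C)"
    proof (rule T_cong)
      fix i j assume i: "i < n + b"
      show "mat ?zero t i j = mmul b (shift n) ?C i j"
      proof (cases "i < n")
        case True
        then have "mmul b (shift n) ?C i j = 0" unfolding mmul_def by (intro sum.neutral) (auto simp: shift_def)
        then show ?thesis using True by (simp add: mat)
      next
        case False
        have "mmul b (shift n) ?C i j = (\<Sum>l<b. if l = i - n then ?C l j else 0)"
          unfolding mmul_def using False by (intro sum.cong) (auto simp: shift_def)
        then show ?thesis using False i by (auto simp: mat)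
      qed
    qed
    then have "T (n + b) N2 (mat ?zero t) (q N2) = T (n + b) b (shift n) (T b N2 ?C (q N2))"
      by (simp add: T_comp[OF q2])
    also have "T b N2 ?C (q N2) = T b N1 ?C (q N1)"
      by (rule Q_rows[OF q C0]) (simp add: N2_def)
    also have "T b N1 ?C = T b N1 (\<lambda>i j. \<Sum>l<M. t l * C l i j)"
      by (rule T_cong) (simp add: C0_def)
    also have "T b N1 (\<lambda>i j. \<Sum>l<M. t l * C l i j) (q N1) = s0" by (simp add: C t1)
    finally show ?thesis .
  qed
  ultimately have "T (n + b) N2 (mat ?one t) (q N2) = (\<lambda>i. T (n + b) n idm x i + T (n + b) b (shift n) s0 i)"
    using split by (intro ext) simp
  moreover have "\<forall>i<n. mat ?one t i = A i" by (auto simp: mat)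
  ultimately show ?thesis using A2 by blast
qed

subsection \<open>A minimal element\<close>

text \<open>Block \<open>k\<close> encodes a pair (n, i) and carries the basis vector
  \<open>i\<close> of level \<open>n + 1\<close>, or zero if \<open>i\<close> is out of range.
  Positive sizes make the offsets unbounded, so the blocks reach every variable.\<close>

definition min_size :: "nat \<Rightarrow> nat" where
  "min_size k = Suc (fst (prod_decode k))"

definition min_block :: "nat \<Rightarrow> nat \<Rightarrow> 'a" where
  "min_block k = (if snd (prod_decode k) < D (min_size k) then unit (snd (prod_decode k)) else (\<lambda>_. 0))"

end

sublocale matrix_functor \<subseteq> min: block_family D T d min_size min_block
  by unfold_locales (auto simp: min_block_def unit_coords zero_coords)

context matrix_functor
begin

lemma min_off: "k \<le> min.off k"
proof (induction k)
  case (Suc k)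
  moreover have "0 < min_size k" by (simp add: min_size_def)
  ultimately show ?case unfolding min.off_Suc by linarith
qed simp

text \<open>By \<open>min_off\<close> the first \<open>n\<close> blocks already contain the first
  \<open>n\<close> variables; later blocks do not affect level \<open>n\<close>.\<close>

definition min_elt :: "nat \<Rightarrow> nat \<Rightarrow> 'a" where
  "min_elt n = T n (min.off n) idm (min.bsum n)"

lemma min_elt_eq: "n \<le> min.off k \<Longrightarrow> min_elt n = T n (min.off k) idm (min.bsum k)"
proof -
  have eq: "T n (min.off l) idm (min.bsum l) = T n (min.off k) idm (min.bsum k)"
    if "k \<le> l" "n \<le> min.off k" for k l
    using T_idm_trans[OF that(2) min.bsum_V, of l] min.bsum_restrict[OF that(1)] by simp
  show "n \<le> min.off k \<Longrightarrow> ?thesis"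
    unfolding min_elt_def using eq[of k n] eq[of n k] min_off[of n] by (cases "k \<le> n") auto
qed

lemma min_elt_off: "min_elt (min.off k) = min.bsum k"
  using min_elt_eq[OF order_refl, of k] T_id[OF min.bsum_V] by simp

lemma min_elt_Q: "min_elt \<in> Q"
  unfolding Q_def
proof (intro CollectI allI conjI)
  fix n
  show "min_elt n \<in> V n" unfolding min_elt_def by (rule T_in[OF min.bsum_V])
  have "min_elt n = T n (min.off (Suc n)) idm (min.bsum (Suc n))"
    by (rule min_elt_eq) (use min_off[of "Suc n"] in simp)
  then show "T n (Suc n) idm (min_elt (Suc n)) = min_elt n"
    unfolding min_elt_def[of "Suc n"] by (simp only: T_idm_trans[OF le_SucI[OF order_refl] min.bsum_V])
qed

text \<open>Points of level \<open>n\<close> are included into level \<open>n + 1\<close>, reached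
  there, and projected back. This accounts for level 0, for which the minimal element has no
  blocks.\<close>

lemma covers_if_Suc:
  assumes q: "q \<in> Q" and "\<And>n y. y \<in> V (Suc n) \<Longrightarrow> \<exists>N A. T (Suc n) N A (q N) = y"
  shows "covers q"
  unfolding covers_def
proof (intro allI ballI)
  fix n y assume y: "y \<in> V n"
  obtain N A where A: "T (Suc n) N A (q N) = T (Suc n) n idm y" using assms(2)[OF T_in[OF y]] by blast
  have "T n N (mmul (Suc n) idm A) (q N) = T n (Suc n) idm (T (Suc n) n idm y)"
    unfolding A[symmetric] by (rule T_comp[symmetric, OF Q_V[OF q]])
  also have "\<dots> = y" using T_idm_trans[OF le_SucI[OF order_refl] y] T_id[OF y] by simp
  finally show "\<exists>N A. T n N A (q N) = y" by blast
qed

lemma min_elt_covers: "covers min_elt"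
proof (rule covers_if_Suc[OF min_elt_Q])
  fix n y assume y: "y \<in> V (Suc n)"
  have "\<exists>c. \<forall>i. c i ^ d = y i" using nth_root_exists[OF d] by (intro choice allI)
  then obtain c where c: "\<And>i. c i ^ d = y i" by blast
  \<comment> \<open>Large enough that the blocks of all pairs (n, i) with
    \<open>i < D (Suc n)\<close> are among the first \<open>K\<close>.\<close>
  define K where "K = Suc (\<Sum>i<D (Suc n). prod_encode (n, i))"
  have K: "prod_encode (n, i) < K" if "i < D (Suc n)" for i
    using member_le_sum[of i "{..<D (Suc n)}" "\<lambda>i. prod_encode (n, i)"] that by (simp add: K_def)
  \<comment> \<open>Only the blocks of size \<open>Suc n\<close> are switched on, scaled by
    \<open>d\<close>-th roots of the coordinates of \<open>y\<close>.\<close>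
  define c' where "c' = (\<lambda>k. if fst (prod_decode k) = n \<and> snd (prod_decode k) < D (Suc n)
    then c (snd (prod_decode k)) else 0)"
  let ?A = "\<lambda>i j. \<Sum>k<K. c' k * (if j = min.off k + i then 1 else 0 :: 'a)"
  have "T (Suc n) (min.off K) ?A (min_elt (min.off K)) = (\<lambda>i. \<Sum>k<K. c' k ^ d * min_block k i)"
    unfolding min_elt_off by (rule min.bsum_eval) (auto simp: c'_def min_size_def split: if_splits)
  also have "\<dots> = y"
  proof
    fix i
    show "(\<Sum>k<K. c' k ^ d * min_block k i) = y i"
    proof (cases "i < D (Suc n)")
      case True
      have "c' k ^ d * min_block k i = (if k = prod_encode (n, i) then y i else 0)" for k
      proof (cases "k = prod_encode (n, i)")
        case True
        then show ?thesis using c \<open>i < D (Suc n)\<close> by (simp add: c'_def min_block_def min_size_def unit_def)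
      next
        case False
        then have "prod_decode k \<noteq> (n, i)" by (metis prod_decode_inverse)
        then show ?thesis using d False
          by (cases "prod_decode k") (auto simp: c'_def min_block_def min_size_def unit_def power_0_left)
      qed
      then show ?thesis using K[OF True] by simp
    next
      case False
      have "c' k ^ d * min_block k i = 0" for k
        using d False by (auto simp: c'_def min_block_def min_size_def unit_def power_0_left)
      then show ?thesis using y False by (simp add: coords_def)
    qed
  qed
  finally show "\<exists>N A. T (Suc n) N A (min_elt N) = y" by blast
qed

text \<open>Stage \<open>k\<close> has a finite matrix that reaches the first \<open>k\<close>
  blocks. As \<open>covers_extend\<close> keeps the rows already present, the matrices converge row
  by row, and each row of the limit already occurs at a finite stage.\<close>

theorem min_elt_minimal:
  assumes q: "q \<in> Q" and cov: "covers q"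
  shows "\<exists>\<phi>\<in>row_finite_matrices. \<forall>n N. rows_within \<phi> n N \<longrightarrow> T n N \<phi> (q N) = min_elt n"
proof -
  define ok where "ok = (\<lambda>k (x :: (nat \<Rightarrow> nat \<Rightarrow> 'a) \<times> nat). rows_within (fst x) (min.off k) (snd x) \<and>
    T (min.off k) (snd x) (fst x) (q (snd x)) = min.bsum k)"
  have "\<exists>f. \<forall>k. ok k (f k) \<and> (\<forall>i<min.off k. fst (f (Suc k)) i = fst (f k) i)"
  proof (rule dependent_nat_choice)
    \<comment> \<open>At level 0 the identity is also a zero matrix, so positive degree forces the
      value 0.\<close>
    have "T 0 0 idm (q 0) = (\<lambda>_. 0)" by (rule T_zero[OF Q_V[OF q]]) auto
    then show "\<exists>x. ok 0 x" by (intro exI[of _ "(idm, 0)"]) (simp add: ok_def min.off_def rows_within_def)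
  next
    fix x k assume x: "ok k x"
    then obtain A' N' where "\<forall>i<min.off k. A' i = fst x i" "rows_within A' (min.off (Suc k)) N'"
      "T (min.off (Suc k)) N' A' (q N') = min.bsum (Suc k)"
      using covers_extend[OF q cov min.s[of k], of "fst x" "min.off k" "snd x"]
      unfolding ok_def min.off_Suc[symmetric] min.bsum.simps by metis
    then show "\<exists>y. ok (Suc k) y \<and> (\<forall>i<min.off k. fst y i = fst x i)"
      by (intro exI[of _ "(A', N')"]) (simp add: ok_def)
  qed
  then obtain f where f: "\<And>k. ok k (f k)" "\<And>k i. i < min.off k \<Longrightarrow> fst (f (Suc k)) i = fst (f k) i" by blast
  have stable: "fst (f l) i = fst (f k) i" if "k \<le> l" "i < min.off k" for k l i
    using that
  proof (induction l rule: dec_induct)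
    case (step l)
    then show ?case using f(2)[of i l] min.off_mono[of k l] by simp
  qed simp
  \<comment> \<open>Row \<open>i\<close> is final from stage \<open>Suc i\<close> on, because
    \<open>i < min.off (Suc i)\<close>.\<close>
  define \<phi> where "\<phi> = (\<lambda>i. fst (f (Suc i)) i)"
  have \<phi>: "\<phi> i = fst (f k) i" if "i < min.off k" for i k
  proof -
    have "i < min.off (Suc i)" using min_off[of "Suc i"] by simp
    then show ?thesis unfolding \<phi>_def using stable[of k "Suc i" i] stable[of "Suc i" k i] that
      by (cases "k \<le> Suc i") auto
  qed
  have rows: "rows_within \<phi> (min.off k) (snd (f k))" for k
    using f(1)[of k] \<phi> unfolding ok_def rows_within_def by metis
  have bs: "T (min.off k) (snd (f k)) \<phi> (q (snd (f k))) = min.bsum k" for k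
  proof -
    have "T (min.off k) (snd (f k)) \<phi> = T (min.off k) (snd (f k)) (fst (f k))"
      by (rule T_cong) (simp add: \<phi>)
    then show ?thesis using f(1)[of k] by (simp add: ok_def)
  qed
  have "\<phi> \<in> row_finite_matrices"
    unfolding row_finite_matrices_def
  proof (intro CollectI allI)
    fix i
    have "{j. \<phi> i j \<noteq> 0} \<subseteq> {..<snd (f (Suc i))}"
      using rows[of "Suc i"] less_le_trans[OF lessI min_off[of "Suc i"]] unfolding rows_within_def by blast
    then show "finite {j. \<phi> i j \<noteq> 0}" by (rule finite_subset) simp
  qed
  moreover have "T n N \<phi> (q N) = min_elt n" if N: "rows_within \<phi> n N" for n N
  proof -
    let ?N = "snd (f n)"
    have n: "rows_within \<phi> n ?N" using rows[of n] less_le_trans[OF _ min_off[of n]] unfolding rows_within_def by blast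
    have "T n N \<phi> (q N) = T n (max N ?N) \<phi> (q (max N ?N))"
      by (rule Q_rows[OF q N, symmetric]) simp
    also have "\<dots> = T n ?N \<phi> (q ?N)" by (rule Q_rows[OF q n]) simp
    also have "T n ?N \<phi> = T n ?N (mmul (min.off n) idm \<phi>)"
      by (rule T_cong) (use min_off[of n] in \<open>simp add: idm_mmul\<close>)
    also have "T n ?N (mmul (min.off n) idm \<phi>) (q ?N) = T n (min.off n) idm (T (min.off n) ?N \<phi> (q ?N))"
      by (rule T_comp[OF Q_V[OF q], symmetric])
    finally show ?thesis by (simp add: bs min_elt_def)
  qed
  ultimately show ?thesis by blast
qed

end

subsection \<open>Weight vectors\<close>

definition dg :: "(nat \<Rightarrow> 'a::zero) \<Rightarrow> nat \<Rightarrow> nat \<Rightarrow> 'a" where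
  "dg s = (\<lambda>i j. if i = j then s i else 0)"

text \<open>Maps variable \<open>m\<close> to variable \<open>ns ! m\<close>; its transpose picks
  out the coordinates listed in \<open>ns\<close>.\<close>

definition sel :: "nat list \<Rightarrow> nat \<Rightarrow> nat \<Rightarrow> 'a::zero_neq_one" where
  "sel ns = (\<lambda>i m. if m < length ns \<and> i = ns ! m then 1 else 0)"

definition expo :: "nat list \<Rightarrow> nat \<Rightarrow> nat" where
  "expo \<beta> = (\<lambda>m. if m < length \<beta> then \<beta> ! m else 0)"

lemma mmul_dg: "j < k \<Longrightarrow> mmul k A (dg s) i j = A i j * s j" for A :: "nat \<Rightarrow> nat \<Rightarrow> 'a::semiring_1"
  by (simp add: mmul_def dg_def if_distrib[of "\<lambda>x. _ * x"] cong: if_cong)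

lemma dg_mmul: "i < k \<Longrightarrow> mmul k (dg s) A i j = s i * A i j" for A :: "nat \<Rightarrow> nat \<Rightarrow> 'a::semiring_1"
  by (simp add: mmul_def dg_def if_distrib[of "\<lambda>x. x * _"] cong: if_cong)

lemma mmul_sel:
  "m < length ns \<Longrightarrow> ns ! m < k \<Longrightarrow> mmul k A (sel ns) i m = A i (ns ! m)" for A :: "nat \<Rightarrow> nat \<Rightarrow> 'a::semiring_1"
  by (simp add: mmul_def sel_def if_distrib[of "\<lambda>x. _ * x"] cong: if_cong)

lemma sel_mmul:
  "m < length ns \<Longrightarrow> ns ! m < k \<Longrightarrow> mmul k (\<lambda>m i. sel ns i m) A m i = A (ns ! m) i" for A :: "nat \<Rightarrow> nat \<Rightarrow> 'a::semiring_1"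
  by (simp add: mmul_def sel_def if_distrib[of "\<lambda>x. x * _"] cong: if_cong)

context matrix_functor
begin

lemma dg_form: "x \<in> V n \<Longrightarrow> form n d (\<lambda>s. T n n (dg s) x b)"
proof -
  assume x: "x \<in> V n"
  have "T n n (\<lambda>i j. \<Sum>l<n. s l * (if i = l \<and> j = l then 1 else 0)) = T n n (dg s)" for s
  proof (rule T_cong)
    fix i j assume "i < n"
    have "(\<Sum>l<n. s l * (if i = l \<and> j = l then 1 else 0)) = (\<Sum>l<n. if l = i then dg s i j else 0)"
      by (intro sum.cong) (auto simp: dg_def)
    then show "(\<Sum>l<n. s l * (if i = l \<and> j = l then 1 else 0)) = dg s i j" using \<open>i < n\<close> by simp
  qed
  with T_form[OF x, of n n "\<lambda>l i j. if i = l \<and> j = l then 1 else 0" b] show ?thesis by simp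
qed

text \<open>The component of weight \<alpha> for the diagonal torus: the coefficient of s^\<alpha>
  in the action of diag(s). The choice is harmless on the relevant exponents, where coefficients are
  unique.\<close>

definition wt :: "nat \<Rightarrow> (nat \<Rightarrow> 'a) \<Rightarrow> (nat \<Rightarrow> nat) \<Rightarrow> nat \<Rightarrow> 'a" where
  "wt n x \<alpha> b = (SOME c. \<forall>s. T n n (dg s) x b = (\<Sum>\<alpha>\<in>hexpos n d. c \<alpha> * mon n \<alpha> s)) \<alpha>"

lemma wt_expand: "x \<in> V n \<Longrightarrow> T n n (dg s) x b = (\<Sum>\<alpha>\<in>hexpos n d. wt n x \<alpha> b * mon n \<alpha> s)"
  unfolding wt_def using someI_ex[OF form_coeffs[OF dg_form, of x n b]] by blast

lemma wt_unique:
  assumes "x \<in> V n" "\<alpha> \<in> hexpos n d"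
    and "\<And>s b. T n n (dg s) x b = (\<Sum>\<alpha>\<in>hexpos n d. y \<alpha> b * mon n \<alpha> s)"
  shows "wt n x \<alpha> = y \<alpha>"
proof
  fix b
  show "wt n x \<alpha> b = y \<alpha> b"
    by (rule hexpos_coeffs_unique[OF _ assms(2), where c = "\<lambda>\<alpha>. wt n x \<alpha> b" and c' = "\<lambda>\<alpha>. y \<alpha> b"])
      (simp only: wt_expand[OF assms(1), symmetric] assms(3)[symmetric])
qed

lemma wt_V: "x \<in> V n \<Longrightarrow> \<alpha> \<in> hexpos n d \<Longrightarrow> wt n x \<alpha> \<in> V n"
proof -
  assume x: "x \<in> V n" and \<alpha>: "\<alpha> \<in> hexpos n d"
  have "wt n x \<alpha> = (\<lambda>b. if b < D n then wt n x \<alpha> b else 0)"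
  proof (rule wt_unique[OF x \<alpha>])
    fix s b
    show "T n n (dg s) x b = (\<Sum>\<alpha>\<in>hexpos n d. (if b < D n then wt n x \<alpha> b else 0) * mon n \<alpha> s)"
    proof (cases "b < D n")
      case False
      have "T n n (dg s) x \<in> V n" by (rule T_in[OF x])
      then have "T n n (dg s) x b = 0" using False by (simp add: coords_def)
      then show ?thesis using False by simp
    qed (simp add: wt_expand[OF x])
  qed
  note eq = fun_cong[OF this]
  show ?thesis
    unfolding coords_def
  proof (intro CollectI allI impI)
    fix b assume "D n \<le> b"
    then show "wt n x \<alpha> b = 0" by (subst eq) simp
  qed
qed

lemma dg_one: "dg (\<lambda>_. 1) = idm"
  by (simp add: dg_def idm_def)

lemma wt_sum: "x \<in> V n \<Longrightarrow> x = (\<lambda>b. \<Sum>\<alpha>\<in>hexpos n d. wt n x \<alpha> b)"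
  using wt_expand[of x n "\<lambda>_. 1"] by (simp add: dg_one T_id mon_one fun_eq_iff)

lemma T_wt_sum:
  assumes "x \<in> V n"
  shows "T m n A (T n n (dg s) x) b = (\<Sum>\<alpha>\<in>hexpos n d. mon n \<alpha> s * T m n A (wt n x \<alpha>) b)"
proof -
  have "T n n (dg s) x = (\<lambda>b. \<Sum>\<alpha>\<in>hexpos n d. mon n \<alpha> s * wt n x \<alpha> b)"
    using wt_expand[OF assms, of s] by (simp add: fun_eq_iff mult.commute)
  then have "T m n A (T n n (dg s) x) = T m n A (\<lambda>b. \<Sum>\<alpha>\<in>hexpos n d. mon n \<alpha> s * wt n x \<alpha> b)" by simp
  also have "\<dots> = (\<lambda>b. \<Sum>\<alpha>\<in>hexpos n d. mon n \<alpha> s * T m n A (wt n x \<alpha>) b)"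
    by (rule T_sum) (rule wt_V[OF assms])
  finally show ?thesis by simp
qed

lemma T_dg_dg: "x \<in> V n \<Longrightarrow> T n n (dg u) (T n n (dg s) x) = T n n (dg (\<lambda>i. u i * s i)) x"
proof -
  assume x: "x \<in> V n"
  have "T n n (mmul n (dg u) (dg s)) = T n n (dg (\<lambda>i. u i * s i))"
    by (rule T_cong) (simp add: mmul_dg, simp add: dg_def)
  then show ?thesis using x by (simp add: T_comp)
qed

text \<open>Compare the coefficients of s^\<alpha> in the identity diag(u) diag(s) = diag(us),
  applied to \<open>x\<close>.\<close>

lemma wt_weight:
  assumes x: "x \<in> V n" and \<alpha>: "\<alpha> \<in> hexpos n d"
  shows "T n n (dg u) (wt n x \<alpha>) = (\<lambda>b. mon n \<alpha> u * wt n x \<alpha> b)"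
proof
  fix b
  have "(\<Sum>\<alpha>\<in>hexpos n d. T n n (dg u) (wt n x \<alpha>) b * mon n \<alpha> s) =
      (\<Sum>\<alpha>\<in>hexpos n d. (mon n \<alpha> u * wt n x \<alpha> b) * mon n \<alpha> s)" for s
    using T_wt_sum[OF x, of n "dg u" s b] T_dg_dg[OF x, of u s] wt_expand[OF x, of "\<lambda>i. u i * s i" b]
    by (simp add: mon_mult mult_ac)
  from hexpos_coeffs_unique[OF this \<alpha>]
  show "T n n (dg u) (wt n x \<alpha>) b = mon n \<alpha> u * wt n x \<alpha> b" .
qed

lemma hexpos_mono: "n \<le> m \<Longrightarrow> hexpos n d \<subseteq> hexpos m d"
proof
  fix \<alpha> assume "n \<le> m" and \<alpha>: "\<alpha> \<in> hexpos n d"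
  then have "sum \<alpha> {..<m} = sum \<alpha> {..<n}"
    by (intro sum.mono_neutral_right) (auto simp: hexpos_def)
  then show "\<alpha> \<in> hexpos m d" using \<alpha> \<open>n \<le> m\<close> by (auto simp: hexpos_def)
qed

text \<open>Acting by diag(s) after projecting is the same as first acting by the extension of
  \<open>s\<close> by zero. That extension kills every weight involving one of the forgotten
  variables.\<close>

lemma wt_restrict:
  assumes nm: "n \<le> m" and x: "x \<in> V m" and \<alpha>: "\<alpha> \<in> hexpos n d"
  shows "wt n (T n m idm x) \<alpha> = T n m idm (wt m x \<alpha>)"
proof (rule wt_unique[OF T_in[OF x] \<alpha>])
  fix s b
  define s' where "s' = (\<lambda>i. if i < n then s i else 0 :: 'a)"
  have "T n m (mmul n (dg s) idm) = T n m (mmul m idm (dg s'))"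
  proof (rule T_cong)
    fix i j assume "i < n" "j < m"
    then show "mmul n (dg s) idm i j = mmul m idm (dg s') i j"
      by (simp add: dg_mmul mmul_dg) (simp add: idm_def s'_def)
  qed
  then have "T n n (dg s) (T n m idm x) b = T n m idm (T m m (dg s') x) b"
    using x by (simp add: T_comp)
  also have "\<dots> = (\<Sum>\<alpha>\<in>hexpos m d. mon m \<alpha> s' * T n m idm (wt m x \<alpha>) b)" by (rule T_wt_sum[OF x])
  also have "\<dots> = (\<Sum>\<alpha>\<in>hexpos n d. mon m \<alpha> s' * T n m idm (wt m x \<alpha>) b)"
  proof (rule sum.mono_neutral_right[OF finite_hexpos hexpos_mono[OF nm]], intro ballI)
    fix \<beta> assume \<beta>: "\<beta> \<in> hexpos m d - hexpos n d"
    have "\<exists>i<m. n \<le> i \<and> \<beta> i \<noteq> 0"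
    proof (rule ccontr)
      assume "\<not> ?thesis"
      then have 0: "\<beta> i = 0" if "n \<le> i" for i using \<beta> that by (cases "i < m") (auto simp: hexpos_def)
      then have "sum \<beta> {..<m} = sum \<beta> {..<n}" using nm by (intro sum.mono_neutral_right) auto
      then show False using \<beta> 0 by (auto simp: hexpos_def)
    qed
    then obtain i where i: "i < m" "n \<le> i" "\<beta> i \<noteq> 0" by blast
    have "mon m \<beta> s' = 0"
      unfolding mon_def using i by (intro prod_zero) (auto simp: s'_def power_0_left intro!: bexI[of _ i])
    then show "mon m \<beta> s' * T n m idm (wt m x \<beta>) b = 0" by simp
  qed
  also have "\<dots> = (\<Sum>\<alpha>\<in>hexpos n d. T n m idm (wt m x \<alpha>) b * mon n \<alpha> s)"
  proof (intro sum.cong refl)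
    fix \<beta> assume "\<beta> \<in> hexpos n d"
    then have "mon m \<beta> s' = mon n \<beta> s'"
      unfolding mon_def using nm by (intro prod.mono_neutral_right) (auto simp: hexpos_def)
    also have "\<dots> = mon n \<beta> s" by (rule mon_cong) (simp_all add: s'_def)
    finally show "mon m \<beta> s' * T n m idm (wt m x \<beta>) b = T n m idm (wt m x \<beta>) b * mon n \<beta> s"
      by (simp add: mult.commute)
  qed
  finally show "T n n (dg s) (T n m idm x) b = (\<Sum>\<alpha>\<in>hexpos n d. T n m idm (wt m x \<alpha>) b * mon n \<alpha> s)" .
qed

lemma wt_of_weight_vector:
  assumes x: "x \<in> V n" and \<alpha>: "\<alpha> \<in> hexpos n d" and w: "\<And>s b. T n n (dg s) x b = mon n \<alpha> s * x b"
  shows "wt n x \<alpha> = x"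
proof -
  have "wt n x \<alpha> = (if \<alpha> = \<alpha> then x else (\<lambda>_. 0))"
  proof (rule wt_unique[OF x \<alpha>, of "\<lambda>\<beta>. if \<beta> = \<alpha> then x else (\<lambda>_. 0)"])
    fix s b
    have "(\<Sum>\<beta>\<in>hexpos n d. (if \<beta> = \<alpha> then x else (\<lambda>_. 0)) b * mon n \<beta> s) =
        (\<Sum>\<beta>\<in>hexpos n d. if \<beta> = \<alpha> then x b * mon n \<alpha> s else 0)"
      by (intro sum.cong) auto
    then show "T n n (dg s) x b = (\<Sum>\<beta>\<in>hexpos n d. (if \<beta> = \<alpha> then x else (\<lambda>_. 0)) b * mon n \<beta> s)"
      using \<alpha> finite_hexpos[of n d] by (simp add: w mult.commute)
  qed
  then show ?thesis by simp
qed

lemma wt_units: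
  assumes x: "x \<in> V n" and \<alpha>: "\<alpha> \<in> hexpos n d"
  shows "wt n x \<alpha> = (\<lambda>b. \<Sum>k<D n. x k * wt n (unit k) \<alpha> b)"
proof (rule wt_unique[OF x \<alpha>, of "\<lambda>\<alpha> b. \<Sum>k<D n. x k * wt n (unit k) \<alpha> b"])
  fix s b
  have "T n n (dg s) x = T n n (dg s) (\<lambda>i. \<Sum>k<D n. x k * unit k i)" using coords_expand[OF x] by simp
  also have "\<dots> = (\<lambda>i. \<Sum>k<D n. x k * T n n (dg s) (unit k) i)" by (rule T_sum) (simp add: unit_coords)
  finally have "T n n (dg s) x b = (\<Sum>k<D n. x k * (\<Sum>\<alpha>\<in>hexpos n d. wt n (unit k) \<alpha> b * mon n \<alpha> s))"
    by (simp add: wt_expand unit_coords)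
  also have "\<dots> = (\<Sum>\<alpha>\<in>hexpos n d. (\<Sum>k<D n. x k * wt n (unit k) \<alpha> b) * mon n \<alpha> s)"
    unfolding sum_distrib_left sum_distrib_right by (subst sum.swap) (simp add: mult.assoc)
  finally show "T n n (dg s) x b = (\<Sum>\<alpha>\<in>hexpos n d. (\<Sum>k<D n. x k * wt n (unit k) \<alpha> b) * mon n \<alpha> s)" .
qed

subsection \<open>A maximal element\<close>

definition exps :: "(nat \<Rightarrow> nat) set" where
  "exps = (\<Union>n. hexpos n d)"

text \<open>A weight is split into its support in increasing order and the list \<open>vals\<close>
  of its exponents there. Up to renaming variables only \<open>vals\<close> matters, and there are
  finitely many such lists.\<close>

definition idx :: "(nat \<Rightarrow> nat) \<Rightarrow> nat list" where
  "idx \<alpha> = sorted_list_of_set {i. \<alpha> i \<noteq> 0}"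

definition vals :: "(nat \<Rightarrow> nat) \<Rightarrow> nat list" where
  "vals \<alpha> = map \<alpha> (idx \<alpha>)"

text \<open>By \<open>wt_units\<close>, these vectors span the space of weight \<beta> in
  \<open>length \<beta>\<close> variables. They may be linearly dependent; only a fixed way of
  expressing vectors by them is used.\<close>

definition wvec :: "nat list \<Rightarrow> nat \<Rightarrow> nat \<Rightarrow> 'a" where
  "wvec \<beta> k = wt (length \<beta>) (unit k) (expo \<beta>)"

lemma supp_hexpos: "\<alpha> \<in> hexpos n d \<Longrightarrow> {i. \<alpha> i \<noteq> 0} \<subseteq> {..<n}"
  unfolding hexpos_def by (auto intro: leI)

lemma exps_finite: "\<alpha> \<in> exps \<Longrightarrow> finite {i. \<alpha> i \<noteq> 0}"
proof -
  assume "\<alpha> \<in> exps"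
  then obtain n where "\<alpha> \<in> hexpos n d" by (auto simp: exps_def)
  then have "{i. \<alpha> i \<noteq> 0} \<subseteq> {..<n}" by (rule supp_hexpos)
  then show ?thesis by (rule finite_subset) simp
qed

lemma idx:
  assumes "\<alpha> \<in> exps"
  shows "set (idx \<alpha>) = {i. \<alpha> i \<noteq> 0}" "distinct (idx \<alpha>)" "sorted_wrt (<) (idx \<alpha>)"
  using exps_finite[OF assms] by (simp_all add: idx_def)

lemma exps_hexpos: "\<alpha> \<in> exps \<Longrightarrow> set (idx \<alpha>) \<subseteq> {..<n} \<Longrightarrow> \<alpha> \<in> hexpos n d"
proof -
  assume e: "\<alpha> \<in> exps" and s: "set (idx \<alpha>) \<subseteq> {..<n}"
  obtain m where m: "\<alpha> \<in> hexpos m d" using e by (auto simp: exps_def)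
  have z: "\<alpha> i = 0" if "n \<le> i" for i 
  proof (rule ccontr)
    assume "\<alpha> i \<noteq> 0"
    then have "i \<in> {..<n}" using s idx(1)[OF e] by blast
    then show False using that by simp
  qed
  have "sum \<alpha> {..<n} = sum \<alpha> {i. \<alpha> i \<noteq> 0}"
    using s idx(1)[OF e] by (intro sum.mono_neutral_right) auto
  also have "\<dots> = sum \<alpha> {..<m}"
    using supp_hexpos[OF m] by (intro sum.mono_neutral_left) auto
  finally show ?thesis using z m by (auto simp: hexpos_def)
qed

lemma hexpos_exps: "\<alpha> \<in> hexpos n d \<Longrightarrow> \<alpha> \<in> exps"
  by (auto simp: exps_def)

lemma idx_bound: "\<alpha> \<in> hexpos n d \<Longrightarrow> set (idx \<alpha>) \<subseteq> {..<n}"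
  using idx(1)[OF hexpos_exps] supp_hexpos by simp

lemma vals: "length (vals \<alpha>) = length (idx \<alpha>)" "m < length (idx \<alpha>) \<Longrightarrow> vals \<alpha> ! m = \<alpha> (idx \<alpha> ! m)"
  by (simp_all add: vals_def)

lemma sum_vals: "\<alpha> \<in> exps \<Longrightarrow> sum_list (vals \<alpha>) = d"
proof -
  assume e: "\<alpha> \<in> exps"
  then obtain n where n: "\<alpha> \<in> hexpos n d" by (auto simp: exps_def)
  have "sum_list (vals \<alpha>) = sum \<alpha> (set (idx \<alpha>))"
    unfolding vals_def using idx(2)[OF e] by (rule sum_list_distinct_conv_sum_set)
  also have "\<dots> = sum \<alpha> {..<n}"
    using idx_bound[OF n] idx(1)[OF e] by (intro sum.mono_neutral_left) auto
  finally show ?thesis using n by (simp add: hexpos_def)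
qed

lemma vals_pos: "\<alpha> \<in> exps \<Longrightarrow> m < length (idx \<alpha>) \<Longrightarrow> 0 < vals \<alpha> ! m"
  using idx(1)[of \<alpha>] nth_mem[of m "idx \<alpha>"] by (auto simp: vals)

lemma idx_nonempty: "\<alpha> \<in> exps \<Longrightarrow> 0 < length (idx \<alpha>)"
  using sum_vals[of \<alpha>] d by (cases "idx \<alpha>") (auto simp: vals_def)

lemma expo_hexpos: "sum_list \<beta> = d \<Longrightarrow> expo \<beta> \<in> hexpos (length \<beta>) d"
  by (auto simp: hexpos_def expo_def sum_list_sum_nth lessThan_atLeast0)

lemma exps_eqI:
  assumes "\<alpha> \<in> exps" "\<alpha>' \<in> exps" "idx \<alpha> = idx \<alpha>'" "vals \<alpha> = vals \<alpha>'"
  shows "\<alpha> = \<alpha>'"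
proof
  fix i
  show "\<alpha> i = \<alpha>' i"
  proof (cases "i \<in> set (idx \<alpha>)")
    case True
    then show ?thesis using assms(3,4) by (simp add: vals_def)
  next
    case False
    then show ?thesis using idx(1)[OF assms(1)] idx(1)[OF assms(2)] assms(3) by (metis (mono_tags) mem_Collect_eq)
  qed
qed

lemma wvec_V: "sum_list \<beta> = d \<Longrightarrow> k < D (length \<beta>) \<Longrightarrow> wvec \<beta> k \<in> V (length \<beta>)"
  unfolding wvec_def by (intro wt_V unit_coords expo_hexpos)

lemma wvec_weight:
  "sum_list \<beta> = d \<Longrightarrow> k < D (length \<beta>) \<Longrightarrow>
    T (length \<beta>) (length \<beta>) (dg s) (wvec \<beta> k) = (\<lambda>b. mon (length \<beta>) (expo \<beta>) s * wvec \<beta> k b)"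
  unfolding wvec_def by (intro wt_weight unit_coords expo_hexpos)

text \<open>A zero column is unchanged when its variable is first set to 0, and this kills a vector
  whose weight has a positive exponent there.\<close>

lemma T_wvec_zero_column:
  assumes \<beta>: "sum_list \<beta> = d" "k < D (length \<beta>)" and m: "m < length \<beta>" "0 < \<beta> ! m"
    and zero: "\<And>i. i < N \<Longrightarrow> A i m = 0"
  shows "T N (length \<beta>) A (wvec \<beta> k) = (\<lambda>_. 0)"
proof -
  define s where "s = (\<lambda>i. if i = m then 0 else 1 :: 'a)"
  have "T N (length \<beta>) A = T N (length \<beta>) (mmul (length \<beta>) A (dg s))"
    by (rule T_cong) (use zero in \<open>auto simp: mmul_dg s_def\<close>)
  then have "T N (length \<beta>) A (wvec \<beta> k) = T N (length \<beta>) (mmul (length \<beta>) A (dg s)) (wvec \<beta> k)"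
    by (rule fun_cong)
  also have "\<dots> = T N (length \<beta>) A (T (length \<beta>) (length \<beta>) (dg s) (wvec \<beta> k))"
    by (rule T_comp[OF wvec_V[OF \<beta>], symmetric])
  also have "mon (length \<beta>) (expo \<beta>) s = 0"
    unfolding mon_def using m by (intro prod_zero) (auto simp: s_def expo_def power_0_left)
  then have "T (length \<beta>) (length \<beta>) (dg s) (wvec \<beta> k) = (\<lambda>_. 0)" using wvec_weight[OF \<beta>] by simp
  finally show ?thesis by (simp add: T_zero_vec)
qed

text \<open>The component of weight \<alpha>, rewritten in the variables of its support alone. It
  does not depend on the level (\<open>coord_restrict\<close>), so it is an invariant of a point of
  the inverse limit.\<close>

definition coord :: "(nat \<Rightarrow> nat) \<Rightarrow> nat \<Rightarrow> (nat \<Rightarrow> 'a) \<Rightarrow> nat \<Rightarrow> 'a" where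
  "coord \<alpha> n x = T (length (idx \<alpha>)) n (\<lambda>m i. sel (idx \<alpha>) i m) (wt n x \<alpha>)"

lemma coord_V: "x \<in> V n \<Longrightarrow> \<alpha> \<in> hexpos n d \<Longrightarrow> coord \<alpha> n x \<in> V (length (idx \<alpha>))"
  unfolding coord_def by (intro T_in wt_V)

text \<open>The vector has pure weight \<open>expo (vals \<alpha>)\<close>, so it equals its own
  component of that weight. Expanding it in the basis and taking this component gives the formula,
  with its own coordinates as coefficients.\<close>

lemma coord_wvec:
  assumes x: "x \<in> V n" and \<alpha>: "\<alpha> \<in> hexpos n d"
  shows "coord \<alpha> n x = (\<lambda>b. \<Sum>k<D (length (idx \<alpha>)). coord \<alpha> n x k * wvec (vals \<alpha>) k b)"
proof -
  let ?h = "length (idx \<alpha>)" and ?X = "coord \<alpha> n x"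
  note e = hexpos_exps[OF \<alpha>]
  have bd: "idx \<alpha> ! m < n" if "m < ?h" for m using idx_bound[OF \<alpha>] nth_mem[OF that] by auto
  have \<beta>: "expo (vals \<alpha>) \<in> hexpos ?h d" using expo_hexpos[OF sum_vals[OF e]] by (simp add: vals)
  have "T ?h ?h (dg s) ?X b = mon ?h (expo (vals \<alpha>)) s * ?X b" for s b
  proof -
    \<comment> \<open>The scalars \<open>s\<close> are carried from positions in the support to the
      variables themselves, and extended by zero.\<close>
    define s' where "s' = (\<lambda>i. \<Sum>m<?h. if i = idx \<alpha> ! m then s m else 0)"
    have s': "s' (idx \<alpha> ! m) = s m" if "m < ?h" for m
    proof -
      have "s' (idx \<alpha> ! m) = (\<Sum>m'<?h. if m' = m then s m else 0)"
        unfolding s'_def using that by (intro sum.cong) (auto simp: nth_eq_iff_index_eq[OF idx(2)[OF e]])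
      then show ?thesis using that by simp
    qed
    have "T ?h n (mmul ?h (dg s) (\<lambda>m i. sel (idx \<alpha>) i m)) = T ?h n (mmul n (\<lambda>m i. sel (idx \<alpha>) i m) (dg s'))"
    proof (rule T_cong)
      fix m i assume "m < ?h" "i < n"
      then show "mmul ?h (dg s) (\<lambda>m i. sel (idx \<alpha>) i m) m i = mmul n (\<lambda>m i. sel (idx \<alpha>) i m) (dg s') m i"
        using s' by (simp add: dg_mmul mmul_dg) (simp add: sel_def)
    qed
    then have "T ?h ?h (dg s) ?X = T ?h n (\<lambda>m i. sel (idx \<alpha>) i m) (T n n (dg s') (wt n x \<alpha>))"
      unfolding coord_def using wt_V[OF x \<alpha>] by (simp add: T_comp)
    also have "\<dots> = (\<lambda>b. mon n \<alpha> s' * ?X b)"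
      unfolding wt_weight[OF x \<alpha>] coord_def by (rule T_scale[OF wt_V[OF x \<alpha>]])
    also have "mon n \<alpha> s' = mon ?h (expo (vals \<alpha>)) s"
    proof -
      have bij: "bij_betw (\<lambda>m. idx \<alpha> ! m) {..<?h} (set (idx \<alpha>))"
        by (rule bij_betw_nth[OF idx(2)[OF e]]) auto
      have "mon n \<alpha> s' = (\<Prod>i\<in>set (idx \<alpha>). s' i ^ \<alpha> i)"
        unfolding mon_def using idx_bound[OF \<alpha>] idx(1)[OF e] by (intro prod.mono_neutral_right) auto
      also have "\<dots> = (\<Prod>m<?h. s' (idx \<alpha> ! m) ^ \<alpha> (idx \<alpha> ! m))"
        by (rule prod.reindex_bij_betw[OF bij, symmetric])
      also have "\<dots> = mon ?h (expo (vals \<alpha>)) s"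
        unfolding mon_def by (intro prod.cong) (simp_all add: s' expo_def vals)
      finally show ?thesis .
    qed
    finally show ?thesis by simp
  qed
  then have "wt ?h ?X (expo (vals \<alpha>)) = ?X"
    using coord_V[OF x \<alpha>] \<beta> by (intro wt_of_weight_vector)
  then show ?thesis using wt_units[OF coord_V[OF x \<alpha>] \<beta>] by (simp add: wvec_def vals)
qed

text \<open>Projecting to the support and including back is a diagonal matrix with entries 1 on the
  support, which acts trivially on weight \<alpha>.\<close>

lemma wt_coord:
  assumes x: "x \<in> V n" and \<alpha>: "\<alpha> \<in> hexpos n d"
  shows "wt n x \<alpha> = T n (length (idx \<alpha>)) (sel (idx \<alpha>)) (coord \<alpha> n x)"
proof -
  let ?h = "length (idx \<alpha>)"
  note e = hexpos_exps[OF \<alpha>]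
  define s where "s = (\<lambda>i. if i \<in> set (idx \<alpha>) then 1 else 0 :: 'a)"
  have "T n n (mmul ?h (sel (idx \<alpha>)) (\<lambda>m i. sel (idx \<alpha>) i m)) = T n n (dg s)"
  proof (rule T_cong)
    fix i j assume "i < n"
    show "mmul ?h (sel (idx \<alpha>)) (\<lambda>m i. sel (idx \<alpha>) i m) i j = dg s i j"
    proof (cases "i \<in> set (idx \<alpha>)")
      case True
      then obtain m where m: "m < ?h" "i = idx \<alpha> ! m" by (auto simp: in_set_conv_nth)
      have "mmul ?h (sel (idx \<alpha>)) (\<lambda>m i. sel (idx \<alpha>) i m) i j = (\<Sum>m'<?h. if m' = m then dg s i j else 0)"
        unfolding mmul_def using m True
        by (intro sum.cong) (auto simp: sel_def dg_def s_def nth_eq_iff_index_eq[OF idx(2)[OF e]])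
      then show ?thesis using m by simp
    next
      case False
      then have "mmul ?h (sel (idx \<alpha>)) (\<lambda>m i. sel (idx \<alpha>) i m) i j = 0"
        unfolding mmul_def by (intro sum.neutral) (auto simp: sel_def)
      moreover have "dg s i j = 0" using False by (auto simp: dg_def s_def)
      ultimately show ?thesis by simp
    qed
  qed
  then have "T n ?h (sel (idx \<alpha>)) (coord \<alpha> n x) = T n n (dg s) (wt n x \<alpha>)"
    unfolding coord_def using wt_V[OF x \<alpha>] by (simp add: T_comp)
  also have "mon n \<alpha> s = 1"
    unfolding mon_def using idx(1)[OF e] by (intro prod.neutral) (auto simp: s_def)
  then have "T n n (dg s) (wt n x \<alpha>) = wt n x \<alpha>" using wt_weight[OF x \<alpha>] by simp
  finally show ?thesis by simp
qed

lemma coord_restrict: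
  assumes nm: "n \<le> m" and x: "x \<in> V m" and \<alpha>: "\<alpha> \<in> hexpos n d"
  shows "coord \<alpha> n (T n m idm x) = coord \<alpha> m x"
proof -
  let ?h = "length (idx \<alpha>)"
  have "T ?h m (mmul n (\<lambda>m i. sel (idx \<alpha>) i m) idm) = T ?h m (\<lambda>m i. sel (idx \<alpha>) i m)"
  proof (rule T_cong)
    fix l i assume l: "l < ?h"
    then have "idx \<alpha> ! l < n" using idx_bound[OF \<alpha>] nth_mem by blast
    then show "mmul n (\<lambda>m i. sel (idx \<alpha>) i m) idm l i = (sel (idx \<alpha>) i l :: 'a)"
      using l by (simp add: sel_mmul) (auto simp: idm_def sel_def)
  qed
  then show ?thesis
    unfolding coord_def wt_restrict[OF assms] using wt_V[OF x] hexpos_mono[OF nm] \<alpha>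
    by (subst T_comp) auto
qed

lemma expand_wvecs:
  assumes x: "x \<in> V n"
  shows "x b = (\<Sum>\<alpha>\<in>hexpos n d. \<Sum>k<D (length (idx \<alpha>)).
    coord \<alpha> n x k * T n (length (idx \<alpha>)) (sel (idx \<alpha>)) (wvec (vals \<alpha>) k) b)"
proof -
  have "x b = (\<Sum>\<alpha>\<in>hexpos n d. wt n x \<alpha> b)" using wt_sum[OF x] by (rule fun_cong)
  also have "\<dots> = (\<Sum>\<alpha>\<in>hexpos n d. \<Sum>k<D (length (idx \<alpha>)).
    coord \<alpha> n x k * T n (length (idx \<alpha>)) (sel (idx \<alpha>)) (wvec (vals \<alpha>) k) b)"
  proof (intro sum.cong refl)
    fix \<alpha> assume \<alpha>: "\<alpha> \<in> hexpos n d"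
    have "wt n x \<alpha> = T n (length (idx \<alpha>)) (sel (idx \<alpha>))
        (\<lambda>b. \<Sum>k<D (length (idx \<alpha>)). coord \<alpha> n x k * wvec (vals \<alpha>) k b)"
      using wt_coord[OF x \<alpha>] coord_wvec[OF x \<alpha>] by simp
    also have "\<dots> = (\<lambda>b. \<Sum>k<D (length (idx \<alpha>)).
        coord \<alpha> n x k * T n (length (idx \<alpha>)) (sel (idx \<alpha>)) (wvec (vals \<alpha>) k) b)"
      using wvec_V[OF sum_vals[OF hexpos_exps[OF \<alpha>]]] by (intro T_sum) (simp add: vals)
    finally show "wt n x \<alpha> b = (\<Sum>k<D (length (idx \<alpha>)).
        coord \<alpha> n x k * T n (length (idx \<alpha>)) (sel (idx \<alpha>)) (wvec (vals \<alpha>) k) b)" by (rule fun_cong)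
  qed
  finally show ?thesis .
qed

lemma coord_Q:
  assumes q: "q \<in> Q" and "\<alpha> \<in> hexpos n d" "\<alpha> \<in> hexpos m d"
  shows "coord \<alpha> n (q n) = coord \<alpha> m (q m)"
proof -
  have "coord \<alpha> n (q n) = coord \<alpha> m (q m)" if "n \<le> m" "\<alpha> \<in> hexpos n d" for n m
    using coord_restrict[OF that(1) Q_V[OF q] that(2)] Q_restrict[OF q that(1)] by simp
  then show ?thesis using assms(2,3) nat_le_linear[of n m] by metis
qed

text \<open>A vertex records the type \<open>vals \<alpha>\<close>, the index \<open>k\<close> and a
  prefix of the support. Two paths of the same type and \<open>k\<close> share vertices as long as
  their supports agree; only the last vertex of a path sees the whole support.\<close>

definition node :: "(nat \<Rightarrow> nat) \<Rightarrow> nat \<Rightarrow> nat \<Rightarrow> nat" where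
  "node \<alpha> k m = to_nat (vals \<alpha>, k, take (Suc m) (idx \<alpha>))"

definition nodes :: "(nat \<Rightarrow> nat) \<Rightarrow> nat \<Rightarrow> nat list" where
  "nodes \<alpha> k = map (node \<alpha> k) [0..<length (idx \<alpha>)]"

definition paths :: "nat \<Rightarrow> ((nat \<Rightarrow> nat) \<times> nat) set" where
  "paths N = {(\<alpha>, k). \<alpha> \<in> exps \<and> k < D (length (idx \<alpha>)) \<and> (\<forall>m<length (idx \<alpha>). node \<alpha> k m < N)}"

lemma node_eq:
  assumes "\<alpha> \<in> exps" "\<alpha>' \<in> exps" "m < length (idx \<alpha>)" "m' < length (idx \<alpha>')"
    and "node \<alpha> k m = node \<alpha>' k' m'"
  shows "k = k'" "m = m'" "idx \<alpha> ! m = idx \<alpha>' ! m'" "length (idx \<alpha>) = length (idx \<alpha>')"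
    "Suc m = length (idx \<alpha>) \<Longrightarrow> \<alpha> = \<alpha>'"
proof -
  have eq: "vals \<alpha> = vals \<alpha>'" "k = k'" "take (Suc m) (idx \<alpha>) = take (Suc m') (idx \<alpha>')"
    using assms(5) by (simp_all add: node_def)
  show "k = k'" by (rule eq(2))
  show len: "length (idx \<alpha>) = length (idx \<alpha>')" using arg_cong[OF eq(1), of length] by (simp add: vals)
  show m: "m = m'" using arg_cong[OF eq(3), of length] assms(3,4) by simp
  show "idx \<alpha> ! m = idx \<alpha>' ! m'"
    using arg_cong[OF eq(3), of "\<lambda>xs. xs ! m"] m by simp
  show "\<alpha> = \<alpha>'" if "Suc m = length (idx \<alpha>)"
    using exps_eqI[OF assms(1,2) _ eq(1)] eq(3) that len m by simp
qed

text \<open>A path is determined by its last vertex, which is one of the finitely many numbers below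
  \<open>N\<close>.\<close>

lemma finite_paths: "finite (paths N)"
proof (rule finite_imageD)
  let ?f = "\<lambda>(\<alpha>, k). node \<alpha> k (length (idx \<alpha>) - 1)"
  show "finite (?f ` paths N)"
  proof (rule finite_subset)
    show "?f ` paths N \<subseteq> {..<N}" using idx_nonempty by (auto simp: paths_def)
  qed simp
  show "inj_on ?f (paths N)"
  proof (rule inj_onI, clarify)
    fix \<alpha> k \<alpha>' k'
    assume a: "(\<alpha>, k) \<in> paths N" "(\<alpha>', k') \<in> paths N"
      and e: "node \<alpha> k (length (idx \<alpha>) - 1) = node \<alpha>' k' (length (idx \<alpha>') - 1)"
    then have ex: "\<alpha> \<in> exps" "\<alpha>' \<in> exps" by (auto simp: paths_def)
    have h: "0 < length (idx \<alpha>)" "0 < length (idx \<alpha>')" by (rule idx_nonempty[OF ex(1)], rule idx_nonempty[OF ex(2)])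
    then have "length (idx \<alpha>) - 1 < length (idx \<alpha>)" "length (idx \<alpha>') - 1 < length (idx \<alpha>')" by auto
    note eq = node_eq[OF ex this e]
    have "Suc (length (idx \<alpha>) - 1) = length (idx \<alpha>)" using h(1) by simp
    from eq(5)[OF this] eq(1) show "\<alpha> = \<alpha>' \<and> k = k'" by (rule conjI)
  qed
qed

text \<open>
  The variables are the vertices of a forest: a path from a root has its variables indexed by the
  prefixes of a strictly increasing list. A monomial with support \<open>i\<^sub>1 < \<dots> < i\<^sub>h\<close> is
  obtained by sending the prefix ending in \<open>i\<^sub>l\<close> to the \<open>i\<^sub>l\<close>-th variable, so
  each variable is hit only finitely often; coefficients are adjusted at the leaves.
\<close>

definition max_elt :: "nat \<Rightarrow> nat \<Rightarrow> 'a" where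
  "max_elt N = (\<lambda>b. \<Sum>(\<alpha>, k)\<in>paths N. T N (length (idx \<alpha>)) (sel (nodes \<alpha> k)) (wvec (vals \<alpha>) k) b)"

lemma path_wvec_V: "(\<alpha>, k) \<in> paths N \<Longrightarrow> wvec (vals \<alpha>) k \<in> V (length (idx \<alpha>))"
  using wvec_V[OF sum_vals, of \<alpha> k] by (auto simp: paths_def vals)

lemma T_max_elt:
  "T n N A (max_elt N) = (\<lambda>b. \<Sum>(\<alpha>, k)\<in>paths N.
    T n (length (idx \<alpha>)) (mmul N A (sel (nodes \<alpha> k))) (wvec (vals \<alpha>) k) b)"
proof -
  let ?y = "\<lambda>x. T N (length (idx (fst x))) (sel (nodes (fst x) (snd x))) (wvec (vals (fst x)) (snd x))"
  have V: "wvec (vals (fst x)) (snd x) \<in> V (length (idx (fst x)))" if "x \<in> paths N" for x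
    using path_wvec_V[of "fst x" "snd x" N] that by simp
  have "T n N A (\<lambda>b. \<Sum>x\<in>paths N. 1 * ?y x b) = (\<lambda>b. \<Sum>x\<in>paths N. 1 * T n N A (?y x) b)"
    by (rule T_sum) (rule T_in[OF V])
  then show ?thesis
    by (simp add: max_elt_def case_prod_beta T_comp[OF V] cong: sum.cong)
qed

lemma nodes_nth: "m < length (idx \<alpha>) \<Longrightarrow> nodes \<alpha> k ! m = node \<alpha> k m" "length (nodes \<alpha> k) = length (idx \<alpha>)"
  by (simp_all add: nodes_def)

lemma path_zero_column:
  assumes "\<alpha> \<in> exps" "k < D (length (idx \<alpha>))" "m < length (idx \<alpha>)" "\<And>i. i < n \<Longrightarrow> A i m = 0"
  shows "T n (length (idx \<alpha>)) A (wvec (vals \<alpha>) k) = (\<lambda>_. 0)"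
  using T_wvec_zero_column[OF sum_vals[OF assms(1)], of k m n A] vals_pos[OF assms(1,3)] assms
  by (simp add: vals)

text \<open>Forgetting variable \<open>N\<close> kills the summands whose path passes through it,
  since their matrices acquire a zero column.\<close>

lemma max_elt_Q: "max_elt \<in> Q"
  unfolding Q_def
proof (intro CollectI allI conjI)
  fix N
  have "T N (length (idx \<alpha>)) (sel (nodes \<alpha> k)) (wvec (vals \<alpha>) k) b = 0"
    if "(\<alpha>, k) \<in> paths N" "D N \<le> b" for \<alpha> k b
    using coordsD[OF T_in[OF path_wvec_V[OF that(1)]] that(2)] .
  then show "max_elt N \<in> V N"
    unfolding max_elt_def coords_def by (auto intro!: sum.neutral)
  have sub: "paths N \<subseteq> paths (Suc N)" by (auto simp: paths_def less_SucI)
  show "T N (Suc N) idm (max_elt (Suc N)) = max_elt N"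
  proof
    fix b
    let ?t = "\<lambda>(\<alpha>, k). T N (length (idx \<alpha>)) (sel (nodes \<alpha> k)) (wvec (vals \<alpha>) k) b"
    have "T N (length (idx \<alpha>)) (mmul (Suc N) idm (sel ns)) = T N (length (idx \<alpha>)) (sel ns)" for ns \<alpha>
      by (rule T_cong) (simp add: idm_mmul)
    then have "T N (Suc N) idm (max_elt (Suc N)) b = (\<Sum>x\<in>paths (Suc N). ?t x)"
      by (simp add: T_max_elt)
    also have "\<dots> = (\<Sum>x\<in>paths N. ?t x)"
    proof (rule sum.mono_neutral_right[OF finite_paths sub], clarify)
      fix \<alpha> k assume "(\<alpha>, k) \<in> paths (Suc N)" and n: "(\<alpha>, k) \<notin> paths N"
      then have e: "\<alpha> \<in> exps" "k < D (length (idx \<alpha>))" by (auto simp: paths_def)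
      obtain m where m: "m < length (idx \<alpha>)" "\<not> node \<alpha> k m < N" using n e by (auto simp: paths_def)
      have "T N (length (idx \<alpha>)) (sel (nodes \<alpha> k)) (wvec (vals \<alpha>) k) = (\<lambda>_. 0)"
        using e m by (intro path_zero_column[of \<alpha> k m]) (auto simp: sel_def nodes_nth)
      then show "T N (length (idx \<alpha>)) (sel (nodes \<alpha> k)) (wvec (vals \<alpha>) k) b = 0" by simp
    qed
    finally show "T N (Suc N) idm (max_elt (Suc N)) b = max_elt N b" by (simp add: max_elt_def)
  qed
qed

text \<open>Counts the vertices whose prefix ends in \<open>i\<close>: the exponents are positive
  with sum \<open>d\<close>, which bounds the lengths and entries, and an increasing prefix has
  entries at most \<open>i\<close>.\<close>

lemma finite_path_data: "finite {(\<beta>, k, pre). set \<beta> \<subseteq> {..d} \<and> length \<beta> \<le> d \<and> k < D (length \<beta>) \<and>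
    set pre \<subseteq> {..i} \<and> length pre \<le> d}" (is "finite ?S") for i :: nat
proof -
  have "?S \<subseteq> {\<beta>. set \<beta> \<subseteq> {..d} \<and> length \<beta> \<le> d} \<times> {..<Suc (\<Sum>h\<le>d. D h)} \<times> {pre. set pre \<subseteq> {..i} \<and> length pre \<le> d}"
  proof clarify
    fix \<beta> k pre assume a: "set \<beta> \<subseteq> {..d}" "length \<beta> \<le> d" "k < D (length \<beta>)" "set pre \<subseteq> {..i}" "length pre \<le> d"
    have "D (length \<beta>) \<le> (\<Sum>h\<le>d. D h)" using a(2) by (intro member_le_sum) auto
    then show "\<beta> \<in> {\<beta>. set \<beta> \<subseteq> {..d} \<and> length \<beta> \<le> d} \<and>
      (k, pre) \<in> {..<Suc (\<Sum>h\<le>d. D h)} \<times> {pre. set pre \<subseteq> {..i} \<and> length pre \<le> d}"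
      using a by simp
  qed
  then show ?thesis
    by (rule finite_subset) (intro finite_cartesian_product finite_lists_length_le finite_atMost finite_lessThan)
qed

lemma length_vals_le: "\<alpha> \<in> exps \<Longrightarrow> length (vals \<alpha>) \<le> d"
proof -
  assume e: "\<alpha> \<in> exps"
  have "length (vals \<alpha>) = (\<Sum>m<length (vals \<alpha>). 1)" by simp
  also have "\<dots> \<le> (\<Sum>m<length (vals \<alpha>). vals \<alpha> ! m)"
  proof (rule sum_mono)
    fix m assume "m \<in> {..<length (vals \<alpha>)}"
    then show "1 \<le> vals \<alpha> ! m" using vals_pos[OF e, of m] by (simp add: vals(1))
  qed
  also have "\<dots> = d" using sum_vals[OF e] by (simp add: sum_list_sum_nth lessThan_atLeast0)
  finally show ?thesis .
qed

theorem max_elt_maximal: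
  assumes q: "q \<in> Q"
  shows "\<exists>\<phi>\<in>row_finite_matrices. \<forall>n N. rows_within \<phi> n N \<longrightarrow> T n N \<phi> (max_elt N) = q n"
proof -
  \<comment> \<open>A level large enough to contain the support of \<alpha>.\<close>
  define bd where "bd = (\<lambda>\<alpha>. Suc (sum_list (idx \<alpha>)))"
  define c where "c = (\<lambda>\<alpha> k. coord \<alpha> (bd \<alpha>) (q (bd \<alpha>)) k)"
  have c: "c \<alpha> k = coord \<alpha> n (q n) k" if "\<alpha> \<in> hexpos n d" for \<alpha> n k
  proof -
    have "set (idx \<alpha>) \<subseteq> {..<bd \<alpha>}" by (auto simp: bd_def less_Suc_eq_le member_le_sum_list)
    then have "\<alpha> \<in> hexpos (bd \<alpha>) d" by (rule exps_hexpos[OF hexpos_exps[OF that]])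
    then show ?thesis unfolding c_def using coord_Q[OF q _ that] by simp
  qed
  \<comment> \<open>The last variable of the path enters the weight vector with exponent
    \<open>\<alpha> (last (idx \<alpha>))\<close>, so a root of that order produces the
    coefficient.\<close>
  define rt where "rt = (\<lambda>\<alpha> k. SOME g. g ^ \<alpha> (last (idx \<alpha>)) = c \<alpha> k)"
  have last: "0 < \<alpha> (last (idx \<alpha>))" if "\<alpha> \<in> exps" for \<alpha>
    using idx(1)[OF that] last_in_set[of "idx \<alpha>"] idx_nonempty[OF that] by auto
  have rt: "rt \<alpha> k ^ \<alpha> (last (idx \<alpha>)) = c \<alpha> k" if "\<alpha> \<in> exps" for \<alpha> k
    unfolding rt_def by (rule someI_ex[OF nth_root_exists[OF last[OF that]]])
  \<comment> \<open>Scaling is confined to the last vertex, the only one that is not shared with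
    other paths of the same type and index \<open>k\<close>.\<close>
  define w where "w = (\<lambda>\<alpha> k m. if Suc m = length (idx \<alpha>) then rt \<alpha> k else 1)"
  define edge where "edge = (\<lambda>i j \<alpha> k m. \<alpha> \<in> exps \<and> k < D (length (idx \<alpha>)) \<and> m < length (idx \<alpha>) \<and>
    j = node \<alpha> k m \<and> i = idx \<alpha> ! m)"
  \<comment> \<open>Several paths can use the same entry; by \<open>node_eq\<close> they all
    prescribe the same value, so the choice is immaterial.\<close>
  define \<phi> where "\<phi> = (\<lambda>i j. if \<exists>\<alpha> k m. edge i j \<alpha> k m then SOME x. \<exists>\<alpha> k m. edge i j \<alpha> k m \<and> x = w \<alpha> k m else 0)"
  have \<phi>_edge: "\<phi> i j = w \<alpha> k m" if e: "edge i j \<alpha> k m" for i j \<alpha> k m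
  proof -
    have "\<exists>x. \<exists>\<alpha> k m. edge i j \<alpha> k m \<and> x = w \<alpha> k m" using e by blast
    then have "\<exists>\<alpha> k m. edge i j \<alpha> k m \<and> (SOME x. \<exists>\<alpha> k m. edge i j \<alpha> k m \<and> x = w \<alpha> k m) = w \<alpha> k m"
      by (rule someI_ex)
    moreover have "\<phi> i j = (SOME x. \<exists>\<alpha> k m. edge i j \<alpha> k m \<and> x = w \<alpha> k m)"
      unfolding \<phi>_def using e by (intro if_P) blast
    ultimately obtain \<alpha>' k' m' where e': "edge i j \<alpha>' k' m'" "\<phi> i j = w \<alpha>' k' m'" by auto
    have "\<alpha> \<in> exps" "\<alpha>' \<in> exps" "m < length (idx \<alpha>)" "m' < length (idx \<alpha>')" "node \<alpha> k m = node \<alpha>' k' m'"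
      using e e'(1) by (auto simp: edge_def)
    note eq = node_eq[OF this]
    show ?thesis
    proof (cases "Suc m = length (idx \<alpha>)")
      case True
      then show ?thesis using eq(1,2,5) e'(2) by simp
    next
      case False
      then show ?thesis using eq(2,4) e'(2) by (simp add: w_def)
    qed
  qed
  have \<phi>_node: "\<phi> i (node \<alpha> k m) = (if i = idx \<alpha> ! m then w \<alpha> k m else 0)"
    if \<alpha>: "\<alpha> \<in> exps" "k < D (length (idx \<alpha>))" "m < length (idx \<alpha>)" for i \<alpha> k m
  proof (cases "i = idx \<alpha> ! m")
    case True
    then have "edge i (node \<alpha> k m) \<alpha> k m" using \<alpha> by (simp add: edge_def)
    then show ?thesis using \<phi>_edge True by simp
  next
    case False
    have "\<not> edge i (node \<alpha> k m) \<alpha>' k' m'" for \<alpha>' k' m'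
    proof
      assume e: "edge i (node \<alpha> k m) \<alpha>' k' m'"
      then have "\<alpha>' \<in> exps" "m' < length (idx \<alpha>')" "node \<alpha> k m = node \<alpha>' k' m'" "i = idx \<alpha>' ! m'"
        by (auto simp: edge_def)
      then show False using node_eq(3)[OF \<alpha>(1) _ \<alpha>(3), of \<alpha>' m' k k'] False by simp
    qed
    then have "\<not> (\<exists>\<alpha>' k' m'. edge i (node \<alpha> k m) \<alpha>' k' m')" by blast
    then show ?thesis unfolding \<phi>_def if_not_P[OF False] by (rule if_not_P)
  qed
  have "\<phi> \<in> row_finite_matrices"
    unfolding row_finite_matrices_def
  proof (intro CollectI allI)
    fix i :: nat
    let ?S = "{(\<beta>, k, pre). set \<beta> \<subseteq> {..d} \<and> length \<beta> \<le> d \<and> k < D (length \<beta>) \<and> set pre \<subseteq> {..i} \<and> length pre \<le> d}"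
    have "{j. \<phi> i j \<noteq> 0} \<subseteq> to_nat ` ?S"
    proof
      fix j assume "j \<in> {j. \<phi> i j \<noteq> 0}"
      then obtain \<alpha> k m where e: "\<alpha> \<in> exps" "k < D (length (idx \<alpha>))" "m < length (idx \<alpha>)"
        "j = node \<alpha> k m" "i = idx \<alpha> ! m"
        unfolding \<phi>_def edge_def by (auto split: if_splits)
      have "set (vals \<alpha>) \<subseteq> {..d}" using member_le_sum_list[of _ "vals \<alpha>"] sum_vals[OF e(1)] by auto
      moreover have "set (take (Suc m) (idx \<alpha>)) \<subseteq> {..i}"
      proof
        fix x assume "x \<in> set (take (Suc m) (idx \<alpha>))"
        then obtain l where l: "l < Suc m" "x = idx \<alpha> ! l" using e(3) by (auto simp: in_set_conv_nth)
        then show "x \<in> {..i}" using sorted_wrt_nth_less[OF idx(3)[OF e(1)], of l m] e(3,5)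
          by (cases "l = m") auto
      qed
      moreover have "length (take (Suc m) (idx \<alpha>)) \<le> d"
        using length_vals_le[OF e(1)] by (simp add: vals)
      ultimately have "(vals \<alpha>, k, take (Suc m) (idx \<alpha>)) \<in> ?S"
        using length_vals_le[OF e(1)] e(2) by (simp add: vals)
      then show "j \<in> to_nat ` ?S" unfolding e(4) node_def by (rule imageI)
    qed
    then show "finite {j. \<phi> i j \<noteq> 0}" by (rule finite_subset) (intro finite_imageI finite_path_data)
  qed
  moreover have "T n N \<phi> (max_elt N) = q n" if rows: "rows_within \<phi> n N" for n N
  proof
    fix b
    let ?t = "\<lambda>\<alpha> k. c \<alpha> k * T n (length (idx \<alpha>)) (sel (idx \<alpha>)) (wvec (vals \<alpha>) k) b"
    let ?I = "SIGMA \<alpha>:hexpos n d. {..<D (length (idx \<alpha>))}"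
    have path: "T n (length (idx \<alpha>)) (mmul N \<phi> (sel (nodes \<alpha> k))) (wvec (vals \<alpha>) k) b =
        (if \<alpha> \<in> hexpos n d then ?t \<alpha> k else 0)" if x: "(\<alpha>, k) \<in> paths N" for \<alpha> k
    proof -
      let ?h = "length (idx \<alpha>)"
      have e: "\<alpha> \<in> exps" "k < D ?h" and N: "\<And>m. m < ?h \<Longrightarrow> node \<alpha> k m < N" using x by (auto simp: paths_def)
      have A: "mmul N \<phi> (sel (nodes \<alpha> k)) i m = (if i = idx \<alpha> ! m then w \<alpha> k m else 0)" if "m < ?h" for i m
        using that N \<phi>_node[OF e that] by (simp add: mmul_sel nodes_nth)
      show ?thesis
      proof (cases "\<alpha> \<in> hexpos n d")
        case True
        have y: "wvec (vals \<alpha>) k \<in> V ?h" by (rule path_wvec_V[OF x])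
        have "T n ?h (mmul N \<phi> (sel (nodes \<alpha> k))) = T n ?h (mmul ?h (sel (idx \<alpha>)) (dg (w \<alpha> k)))"
        proof (rule T_cong)
          fix i m assume "m < ?h"
          then show "mmul N \<phi> (sel (nodes \<alpha> k)) i m = mmul ?h (sel (idx \<alpha>)) (dg (w \<alpha> k)) i m"
            by (simp add: A mmul_dg) (simp add: sel_def)
        qed
        then have "T n ?h (mmul N \<phi> (sel (nodes \<alpha> k))) (wvec (vals \<alpha>) k) =
            T n ?h (sel (idx \<alpha>)) (T ?h ?h (dg (w \<alpha> k)) (wvec (vals \<alpha>) k))"
          using T_comp[OF y] by simp
        also have "T ?h ?h (dg (w \<alpha> k)) (wvec (vals \<alpha>) k) = (\<lambda>b. mon ?h (expo (vals \<alpha>)) (w \<alpha> k) * wvec (vals \<alpha>) k b)"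
          using wvec_weight[OF sum_vals[OF e(1)], of k "w \<alpha> k"] e(2) by (simp add: vals)
        also have "T n ?h (sel (idx \<alpha>)) \<dots> = (\<lambda>b. mon ?h (expo (vals \<alpha>)) (w \<alpha> k) * T n ?h (sel (idx \<alpha>)) (wvec (vals \<alpha>) k) b)"
          by (rule T_scale[OF y])
        also have "mon ?h (expo (vals \<alpha>)) (w \<alpha> k) = c \<alpha> k"
        proof -
          have h: "0 < ?h" by (rule idx_nonempty[OF e(1)])
          have "mon ?h (expo (vals \<alpha>)) (w \<alpha> k) = (\<Prod>m<?h. if m = ?h - 1 then c \<alpha> k else 1)"
            unfolding mon_def
          proof (intro prod.cong refl)
            fix m assume m: "m \<in> {..<?h}"
            show "w \<alpha> k m ^ expo (vals \<alpha>) m = (if m = ?h - 1 then c \<alpha> k else 1)"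
            proof (cases "m = ?h - 1")
              case True
              then have "idx \<alpha> ! m = last (idx \<alpha>)" using h by (simp add: last_conv_nth)
              then show ?thesis using True h m rt[OF e(1), of k] by (simp add: w_def expo_def vals)
            next
              case False
              then have "Suc m \<noteq> ?h" by auto
              then show ?thesis using False by (simp add: w_def)
            qed
          qed
          then show ?thesis using h by simp
        qed
        finally show ?thesis using True by simp
      next
        case False
        \<comment> \<open>A path whose support leaves the first \<open>n\<close> variables has a
          vertex sent to a row beyond \<open>n\<close>; its column is zero in the block
          considered.\<close>
        have "\<exists>m<?h. \<not> idx \<alpha> ! m < n"
        proof (rule ccontr)
          assume "\<not> ?thesis"
          then have "set (idx \<alpha>) \<subseteq> {..<n}" by (auto simp: in_set_conv_nth)
          then show False using exps_hexpos[OF e(1)] False by blast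
        qed
        then obtain m where "m < ?h" "\<not> idx \<alpha> ! m < n" by blast
        then have "T n ?h (mmul N \<phi> (sel (nodes \<alpha> k))) (wvec (vals \<alpha>) k) = (\<lambda>_. 0)"
          using e A by (intro path_zero_column[of \<alpha> k m]) auto
        then show ?thesis using False by simp
      qed
    qed
    \<comment> \<open>The bound on the columns may cut off a path. Then the entry at a vertex beyond
      \<open>N\<close> is zero, which can happen only at the last vertex and only if the coefficient
      \<open>c \<alpha> k\<close> is zero.\<close>
    have zero: "?t \<alpha> k = 0" if "(\<alpha>, k) \<in> ?I - paths N" for \<alpha> k
    proof -
      have \<alpha>: "\<alpha> \<in> hexpos n d" "k < D (length (idx \<alpha>))" "(\<alpha>, k) \<notin> paths N" using that by auto
      note e = hexpos_exps[OF \<alpha>(1)]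
      obtain m where m: "m < length (idx \<alpha>)" "\<not> node \<alpha> k m < N" using \<alpha> e by (auto simp: paths_def)
      have "idx \<alpha> ! m < n" using idx_bound[OF \<alpha>(1)] nth_mem[OF m(1)] by auto
      then have "\<phi> (idx \<alpha> ! m) (node \<alpha> k m) = 0" using rows m(2) unfolding rows_within_def by blast
      then have "w \<alpha> k m = 0" using \<phi>_node[OF e \<alpha>(2) m(1)] by simp
      then have "rt \<alpha> k = 0" by (simp add: w_def split: if_splits)
      then have "c \<alpha> k = 0" using rt[OF e, of k] last[OF e] by (simp add: power_0_left)
      then show ?thesis by simp
    qed
    have finI: "finite ?I" by (intro finite_SigmaI finite_hexpos finite_lessThan)
    have "T n N \<phi> (max_elt N) b = (\<Sum>(\<alpha>, k)\<in>paths N. if \<alpha> \<in> hexpos n d then ?t \<alpha> k else 0)"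
      unfolding T_max_elt by (intro sum.cong refl) (auto simp: path)
    also have "\<dots> = (\<Sum>(\<alpha>, k)\<in>paths N \<inter> ?I. ?t \<alpha> k)"
      by (rule sum.mono_neutral_cong_right[OF finite_paths]) (auto simp: paths_def split: if_splits)
    also have "\<dots> = (\<Sum>(\<alpha>, k)\<in>?I. ?t \<alpha> k)"
    proof (rule sum.mono_neutral_left[OF finI], blast, intro ballI)
      fix x assume x: "x \<in> ?I - paths N \<inter> ?I"
      obtain \<alpha> k where "x = (\<alpha>, k)" by fastforce
      then show "(case x of (\<alpha>, k) \<Rightarrow> ?t \<alpha> k) = 0" using zero[of \<alpha> k] x by auto
    qed
    also have "\<dots> = (\<Sum>\<alpha>\<in>hexpos n d. \<Sum>k<D (length (idx \<alpha>)). ?t \<alpha> k)"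
      by (rule sum.Sigma[symmetric]) (auto simp: finite_hexpos)
    also have "\<dots> = (\<Sum>\<alpha>\<in>hexpos n d. \<Sum>k<D (length (idx \<alpha>)).
        coord \<alpha> n (q n) k * T n (length (idx \<alpha>)) (sel (idx \<alpha>)) (wvec (vals \<alpha>) k) b)"
      by (intro sum.cong refl) (simp only: c)
    also have "\<dots> = q n b" by (rule expand_wvecs[OF Q_V[OF q], symmetric])
    finally show "T n N \<phi> (max_elt N) b = q n b" .
  qed
  ultimately show ?thesis by blast
qed

end

section \<open>Coordinates on finite-dimensional spaces\<close>

definition coordinates :: "('a::field, 'v) module \<Rightarrow> nat \<Rightarrow> ('v \<Rightarrow> nat \<Rightarrow> 'a) \<Rightarrow> bool" where
  "coordinates V L \<phi> \<longleftrightarrow> bij_betw \<phi> (carrier V) (coords L) \<and>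
    (\<forall>u\<in>carrier V. \<forall>v\<in>carrier V. \<phi> (u \<oplus>\<^bsub>V\<^esub> v) = (\<lambda>i. \<phi> u i + \<phi> v i)) \<and>
    (\<forall>c. \<forall>v\<in>carrier V. \<phi> (c \<odot>\<^bsub>V\<^esub> v) = (\<lambda>i. c * \<phi> v i))"

lemma fd_space_closed:
  assumes "fd_space V"
  shows "u \<in> carrier V \<Longrightarrow> v \<in> carrier V \<Longrightarrow> u \<oplus>\<^bsub>V\<^esub> v \<in> carrier V"
    and "v \<in> carrier V \<Longrightarrow> c \<odot>\<^bsub>V\<^esub> v \<in> carrier V"
    and "v \<in> carrier V \<Longrightarrow> 1 \<odot>\<^bsub>V\<^esub> v = v"
    and "\<zero>\<^bsub>V\<^esub> \<in> carrier V"
proof -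
  interpret vectorspace class_ring V using assms by (simp add: fd_space_def)
  show "u \<in> carrier V \<Longrightarrow> v \<in> carrier V \<Longrightarrow> u \<oplus>\<^bsub>V\<^esub> v \<in> carrier V" by simp
  show "v \<in> carrier V \<Longrightarrow> c \<odot>\<^bsub>V\<^esub> v \<in> carrier V" by (rule smult_closed) (simp add: class_ring_simps)
  show "v \<in> carrier V \<Longrightarrow> 1 \<odot>\<^bsub>V\<^esub> v = v" using smult_one[of v] by (simp add: class_ring_simps)
  show "\<zero>\<^bsub>V\<^esub> \<in> carrier V" by simp
qed

lemma coordinates_exist:
  fixes V :: "('a::field, 'v) module"
  assumes V: "fd_space V"
  shows "\<exists>L \<phi>. coordinates V L \<phi>"
proof -
  interpret vectorspace class_ring V using V by (simp add: fd_space_def)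
  have cr: "carrier (class_ring :: 'a ring) = UNIV" by (simp add: class_ring_simps)
  obtain B where B: "finite B" "basis B" using finite_basis_exists V by (auto simp: fd_space_def)
  have BV: "B \<subseteq> carrier V" using B(2) by (simp add: basis_def)
  define L where "L = card B"
  obtain g where g: "bij_betw g B {..<L}"
    using ex_bij_betw_finite_nat[OF B(1)] unfolding L_def lessThan_atLeast0 by blast
  define \<Psi> where "\<Psi> = (\<lambda>x::nat \<Rightarrow> 'a. lincomb (\<lambda>b. x (g b)) B)"
  have \<Psi>_in: "\<Psi> x \<in> carrier V" for x
    unfolding \<Psi>_def by (rule lincomb_closed[OF BV]) (simp add: cr)
  have \<Psi>_add: "\<Psi> (\<lambda>i. x i + y i) = \<Psi> x \<oplus>\<^bsub>V\<^esub> \<Psi> y" for x y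
    unfolding \<Psi>_def using lincomb_sum[OF B(1) BV, of "\<lambda>b. x (g b)" "\<lambda>b. y (g b)"] by (simp add: class_ring_simps)
  have \<Psi>_scale: "\<Psi> (\<lambda>i. c * x i) = c \<odot>\<^bsub>V\<^esub> \<Psi> x" for c x
    unfolding \<Psi>_def using lincomb_smult[OF BV, of "\<lambda>b. x (g b)" c] by (simp add: class_ring_simps)
  have uniq: "\<exists>!a. a \<in> B \<rightarrow>\<^sub>E UNIV \<and> lincomb a B = v" if "v \<in> carrier V" for v
    using basis_criterion[OF B(1) BV] B(2) that by (simp add: cr)
  have restr: "lincomb a B = lincomb (restrict a B) B" for a
    by (rule lincomb_cong[OF refl BV]) (auto simp: cr)
  have bij: "bij_betw \<Psi> (coords L) (carrier V)"
    unfolding bij_betw_def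
  proof
    show "inj_on \<Psi> (coords L)"
    proof (rule inj_onI)
      fix x y assume x: "x \<in> coords L" and y: "y \<in> coords L" and e: "\<Psi> x = \<Psi> y"
      have "restrict (\<lambda>b. x (g b)) B = restrict (\<lambda>b. y (g b)) B"
        using uniq[OF \<Psi>_in[of x]] e restr unfolding \<Psi>_def by (metis restrict_PiE_iff UNIV_I)
      then have xy: "x (g b) = y (g b)" if "b \<in> B" for b using that by (metis restrict_apply')
      show "x = y"
      proof
        fix i show "x i = y i"
        proof (cases "i < L")
          case True
          then obtain b where "b \<in> B" "i = g b" using g unfolding bij_betw_def by blast
          then show ?thesis using xy by simp
        next
          case False
          then show ?thesis using x y by (simp add: coords_def)
        qed
      qed
    qed
    show "\<Psi> ` coords L = carrier V"
    proof
      show "\<Psi> ` coords L \<subseteq> carrier V" using \<Psi>_in by blast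
      show "carrier V \<subseteq> \<Psi> ` coords L"
      proof
        fix v assume "v \<in> carrier V"
        then obtain a where a: "lincomb a B = v" using uniq by blast
        define x where "x = (\<lambda>i. if i < L then a (inv_into B g i) else 0)"
        have "x (g b) = a b" if "b \<in> B" for b
          using that g by (auto simp: x_def bij_betw_def)
        then have "\<Psi> x = lincomb a B"
          unfolding \<Psi>_def by (intro lincomb_cong[OF refl BV]) (auto simp: cr)
        moreover have "x \<in> coords L" by (simp add: x_def coords_def)
        ultimately show "v \<in> \<Psi> ` coords L" using a by (intro image_eqI[of _ _ x]) simp_all
      qed
    qed
  qed
  define \<phi> where "\<phi> = inv_into (coords L) \<Psi>"
  have \<phi>\<Psi>: "\<phi> (\<Psi> x) = x" if "x \<in> coords L" for x
    unfolding \<phi>_def using bij that by (simp add: bij_betw_def)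
  have \<Psi>\<phi>: "\<Psi> (\<phi> v) = v" "\<phi> v \<in> coords L" if "v \<in> carrier V" for v
    unfolding \<phi>_def using bij that by (auto simp: bij_betw_def f_inv_into_f inv_into_into)
  have "coordinates V L \<phi>"
    unfolding coordinates_def
  proof (intro conjI ballI allI)
    show "bij_betw \<phi> (carrier V) (coords L)" unfolding \<phi>_def by (rule bij_betw_inv_into[OF bij])
    fix u v assume u: "u \<in> carrier V" and v: "v \<in> carrier V"
    have "u \<oplus>\<^bsub>V\<^esub> v = \<Psi> (\<lambda>i. \<phi> u i + \<phi> v i)" by (simp add: \<Psi>_add \<Psi>\<phi> u v)
    then show "\<phi> (u \<oplus>\<^bsub>V\<^esub> v) = (\<lambda>i. \<phi> u i + \<phi> v i)"
      using \<phi>\<Psi>[of "\<lambda>i. \<phi> u i + \<phi> v i"] \<Psi>\<phi>(2)[OF u] \<Psi>\<phi>(2)[OF v] by (simp add: coords_def)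
  next
    fix c v assume v: "v \<in> carrier V"
    have "c \<odot>\<^bsub>V\<^esub> v = \<Psi> (\<lambda>i. c * \<phi> v i)" by (simp add: \<Psi>_scale \<Psi>\<phi> v)
    then show "\<phi> (c \<odot>\<^bsub>V\<^esub> v) = (\<lambda>i. c * \<phi> v i)"
      using \<phi>\<Psi>[of "\<lambda>i. c * \<phi> v i"] \<Psi>\<phi>(2)[OF v] by (simp add: coords_def)
  qed
  then show ?thesis by blast
qed

lemma Hom_iff:
  "f \<in> Hom V W \<longleftrightarrow> f \<in> carrier V \<rightarrow> carrier W \<and> f \<in> extensional (carrier V) \<and>
    (\<forall>u\<in>carrier V. \<forall>v\<in>carrier V. f (u \<oplus>\<^bsub>V\<^esub> v) = f u \<oplus>\<^bsub>W\<^esub> f v) \<and>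
    (\<forall>c. \<forall>v\<in>carrier V. f (c \<odot>\<^bsub>V\<^esub> v) = c \<odot>\<^bsub>W\<^esub> f v)"
  by (auto simp: Hom_def LinearCombinations.module_hom_def class_ring_simps)

lemma functional_iff:
  "l \<in> LinearCombinations.module_hom class_ring V scalar_space \<longleftrightarrow>
    (\<forall>u\<in>carrier V. \<forall>v\<in>carrier V. l (u \<oplus>\<^bsub>V\<^esub> v) = l u + l v) \<and>
    (\<forall>c. \<forall>v\<in>carrier V. l (c \<odot>\<^bsub>V\<^esub> v) = c * l v)"
  by (auto simp: LinearCombinations.module_hom_def class_ring_simps scalar_space_def)

section \<open>Polynomial functions, forms and their restriction to curves\<close>

lemma polys_sum_of_forms:
  assumes "f \<in> polys k"
  shows "\<exists>E G. (\<forall>e. form k e (G e)) \<and> (\<forall>e\<ge>E. G e = (\<lambda>_. 0)) \<and> (\<forall>s. f s = (\<Sum>e<E. G e s))"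
  using assms unfolding polys_def
proof (induction rule: fun_vs.span_induct_alt)
  case base
  show ?case by (intro exI[of _ 0] exI[of _ "\<lambda>_ _. 0"]) (auto intro: form_zero)
next
  case (step c x y)
  then obtain E G where G: "\<And>e. form k e (G e)" "\<And>e. e \<ge> E \<Longrightarrow> G e = (\<lambda>_. 0)" "\<And>s. y s = (\<Sum>e<E. G e s)" by blast
  obtain \<alpha> where \<alpha>: "x = mon k \<alpha>" using step by blast
  let ?e = "sum \<alpha> {..<k}"
  let ?H = "\<lambda>e s. (if e = ?e then c * x s else 0) + G e s"
  have "form k e (\<lambda>s. if e = ?e then c * x s else 0)" for e
    using form_scale[OF form_mon[of k \<alpha>]] form_zero by (cases "e = ?e") (auto simp: \<alpha>)
  then have "form k e (?H e)" for e using G(1) by (rule form_add)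
  moreover have "?H e = (\<lambda>_. 0)" if "max E (Suc ?e) \<le> e" for e using that G(2)[of e] by auto
  moreover have "((\<lambda>t. c * x t) + y) s = (\<Sum>e<max E (Suc ?e). ?H e s)" for s
  proof -
    have "(\<Sum>e<E. G e s) = (\<Sum>e<max E (Suc ?e). G e s)"
      using G(2) by (intro sum.mono_neutral_left) auto
    then show ?thesis by (simp add: sum.distrib G(3))
  qed
  ultimately show ?case by (intro exI[of _ "max E (Suc ?e)"] exI[of _ ?H]) blast
qed

text \<open>Compare both sides of the homogeneity equation as polynomials in the scalar
  \<open>c\<close>: over an infinite field only the part of degree \<open>d\<close> can
  remain.\<close>

lemma homogeneous_polys_form:
  fixes f :: "(nat \<Rightarrow> 'a::field_char_0) \<Rightarrow> 'a"
  assumes f: "f \<in> polys k" and hom: "\<And>c s. f (\<lambda>i. c * s i) = c ^ d * f s"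
  shows "form k d f"
proof -
  obtain E G where G: "\<And>e. form k e (G e)" "\<And>e. e \<ge> E \<Longrightarrow> G e = (\<lambda>_. 0)" "\<And>s. f s = (\<Sum>e<E. G e s)"
    using polys_sum_of_forms[OF f] by blast
  have "f s = G d s" for s
  proof -
    define p where "p = (\<Sum>e<E. monom (G e s) e) - monom (f s) d"
    have "poly p c = 0" for c
    proof -
      have "(\<Sum>e<E. G e s * c ^ e) = f (\<lambda>i. c * s i)"
        unfolding G(3) by (intro sum.cong) (simp_all add: form_scaled[OF G(1)])
      then show ?thesis by (simp add: p_def poly_sum poly_monom hom)
    qed
    then have "p = 0" using poly_all_0_iff_0 by blast
    moreover have "coeff p d = G d s - f s"
      using G(2)[of d] by (cases "d < E") (simp_all add: p_def coeff_sum)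
    ultimately show ?thesis by simp
  qed
  then have "f = G d" by blast
  then show ?thesis using G(1) by simp
qed

lemma poly_fun_compose_polys:
  assumes "poly_fun V e f" and \<gamma>: "\<And>l. l \<in> LinearCombinations.module_hom class_ring V scalar_space \<Longrightarrow> (\<lambda>s. l (\<gamma> s)) \<in> polys k"
  shows "(\<lambda>s. f (\<gamma> s)) \<in> polys k"
  using assms(1) by (induction rule: poly_fun.induct) (auto intro: polys_const polys_mult polys_add \<gamma>)

lemma poly_fun_compose_poly:
  assumes "poly_fun V e f" and \<gamma>: "\<And>l. l \<in> LinearCombinations.module_hom class_ring V scalar_space \<Longrightarrow> \<exists>p. \<forall>s. l (\<gamma> s) = poly p s"
  shows "\<exists>p. \<forall>s. f (\<gamma> s) = poly p s"
  using assms(1)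
proof (induction rule: poly_fun.induct)
  case (poly_fun_const d c)
  show ?case by (rule exI[of _ "[:c:]"]) simp
next
  case (poly_fun_linear_mult l d f)
  then obtain p p' where "\<forall>s. l (\<gamma> s) = poly p s" "\<forall>s. f (\<gamma> s) = poly p' s" using \<gamma> by blast
  then show ?case by (intro exI[of _ "p * p'"]) simp
next
  case (poly_fun_add d f g)
  then obtain p p' where "\<forall>s. f (\<gamma> s) = poly p s" "\<forall>s. g (\<gamma> s) = poly p' s" by blast
  then show ?case by (intro exI[of _ "p + p'"]) simp
qed

lemma form_compose_poly:
  assumes "form k d f" and L: "\<And>i. i < k \<Longrightarrow> \<exists>p. \<forall>s. L s i = poly p s"
  shows "\<exists>p. \<forall>s. f (L s) = poly p s"
  using assms(1)
proof (induction rule: form.induct)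
  case (form_zero d)
  show ?case by (rule exI[of _ 0]) simp
next
  case (form_const c)
  show ?case by (rule exI[of _ "[:c:]"]) simp
next
  case (form_var i d f)
  then obtain p p' where "\<forall>s. L s i = poly p s" "\<forall>s. f (L s) = poly p' s" using L by blast
  then show ?case by (intro exI[of _ "p * p'"]) simp
next
  case (form_add d f g)
  then obtain p p' where "\<forall>s. f (L s) = poly p s" "\<forall>s. g (L s) = poly p' s" by blast
  then show ?case by (intro exI[of _ "p + p'"]) simp
qed

lemma polys_poly_fun:
  assumes "R \<in> polys k" and \<phi>: "\<And>i. i < k \<Longrightarrow> (\<lambda>w. \<phi> w i) \<in> LinearCombinations.module_hom class_ring V scalar_space"
  shows "\<exists>e. poly_fun V e (\<lambda>w. R (\<phi> w))"
proof -
  have form: "\<exists>e. poly_fun V e (\<lambda>w. f (\<phi> w))" if "form k d f" for d f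
    using that
  proof (induction rule: form.induct)
    case (form_var i d f)
    then show ?case using poly_fun_linear_mult[OF \<phi>] by blast
  next
    case (form_add d f g)
    then obtain e e' where "poly_fun V e (\<lambda>w. f (\<phi> w))" "poly_fun V e' (\<lambda>w. g (\<phi> w))" by blast
    then have "poly_fun V (max e e') (\<lambda>w. f (\<phi> w))" "poly_fun V (max e e') (\<lambda>w. g (\<phi> w))"
      by (auto intro: poly_fun_mono)
    then show ?case using poly_fun_add by blast
  qed (auto intro: poly_fun_const)
  have sum: "\<exists>e. poly_fun V e (\<lambda>w. \<Sum>e<E. G e (\<phi> w))" if G: "\<And>e. form k e (G e)" for E :: nat and G
  proof (induction E)
    case 0
    show ?case using poly_fun_const[of V 0 0] by auto
  next
    case (Suc E)
    then obtain e e' where "poly_fun V e (\<lambda>w. \<Sum>e<E. G e (\<phi> w))" "poly_fun V e' (\<lambda>w. G E (\<phi> w))"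
      using form[OF G] by blast
    then have "poly_fun V (max e e') (\<lambda>w. \<Sum>e<E. G e (\<phi> w))" "poly_fun V (max e e') (\<lambda>w. G E (\<phi> w))"
      by (auto intro: poly_fun_mono)
    from poly_fun_add[OF this] show ?case by auto
  qed
  obtain E G where "\<And>e. form k e (G e)" "\<And>s. R s = (\<Sum>e<E. G e s)"
    using polys_sum_of_forms[OF assms(1)] by blast
  then show ?thesis using sum[of G E] by simp
qed

section \<open>Matrices as morphisms between the standard spaces\<close>

lemma block_apply: "v \<in> carrier_vec n \<Longrightarrow> block A m n v = mat m n (\<lambda>(r, c). A r c) *\<^sub>v v"
  by (simp add: block_def)

lemma block_cong: "(\<And>i j. i < m \<Longrightarrow> j < n \<Longrightarrow> A i j = B i j) \<Longrightarrow> block A m n = block B m n"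
proof -
  assume "\<And>i j. i < m \<Longrightarrow> j < n \<Longrightarrow> A i j = B i j"
  then have "mat m n (\<lambda>(r, c). A r c) = mat m n (\<lambda>(r, c). B r c)" by (intro eq_matI) auto
  then show ?thesis by (simp add: block_def)
qed

lemma carrier_K_pow: "carrier (K_pow n :: ('a::field, 'a vec) module) = carrier_vec n"
  by (simp add: module_vec_simps)

lemma block_idm: "block idm n n = (\<lambda>v\<in>carrier (K_pow n). v :: 'a::field vec)"
proof -
  have "mat n n (\<lambda>(r, c). idm r c) = (1\<^sub>m n :: 'a mat)" by (intro eq_matI) (auto simp: idm_def)
  then show ?thesis by (auto simp: block_def carrier_K_pow intro!: restrict_ext)
qed

lemma block_compose:
  fixes A :: "nat \<Rightarrow> nat \<Rightarrow> 'a::field"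
  shows "compose (carrier (K_pow n)) (block A l m) (block B m n) = block (mmul m A B) l n"
proof -
  let ?A = "mat l m (\<lambda>(r, c). A r c)" and ?B = "mat m n (\<lambda>(r, c). B r c)"
  have AB: "?A * ?B = mat l n (\<lambda>(r, c). mmul m A B r c)"
    by (intro eq_matI) (auto simp: mmul_def scalar_prod_def lessThan_atLeast0 intro!: sum.cong)
  have "block A l m (block B m n v) = block (mmul m A B) l n v" if "v \<in> carrier_vec n" for v
  proof -
    have "?B *\<^sub>v v \<in> carrier_vec m" using that by (intro mult_mat_vec_carrier) auto
    then show ?thesis
      using that assoc_mult_mat_vec[of ?A l m ?B n v] by (simp add: block_apply AB)
  qed
  then have "compose (carrier (K_pow n)) (block A l m) (block B m n) v = block (mmul m A B) l n v" for v
    by (cases "v \<in> carrier_vec n") (simp_all add: compose_def carrier_K_pow block_def[of "mmul m A B"])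
  then show ?thesis by (rule ext)
qed

lemma block_scale:
  fixes A :: "nat \<Rightarrow> nat \<Rightarrow> 'a::field"
  shows "block (\<lambda>i j. c * A i j) m n =
    compose (carrier (K_pow n)) (\<lambda>v\<in>carrier (K_pow m). c \<odot>\<^bsub>K_pow m\<^esub> v) (block A m n)"
proof -
  have eq: "mat m n (\<lambda>(r, k). c * A r k) = c \<cdot>\<^sub>m mat m n (\<lambda>(r, c). A r c)" by (intro eq_matI) auto
  have "mat m n (\<lambda>(r, k). c * A r k) *\<^sub>v v = c \<cdot>\<^sub>v (mat m n (\<lambda>(r, c). A r c) *\<^sub>v v)" if "v \<in> carrier_vec n" for v
    unfolding eq using that by (intro eq_vecI) (auto simp: scalar_prod_def sum_distrib_left mult.assoc)
  then show ?thesis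
    by (intro ext) (auto simp: compose_def carrier_K_pow block_def module_vec_simps
        intro!: mult_mat_vec_carrier)
qed

text \<open>Linearity of \<open>block\<close> as a map into \<open>Hom_space\<close>, in the form
  needed to see a polynomial map on morphisms as a polynomial in the parameters
  \<open>s\<close>.\<close>

lemma functional_block_sum:
  fixes As :: "nat \<Rightarrow> nat \<Rightarrow> nat \<Rightarrow> 'a::field"
  assumes l: "l \<in> LinearCombinations.module_hom class_ring (Hom_space (K_pow n) (K_pow m)) scalar_space"
  shows "l (block (\<lambda>i j. \<Sum>r<k. s r * As r i j) m n) = (\<Sum>r<k. s r * l (block (As r) m n))"
proof -
  let ?H = "Hom_space (K_pow n :: ('a, 'a vec) module) (K_pow m)"
  have H: "block A m n \<in> carrier ?H" for A :: "nat \<Rightarrow> nat \<Rightarrow> 'a" using block_Hom by (simp add: Hom_space_def)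
  have scale: "block (\<lambda>i j. c * A i j) m n = c \<odot>\<^bsub>?H\<^esub> block A m n" for c and A :: "nat \<Rightarrow> nat \<Rightarrow> 'a"
    unfolding block_scale Hom_space_def using block_Hom[of A m n]
    by (auto simp: compose_def Hom_iff intro!: restrict_ext)
  have add: "block (\<lambda>i j. A i j + B i j) m n = block A m n \<oplus>\<^bsub>?H\<^esub> block B m n" for A B :: "nat \<Rightarrow> nat \<Rightarrow> 'a"
  proof -
    have eq: "mat m n (\<lambda>(r, c). A r c + B r c) = mat m n (\<lambda>(r, c). A r c) + mat m n (\<lambda>(r, c). B r c)"
      by (intro eq_matI) auto
    have "mat m n (\<lambda>(r, c). A r c + B r c) *\<^sub>v v =
        mat m n (\<lambda>(r, c). A r c) *\<^sub>v v + mat m n (\<lambda>(r, c). B r c) *\<^sub>v v" if "v \<in> carrier_vec n" for v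
      unfolding eq using that by (intro add_mult_distrib_mat_vec) auto
    then show ?thesis
      unfolding block_def by (auto simp: Hom_space_def module_vec_simps intro!: restrict_ext)
  qed
  have ladd: "l (block (\<lambda>i j. A i j + B i j) m n) = l (block A m n) + l (block B m n)"
    and lscale: "l (block (\<lambda>i j. c * A i j) m n) = c * l (block A m n)" for A B c
    using l H unfolding functional_iff add scale by blast+
  show ?thesis
  proof (induction k)
    case 0
    show ?case using lscale[of 0 "\<lambda>_ _. 0"] by simp
  next
    case (Suc k)
    then show ?case by (simp add: ladd lscale)
  qed
qed

section \<open>Polynomial functors in coordinates\<close>

locale coordinatised_functor = polynomial_functor P Pm
  for P :: "('a::{alg_closed_field,field_char_0}, 'a vec) module \<Rightarrow> ('a, 'w) module"
    and Pm :: "('a, 'a vec) module \<Rightarrow> ('a, 'a vec) module \<Rightarrow> ('a vec \<Rightarrow> 'a vec) \<Rightarrow> 'w \<Rightarrow> 'w" +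
  fixes d :: nat and D :: "nat \<Rightarrow> nat" and \<phi> :: "nat \<Rightarrow> 'w \<Rightarrow> nat \<Rightarrow> 'a"
  assumes homogeneous: "homogeneous_functor d P Pm" and d: "0 < d"
    and coordinates: "coordinates (P (K_pow n)) (D n) (\<phi> n)"
begin

abbreviation C :: "nat \<Rightarrow> 'w set" where
  "C n \<equiv> carrier (P (K_pow n))"

abbreviation Pb :: "nat \<Rightarrow> nat \<Rightarrow> (nat \<Rightarrow> nat \<Rightarrow> 'a) \<Rightarrow> 'w \<Rightarrow> 'w" where
  "Pb m n A \<equiv> Pm (K_pow n) (K_pow m) (block A m n)"

definition \<psi> :: "nat \<Rightarrow> (nat \<Rightarrow> 'a) \<Rightarrow> 'w" where
  "\<psi> n = inv_into (C n) (\<phi> n)"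

definition T :: "nat \<Rightarrow> nat \<Rightarrow> (nat \<Rightarrow> nat \<Rightarrow> 'a) \<Rightarrow> (nat \<Rightarrow> 'a) \<Rightarrow> nat \<Rightarrow> 'a" where
  "T m n A x = \<phi> m (Pb m n A (\<psi> n x))"

lemma PF: "polynomial_functor P Pm"
  by (rule polynomial_functor_axioms)

lemma fd: "fd_space (P (K_pow n))"
  by (rule obj[OF fd_space_K_pow])

lemma bij: "bij_betw (\<phi> n) (C n) (coords (D n))"
  and \<phi>_add: "u \<in> C n \<Longrightarrow> v \<in> C n \<Longrightarrow> \<phi> n (u \<oplus>\<^bsub>P (K_pow n)\<^esub> v) = (\<lambda>i. \<phi> n u i + \<phi> n v i)"
  and \<phi>_scale: "v \<in> C n \<Longrightarrow> \<phi> n (c \<odot>\<^bsub>P (K_pow n)\<^esub> v) = (\<lambda>i. c * \<phi> n v i)"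
  using coordinates[of n] by (auto simp: coordinates_def)

lemma \<phi>_in: "w \<in> C n \<Longrightarrow> \<phi> n w \<in> coords (D n)"
  using bij[of n] by (auto simp: bij_betw_def)

lemma \<psi>_in: "x \<in> coords (D n) \<Longrightarrow> \<psi> n x \<in> C n"
  using bij[of n] unfolding \<psi>_def bij_betw_def by (metis inv_into_into)

lemma \<psi>_\<phi>: "w \<in> C n \<Longrightarrow> \<psi> n (\<phi> n w) = w"
  using bij[of n] unfolding \<psi>_def bij_betw_def by (metis inv_into_f_f)

lemma \<phi>_\<psi>: "x \<in> coords (D n) \<Longrightarrow> \<phi> n (\<psi> n x) = x"
  using bij[of n] unfolding \<psi>_def bij_betw_def by (metis f_inv_into_f)

lemma \<phi>_eqD: "u \<in> C n \<Longrightarrow> v \<in> C n \<Longrightarrow> \<phi> n u = \<phi> n v \<Longrightarrow> u = v"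
  by (metis \<psi>_\<phi>)

lemma \<psi>_add:
  assumes "x \<in> coords (D n)" "y \<in> coords (D n)"
  shows "\<psi> n (\<lambda>i. x i + y i) = \<psi> n x \<oplus>\<^bsub>P (K_pow n)\<^esub> \<psi> n y"
proof -
  have "\<phi> n (\<psi> n x \<oplus>\<^bsub>P (K_pow n)\<^esub> \<psi> n y) = (\<lambda>i. x i + y i)"
    by (simp add: \<phi>_add \<psi>_in \<phi>_\<psi> assms)
  then show ?thesis using \<psi>_\<phi>[OF fd_space_closed(1)[OF fd \<psi>_in[OF assms(1)] \<psi>_in[OF assms(2)]]] by simp
qed

lemma \<psi>_scale:
  assumes "x \<in> coords (D n)"
  shows "\<psi> n (\<lambda>i. c * x i) = c \<odot>\<^bsub>P (K_pow n)\<^esub> \<psi> n x"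
proof -
  have "\<phi> n (c \<odot>\<^bsub>P (K_pow n)\<^esub> \<psi> n x) = (\<lambda>i. c * x i)"
    by (simp add: \<phi>_scale \<psi>_in \<phi>_\<psi> assms)
  then show ?thesis using \<psi>_\<phi>[OF fd_space_closed(2)[OF fd \<psi>_in[OF assms]], of c] by simp
qed

lemma Pb_Hom: "Pb m n A \<in> Hom (P (K_pow n)) (P (K_pow m))"
  by (rule mor[OF fd_space_K_pow fd_space_K_pow block_Hom])

lemma Pb_in: "w \<in> C n \<Longrightarrow> Pb m n A w \<in> C m"
  using Pb_Hom[of n m A] by (auto simp: Hom_iff)

lemma T_\<phi>: "w \<in> C n \<Longrightarrow> T m n A (\<phi> n w) = \<phi> m (Pb m n A w)"
  by (simp add: T_def \<psi>_\<phi>)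

lemma Pb_comp: "w \<in> C n \<Longrightarrow> Pb l m A (Pb m n B w) = Pb l n (mmul m A B) w"
proof -
  assume w: "w \<in> C n"
  have "Pb l n (mmul m A B) = compose (C n) (Pb l m A) (Pb m n B)"
    unfolding block_compose[symmetric]
    by (rule mor_comp[OF fd_space_K_pow fd_space_K_pow fd_space_K_pow block_Hom block_Hom])
  then show ?thesis using w by (simp add: compose_def)
qed

lemma scaling_Hom: "(\<lambda>v\<in>carrier (K_pow m). c \<odot>\<^bsub>K_pow m\<^esub> v) \<in> Hom (K_pow m) (K_pow m :: ('a, 'a vec) module)"
  unfolding Hom_iff
  by (auto simp: module_vec_simps smult_add_distrib_vec smult_smult_assoc mult.commute)

lemma Pb_scale: "w \<in> C n \<Longrightarrow> Pb m n (\<lambda>i j. c * A i j) w = c ^ d \<odot>\<^bsub>P (K_pow m)\<^esub> Pb m n A w"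
proof -
  assume w: "w \<in> C n"
  have "Pb m n (\<lambda>i j. c * A i j) = compose (C n)
      (Pm (K_pow m) (K_pow m) (\<lambda>v\<in>carrier (K_pow m). c \<odot>\<^bsub>K_pow m\<^esub> v)) (Pb m n A)"
    unfolding block_scale
    by (rule mor_comp[OF fd_space_K_pow fd_space_K_pow fd_space_K_pow block_Hom scaling_Hom])
  also have "Pm (K_pow m) (K_pow m) (\<lambda>v\<in>carrier (K_pow m). c \<odot>\<^bsub>K_pow m\<^esub> v) =
      (\<lambda>w\<in>C m. c ^ d \<odot>\<^bsub>P (K_pow m)\<^esub> w)"
    using homogeneous fd_space_K_pow unfolding homogeneous_functor_def by blast
  finally show ?thesis using w Pb_in[OF w, of m A] by (simp add: compose_def)
qed

text \<open>Evaluating a morphism at a fixed vector and reading off a coordinate is a linear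
  functional on the target space of morphisms, so the polynomiality of the functor applies to
  it.\<close>

lemma T_polys:
  assumes x: "x \<in> coords (D n)"
  shows "(\<lambda>s. T m n (\<lambda>i j. \<Sum>l<k. s l * As l i j) x b) \<in> polys k"
proof -
  let ?U = "K_pow n :: ('a, 'a vec) module" and ?W = "K_pow m :: ('a, 'a vec) module"
  obtain e where "poly_map e (Hom_space ?U ?W) (Hom_space (P ?U) (P ?W)) (Pm ?U ?W)"
    using bounded_degree fd_space_K_pow by blast
  moreover have "(\<lambda>h. \<phi> m (h (\<psi> n x)) b) \<in> LinearCombinations.module_hom class_ring (Hom_space (P ?U) (P ?W)) scalar_space"
  proof -
    have "h (\<psi> n x) \<in> C m" if "h \<in> Hom (P ?U) (P ?W)" for h
      using that \<psi>_in[OF x] by (auto simp: Hom_iff)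
    then show ?thesis unfolding functional_iff Hom_space_def using \<psi>_in[OF x] by (simp add: \<phi>_add \<phi>_scale)
  qed
  ultimately obtain f where f: "poly_fun (Hom_space ?U ?W) e f"
    "\<And>h. h \<in> Hom ?U ?W \<Longrightarrow> \<phi> m (Pm ?U ?W h (\<psi> n x)) b = f h"
    unfolding poly_map_def Hom_space_def by auto
  have "(\<lambda>s. f (block (\<lambda>i j. \<Sum>l<k. s l * As l i j) m n)) \<in> polys k"
  proof (rule poly_fun_compose_polys[OF f(1)])
    fix l assume "l \<in> LinearCombinations.module_hom class_ring (Hom_space ?U ?W) scalar_space"
    note eq = functional_block_sum[OF this]
    show "(\<lambda>s. l (block (\<lambda>i j. \<Sum>l<k. s l * As l i j) m n)) \<in> polys k"
      unfolding eq by (intro polys_sum polys_mult polys_var polys_const) auto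
  qed
  then show ?thesis by (simp add: T_def f(2)[OF block_Hom])
qed

sublocale matrix_functor D T d
proof
  show "0 < d" by (rule d)
  fix n m l :: nat and A B :: "nat \<Rightarrow> nat \<Rightarrow> 'a" and x y :: "nat \<Rightarrow> 'a" and c :: 'a
  have Hom: "Pb m n A (u \<oplus>\<^bsub>P (K_pow n)\<^esub> v) = Pb m n A u \<oplus>\<^bsub>P (K_pow m)\<^esub> Pb m n A v"
    "Pb m n A (c \<odot>\<^bsub>P (K_pow n)\<^esub> v) = c \<odot>\<^bsub>P (K_pow m)\<^esub> Pb m n A v"
    if "u \<in> C n" "v \<in> C n" for u v
    using Pb_Hom[of n m A] that by (auto simp: Hom_iff)
  show "T m n A x \<in> coords (D m)" if "x \<in> coords (D n)"
    unfolding T_def by (intro \<phi>_in Pb_in \<psi>_in that)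
  show "T m n A (\<lambda>i. x i + y i) = (\<lambda>i. T m n A x i + T m n A y i)"
    if "x \<in> coords (D n)" "y \<in> coords (D n)"
    unfolding T_def by (simp add: \<psi>_add Hom \<psi>_in that \<phi>_add Pb_in)
  show "T m n A (\<lambda>i. c * x i) = (\<lambda>i. c * T m n A x i)" if "x \<in> coords (D n)"
    unfolding T_def using Hom(2)[OF \<psi>_in[OF that] \<psi>_in[OF that]]
    by (simp add: \<psi>_scale \<psi>_in that \<phi>_scale Pb_in)
  show "T n n idm x = x" if "x \<in> coords (D n)"
    unfolding T_def block_idm using mor_id[OF fd_space_K_pow[of n]] \<psi>_in[OF that] by (simp add: \<phi>_\<psi> that)
  show "T l m A (T m n B x) = T l n (mmul m A B) x" if "x \<in> coords (D n)"
    by (simp add: T_def \<psi>_\<phi> Pb_in \<psi>_in that Pb_comp)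
  show "T m n A = T m n B" if "\<And>i j. i < m \<Longrightarrow> j < n \<Longrightarrow> A i j = B i j"
  proof -
    have "block A m n = block B m n" by (rule block_cong) (rule that)
    then show ?thesis by (intro ext) (simp only: T_def)
  qed
next
  fix x :: "nat \<Rightarrow> 'a" and n k m b :: nat and As :: "nat \<Rightarrow> nat \<Rightarrow> nat \<Rightarrow> 'a"
  assume x: "x \<in> coords (D n)"
  show "form k d (\<lambda>s. T m n (\<lambda>i j. \<Sum>l<k. s l * As l i j) x b)"
  proof (rule homogeneous_polys_form[OF T_polys[OF x]])
    fix c and s :: "nat \<Rightarrow> 'a"
    have "(\<lambda>i j. \<Sum>l<k. c * s l * As l i j) = (\<lambda>i j. c * (\<Sum>l<k. s l * As l i j))"
      by (simp add: sum_distrib_left mult.assoc)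
    then show "T m n (\<lambda>i j. \<Sum>l<k. c * s l * As l i j) x b = c ^ d * T m n (\<lambda>i j. \<Sum>l<k. s l * As l i j) x b"
      by (simp add: T_def Pb_scale \<psi>_in x \<phi>_scale Pb_in)
  qed
qed

section \<open>The inverse limit and the matrix action in coordinates\<close>

lemma forget_last_block: "forget_last n = block (idm :: nat \<Rightarrow> nat \<Rightarrow> 'a) n (Suc n)"
  unfolding forget_last_eq_block idm_def ..

lemma P_inf_iff: "p \<in> P_inf P Pm \<longleftrightarrow> (\<forall>n. p n \<in> C n \<and> Pb n (Suc n) idm (p (Suc n)) = p n)"
  by (simp add: P_inf_def forget_last_block)

lemma P_inf_Q: "p \<in> P_inf P Pm \<Longrightarrow> (\<lambda>n. \<phi> n (p n)) \<in> Q"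
  unfolding P_inf_iff Q_def by (simp add: \<phi>_in T_\<phi>)

lemma Q_P_inf: "q \<in> Q \<Longrightarrow> (\<lambda>n. \<psi> n (q n)) \<in> P_inf P Pm"
proof -
  assume q: "q \<in> Q"
  have "Pb n (Suc n) idm (\<psi> (Suc n) (q (Suc n))) = \<psi> n (q n)" for n
  proof -
    have "\<phi> n (Pb n (Suc n) idm (\<psi> (Suc n) (q (Suc n)))) = q n"
      using q by (simp add: Q_def T_def)
    then show ?thesis using \<psi>_\<phi>[OF Pb_in[OF \<psi>_in[OF Q_V[OF q]]], of n "Suc n" idm] by simp
  qed
  then show ?thesis unfolding P_inf_iff using \<psi>_in[OF Q_V[OF q]] by simp
qed

lemma \<phi>_P_act:
  assumes p: "p \<in> P_inf P Pm" and A: "rows_within A n N"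
  shows "\<phi> n (P_act P Pm A p n) = T n N A (\<phi> N (p N))"
  using P_act_eq[OF PF p A] T_\<phi>[of "p N" N n A] p by (simp add: P_inf_iff)

lemma specialization_ofI:
  assumes p: "p \<in> P_inf P Pm" and q: "q \<in> P_inf P Pm" and A: "A \<in> row_finite_matrices"
    and eq: "\<And>n N. rows_within A n N \<Longrightarrow> T n N A (\<phi> N (q N)) = \<phi> n (p n)"
  shows "specialization_of P Pm p q"
  unfolding specialization_of_def
proof (rule bexI[OF _ A], rule ext)
  fix n
  obtain N where N: "rows_within A n N" using rows_within_exists[OF A] by blast
  have "P_act P Pm A q n \<in> C n" using P_act_in_P_inf[OF PF q A] by (simp add: P_inf_iff)
  moreover have "p n \<in> C n" using p by (simp add: P_inf_iff)
  moreover have "\<phi> n (P_act P Pm A q n) = \<phi> n (p n)" using \<phi>_P_act[OF q N] eq[OF N] by simp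
  ultimately show "p n = P_act P Pm A q n" by (metis \<phi>_eqD)
qed

lemma extend_to_Q: "y \<in> V n \<Longrightarrow> \<exists>q\<in>Q. q n = y"
proof (rule bexI[of _ "\<lambda>m. T m n idm y"])
  assume y: "y \<in> V n"
  show "T n n idm y = y" by (rule T_id[OF y])
  show "(\<lambda>m. T m n idm y) \<in> Q"
    unfolding Q_def using T_in[OF y] T_idm_trans[OF le_SucI[OF order_refl] y] by simp
qed

section \<open>Density of orbits and covering\<close>

lemma coordinate_functional: "(\<lambda>w. \<phi> n w i) \<in> LinearCombinations.module_hom class_ring (P (K_pow n)) scalar_space"
  unfolding functional_iff by (simp add: \<phi>_add \<phi>_scale)

text \<open>The set where \<open>R\<close> is nonzero at level \<open>n\<close> pulls back to an
  open set of the limit. It is nonempty because every point of level \<open>n\<close> extends to the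
  limit, so the orbit meets it.\<close>

lemma dense_orbit_dense:
  assumes p: "p \<in> P_inf P Pm" and dense: "dense_orbit P Pm p"
  shows "dense (\<lambda>n. \<phi> n (p n))"
  unfolding dense_def
proof (intro allI ballI impI)
  fix n R assume R: "R \<in> polys (D n)" and "\<exists>y\<in>V n. R y \<noteq> 0"
  then obtain y q where y: "y \<in> V n" "R y \<noteq> 0" and q: "q \<in> Q" "q n = y" using extend_to_Q by blast
  define f where "f = (\<lambda>w. R (\<phi> n w))"
  have f: "\<exists>e. poly_fun (P (K_pow n)) e f"
    unfolding f_def by (rule polys_poly_fun[OF R coordinate_functional])
  define W where "W = carrier (P (K_pow n)) - zero_locus (P (K_pow n)) {f}"
  have W: "openin (zariski (P (K_pow n))) W"
    unfolding openin_zariski W_def using f by blast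
  let ?X = "product_topology (\<lambda>n. zariski (P (K_pow n))) UNIV"
  have "continuous_map ?X (zariski (P (K_pow n))) (\<lambda>x. x n)"
    by (rule continuous_map_product_projection) simp
  then have "openin ?X {x \<in> topspace ?X. x n \<in> W}"
    using W by (rule openin_continuous_map_preimage)
  then have U: "openin (P_inf_topology P Pm) (P_inf P Pm \<inter> {x \<in> topspace ?X. x n \<in> W})"
    unfolding P_inf_topology_def by (rule openin_subtopology_Int2)
  define r where "r = (\<lambda>n. \<psi> n (q n))"
  have r: "r \<in> P_inf P Pm" unfolding r_def by (rule Q_P_inf[OF q(1)])
  have rW: "r n \<in> W"
    using r y by (simp add: W_def zero_locus_def f_def P_inf_iff r_def q(2) \<phi>_\<psi> \<psi>_in)
  have rX: "r \<in> topspace ?X" using r by (simp add: P_inf_iff PiE_iff)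
  have "r \<in> P_inf_topology P Pm closure_of GL_orbit P Pm p"
    using dense r unfolding dense_orbit_def by simp
  then have cl: "\<forall>U. r \<in> U \<and> openin (P_inf_topology P Pm) U \<longrightarrow> (\<exists>z. z \<in> GL_orbit P Pm p \<and> z \<in> U)"
    unfolding in_closure_of by (rule conjunct2)
  have "r \<in> P_inf P Pm \<inter> {x \<in> topspace ?X. x n \<in> W}" using r rX rW by simp
  then have "\<exists>z. z \<in> GL_orbit P Pm p \<and> z \<in> P_inf P Pm \<inter> {x \<in> topspace ?X. x n \<in> W}"
    using U by (intro cl[THEN spec, THEN mp] conjI)
  then obtain z where z: "z \<in> GL_orbit P Pm p" "z \<in> P_inf P Pm \<inter> {x \<in> topspace ?X. x n \<in> W}"
    by (elim exE conjE)
  then have zW: "z n \<in> W" by simp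
  from z(1) obtain g where g: "g \<in> GL_inf" "z = P_act P Pm g p" unfolding GL_orbit_def by blast
  then have "g \<in> row_finite_matrices" using GL_inf_row_finite by blast
  then obtain N where N: "rows_within g n N" using rows_within_exists by blast
  have "R (T n N g (\<phi> N (p N))) \<noteq> 0"
    using zW \<phi>_P_act[OF p N] by (simp add: g(2) W_def zero_locus_def f_def)
  then show "\<exists>N A. R (T n N A (\<phi> N (p N))) \<noteq> 0" by blast
qed

lemma T_line_poly:
  assumes x: "x \<in> V n" and l: "l \<in> LinearCombinations.module_hom class_ring (P (K_pow m)) scalar_space"
  shows "\<exists>p. \<forall>s. l (\<psi> m (T m n (\<lambda>i j. A i j + s * B i j) x)) = poly p s"
proof -
  have l\<psi>: "l (\<psi> m y) = (\<Sum>k<D m. y k * l (\<psi> m (unit k)))" if y: "y \<in> V m" for y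
  proof -
    have ladd: "l (\<psi> m (\<lambda>i. y i + z i)) = l (\<psi> m y) + l (\<psi> m z)"
      and lscale: "l (\<psi> m (\<lambda>i. c * y i)) = c * l (\<psi> m y)" if "y \<in> V m" "z \<in> V m" for y z c
      using l that by (simp_all add: functional_iff \<psi>_add \<psi>_scale \<psi>_in)
    have "l (\<psi> m (\<lambda>i. \<Sum>k<K. y k * unit k i)) = (\<Sum>k<K. y k * l (\<psi> m (unit k)))" if "K \<le> D m" for K
      using that
    proof (induction K)
      case 0
      show ?case using lscale[OF zero_coords zero_coords, of 0] by simp
    next
      case (Suc K)
      have u: "unit K \<in> V m" using Suc.prems by (intro unit_coords) simp
      have "(\<lambda>i. \<Sum>k<K. y k * unit k i) \<in> V m" using Suc.prems by (intro sum_coords unit_coords) simp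
      moreover have "(\<lambda>i. y K * unit K i) \<in> V m" using u by (simp add: coords_def)
      ultimately show ?case using Suc by (simp add: ladd lscale[OF u u])
    qed
    from this[OF order_refl] show ?thesis using coords_expand[OF y] by simp
  qed
  have "\<exists>p. \<forall>s. T m n (\<lambda>i j. A i j + s * B i j) x k = poly p s" for k
  proof -
    \<comment> \<open>The line is the linear system spanned by \<open>A\<close> and
      \<open>B\<close>, with parameters 1 and \<open>s\<close>.\<close>
    let ?As = "\<lambda>l::nat. if l = 0 then A else B"
    let ?L = "\<lambda>s (l::nat). if l = 0 then 1 else s :: 'a"
    have "\<exists>p. \<forall>s. ?L s i = poly p s" for i
      by (cases "i = 0") (auto intro: exI[of _ "[:1:]"] exI[of _ "[:0, 1:]"])
    then have "\<exists>p. \<forall>s. T m n (\<lambda>i j. \<Sum>l<2. ?L s l * ?As l i j) x k = poly p s"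
      by (intro form_compose_poly[OF T_form[OF x], where L = ?L])
    then show ?thesis by (simp add: numeral_2_eq_2)
  qed
  then have "\<forall>k. \<exists>p. \<forall>s. T m n (\<lambda>i j. A i j + s * B i j) x k = poly p s" by (rule allI)
  from choice[OF this] obtain p where p: "\<And>k s. T m n (\<lambda>i j. A i j + s * B i j) x k = poly (p k) s" by blast
  have "l (\<psi> m (T m n (\<lambda>i j. A i j + s * B i j) x)) =
      poly (\<Sum>k<D m. Polynomial.smult (l (\<psi> m (unit k))) (p k)) s" for s
    by (simp add: l\<psi>[OF T_in[OF x]] p poly_sum mult.commute)
  then show ?thesis by blast
qed

text \<open>
  A matrix reaching a given point need not have full rank; perturbing it by a multiple \<open>s\<close> of the
  identity in fresh columns gives the upper rows of an element of \<open>GL_inf\<close>.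
\<close>

lemma bordered_matrix_GL_inf:
  assumes s: "s \<noteq> 0"
  shows "\<exists>g\<in>GL_inf. rows_within g n (N + n) \<and>
    (\<forall>i<n. \<forall>j<N + n. g i j = ((if j < N then A i j else 0) + s * (if j = N + i then 1 else 0) :: 'a))"
proof -
  let ?M = "N + n"
  \<comment> \<open>In block form \<open>g\<close> is [[A, s I], [I, 0]], and its inverse
    \<open>h\<close> is [[0, I], [I/s, -A/s]].\<close>
  define g where "g = mat ?M ?M (\<lambda>(i, j). if i < n then (if j < N then A i j else 0) + s * (if j = N + i then 1 else 0)
    else if j = i - n then 1 else 0)"
  define h where "h = mat ?M ?M (\<lambda>(i, j). if i < N then if j = n + i then 1 else 0
    else if j < n then if j = i - N then 1 / s else 0 else - A (i - N) (j - n) / s)"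
  have gc: "g \<in> carrier_mat ?M ?M" and hc: "h \<in> carrier_mat ?M ?M" by (simp_all add: g_def h_def)
  have gh: "g * h = 1\<^sub>m ?M"
  proof (rule eq_matI)
    fix i j assume ij: "i < dim_row (1\<^sub>m ?M)" "j < dim_col (1\<^sub>m ?M)"
    then have i: "i < ?M" and j: "j < ?M" by auto
    have "(g * h) $$ (i, j) = (\<Sum>c<?M. g $$ (i, c) * h $$ (c, j))"
      using i j gc hc by (auto simp: scalar_prod_def lessThan_atLeast0 intro!: sum.cong)
    also have "\<dots> = (if i = j then 1 else 0)"
    proof (cases "i < n")
      case True
      have "(\<Sum>c<?M. g $$ (i, c) * h $$ (c, j)) =
          (\<Sum>c<N. g $$ (i, c) * h $$ (c, j)) + (\<Sum>c<n. g $$ (i, N + c) * h $$ (N + c, j))"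
        by (rule sum_lessThan_split)
      also have "(\<Sum>c<N. g $$ (i, c) * h $$ (c, j)) = (\<Sum>c<N. if c = j - n \<and> n \<le> j then A i (j - n) else 0)"
        using True i j by (intro sum.cong) (auto simp: g_def h_def)
      also have "\<dots> = (if n \<le> j then A i (j - n) else 0)" using j by auto
      also have "(\<Sum>c<n. g $$ (i, N + c) * h $$ (N + c, j)) =
          (\<Sum>c<n. if c = i then s * (if j < n then if j = i then 1 / s else 0 else - A i (j - n) / s) else 0)"
        using True i j by (intro sum.cong) (auto simp: g_def h_def)
      also have "\<dots> = s * (if j < n then if j = i then 1 / s else 0 else - A i (j - n) / s)" using True by simp
      finally show ?thesis using s True by auto
    next
      case False
      then have "(\<Sum>c<?M. g $$ (i, c) * h $$ (c, j)) = (\<Sum>c<?M. if c = i - n then h $$ (i - n, j) else 0)"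
        using i j by (intro sum.cong) (auto simp: g_def)
      also have "\<dots> = h $$ (i - n, j)" using False i by auto
      also have "\<dots> = (if i = j then 1 else 0)" using False i j by (auto simp: h_def)
      finally show ?thesis .
    qed
    finally show "(g * h) $$ (i, j) = 1\<^sub>m ?M $$ (i, j)" using i j by simp
  qed (use gc hc in auto)
  then have "h * g = 1\<^sub>m ?M" using mat_mult_left_right_inverse[OF gc hc] by blast
  then have inv: "invertible_mat g"
    using gh gc hc unfolding invertible_mat_def inverts_mat_def by (intro conjI exI[of _ h]) auto
  define \<gamma> where "\<gamma> = (\<lambda>i j. if i < ?M \<and> j < ?M then g $$ (i, j) else if i = j then 1 else 0)"
  have "\<gamma> \<in> GL_inf" unfolding GL_inf_def \<gamma>_def using gc inv by blast
  moreover have "rows_within \<gamma> n ?M" unfolding rows_within_def \<gamma>_def by auto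
  moreover have "\<forall>i<n. \<forall>j<?M. \<gamma> i j = (if j < N then A i j else 0) + s * (if j = N + i then 1 else 0)"
    by (simp add: \<gamma>_def g_def)
  ultimately show ?thesis by blast
qed

text \<open>A basic neighbourhood of \<open>r\<close> restricts finitely many levels, and each
  restriction can be tightened to the nonvanishing of one polynomial function. All these levels are
  determined by level \<open>n\<close>, where covering reaches \<open>r\<close> exactly; the
  perturbed images then leave \<open>r\<close> along a curve, on which each test function is a
  nonzero polynomial in \<open>s\<close>.\<close>

lemma covers_dense_orbit:
  assumes p: "p \<in> P_inf P Pm" and cov: "covers (\<lambda>n. \<phi> n (p n))"
  shows "dense_orbit P Pm p"
  unfolding dense_orbit_def
proof
  show "P_inf_topology P Pm closure_of GL_orbit P Pm p \<subseteq> P_inf P Pm"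
    using closure_of_subset_topspace[of "P_inf_topology P Pm"] by (simp add: topspace_P_inf_topology)
  show "P_inf P Pm \<subseteq> P_inf_topology P Pm closure_of GL_orbit P Pm p"
  proof
    fix r assume r: "r \<in> P_inf P Pm"
    let ?q = "\<lambda>n. \<phi> n (p n)"
    have q: "?q \<in> Q" by (rule P_inf_Q[OF p])
    have "\<exists>z\<in>GL_orbit P Pm p. z \<in> U" if rU: "r \<in> U" and U: "openin (P_inf_topology P Pm) U" for U
    proof -
      let ?X = "product_topology (\<lambda>n. zariski (P (K_pow n))) UNIV"
      obtain O' where O': "openin ?X O'" "U = O' \<inter> P_inf P Pm"
        using U unfolding P_inf_topology_def openin_subtopology by blast
      then obtain W where W: "finite {i. W i \<noteq> topspace (zariski (P (K_pow i)))}"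
        "\<And>i. openin (zariski (P (K_pow i))) (W i)" "r \<in> Pi\<^sub>E UNIV W" "Pi\<^sub>E UNIV W \<subseteq> O'"
        using rU unfolding openin_product_topology_alt by auto
      define J where "J = {i. W i \<noteq> topspace (zariski (P (K_pow i)))}"
      have J: "finite J" using W(1) by (simp add: J_def)
      have "\<exists>f e. poly_fun (P (K_pow j)) e f \<and> f (r j) \<noteq> 0 \<and> (\<forall>w\<in>C j. f w \<noteq> 0 \<longrightarrow> w \<in> W j)" for j
      proof -
        obtain S where S: "S \<subseteq> {f. \<exists>d. poly_fun (P (K_pow j)) d f}"
          "W j = C j - zero_locus (P (K_pow j)) S" using W(2)[of j] unfolding openin_zariski by blast
        have "r j \<in> W j" using W(3) by auto
        then obtain f where "f \<in> S" "f (r j) \<noteq> 0" unfolding S(2) zero_locus_def by blast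
        then show ?thesis using S unfolding zero_locus_def by blast
      qed
      then have "\<forall>j. \<exists>f. \<exists>e. poly_fun (P (K_pow j)) e f \<and> f (r j) \<noteq> 0 \<and> (\<forall>w\<in>C j. f w \<noteq> 0 \<longrightarrow> w \<in> W j)"
        by (rule allI)
      from choice[OF this] obtain f where f: "\<And>j. \<exists>e. poly_fun (P (K_pow j)) e (f j)" "\<And>j. f j (r j) \<noteq> 0"
        "\<And>j w. w \<in> C j \<Longrightarrow> f j w \<noteq> 0 \<Longrightarrow> w \<in> W j" by blast
      define n where "n = (\<Sum>j\<in>J. j)"
      have n: "j \<le> n" if "j \<in> J" for j unfolding n_def using J that by (intro member_le_sum) auto
      have rn: "\<phi> n (r n) \<in> V n" using r by (intro \<phi>_in) (simp add: P_inf_iff)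
      then obtain N A where A: "T n N A (?q N) = \<phi> n (r n)" using cov unfolding covers_def by blast
      let ?M = "N + n"
      define A0 where "A0 = (\<lambda>i j. if j < N then A i j else 0)"
      define B where "B = (\<lambda>i j. if j = N + i then 1 else 0 :: 'a)"
      have qM: "?q ?M \<in> V ?M" by (rule Q_V[OF q])
      define \<gamma> where "\<gamma> = (\<lambda>j s. \<psi> j (T j ?M (\<lambda>i c. A0 i c + s * B i c) (?q ?M)))"
      have \<gamma>0: "\<gamma> j 0 = r j" if "j \<le> n" for j
      proof -
        have A0: "rows_within A0 n N" by (auto simp: rows_within_def A0_def)
        have "T j ?M A0 = T j ?M (mmul n idm A0)"
          using that by (intro T_cong) (simp add: idm_mmul)
        then have "T j ?M A0 (?q ?M) = T j n idm (T n ?M A0 (?q ?M))" by (simp add: T_comp[OF qM])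
        also have "T n ?M A0 (?q ?M) = T n N A0 (?q N)" by (rule Q_rows[OF q A0]) simp
        also have "T n N A0 = T n N A" by (rule T_cong) (simp add: A0_def)
        also have "T j n idm (T n N A (?q N)) = \<phi> j (r j)"
          unfolding A using Q_restrict[OF P_inf_Q[OF r] that] .
        finally show ?thesis using r by (simp add: \<gamma>_def \<psi>_\<phi> P_inf_iff)
      qed
      have "\<exists>P. \<forall>s. f j (\<gamma> j s) = poly P s" for j
      proof -
        obtain e where e: "poly_fun (P (K_pow j)) e (f j)" using f(1) by blast
        show ?thesis
          by (rule poly_fun_compose_poly[OF e]) (unfold \<gamma>_def, rule T_line_poly[OF qM])
      qed
      then have "\<forall>j. \<exists>P. \<forall>s. f j (\<gamma> j s) = poly P s" by (rule allI)
      from choice[OF this] obtain F where F: "\<And>j s. f j (\<gamma> j s) = poly (F j) s" by blast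
      have "poly (F j) 0 \<noteq> 0" if "j \<in> J" for j
        using f(2)[of j] \<gamma>0[OF n[OF that]] F[of j 0] by simp
      then have "F j \<noteq> 0" if "j \<in> J" for j using that by force
      \<comment> \<open>The factor \<open>[:0, 1:]\<close> excludes \<open>s = 0\<close>, where the
        bordered matrix is not invertible if \<open>n\<close> is positive.\<close>
      then have "[:0, 1:] * (\<Prod>j\<in>J. F j) \<noteq> 0" using J by simp
      then obtain s where "poly ([:0, 1:] * (\<Prod>j\<in>J. F j)) s \<noteq> 0" using poly_all_0_iff_0 by blast
      then have s: "s \<noteq> 0" "\<And>j. j \<in> J \<Longrightarrow> f j (\<gamma> j s) \<noteq> 0"
        using J by (auto simp: F poly_prod)
      obtain g where g: "g \<in> GL_inf" "rows_within g n ?M"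
        "\<And>i c. i < n \<Longrightarrow> c < ?M \<Longrightarrow> g i c = A0 i c + s * B i c"
        using bordered_matrix_GL_inf[OF s(1), of n N A] unfolding A0_def B_def by blast
      define z where "z = P_act P Pm g p"
      have z: "z \<in> P_inf P Pm"
        unfolding z_def using P_act_in_P_inf[OF PF p] g(1) GL_inf_row_finite by blast
      have zj: "z j = \<gamma> j s" if "j \<le> n" for j
      proof -
        have "rows_within g j ?M" using g(2) less_le_trans[OF _ that] unfolding rows_within_def by blast
        then have "\<phi> j (z j) = T j ?M g (?q ?M)" unfolding z_def by (rule \<phi>_P_act[OF p])
        also have "T j ?M g = T j ?M (\<lambda>i c. A0 i c + s * B i c)" using that by (intro T_cong g(3)) auto
        finally have "\<psi> j (\<phi> j (z j)) = \<gamma> j s" by (simp add: \<gamma>_def)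
        then show ?thesis using z by (simp add: \<psi>_\<phi> P_inf_iff)
      qed
      have "z j \<in> W j" for j
      proof (cases "j \<in> J")
        case True
        have "z j \<in> C j" using z by (simp add: P_inf_iff)
        then show ?thesis using f(3)[of "z j" j] s(2)[OF True] zj[OF n[OF True]] by simp
      next
        case False
        then show ?thesis using z by (simp add: J_def P_inf_iff)
      qed
      then have "z \<in> U" using W(4) z unfolding O'(2) by auto
      moreover have "z \<in> GL_orbit P Pm p" unfolding z_def GL_orbit_def using g(1) by blast
      ultimately show ?thesis by blast
    qed
    then show "r \<in> P_inf_topology P Pm closure_of GL_orbit P Pm p"
      unfolding in_closure_of topspace_P_inf_topology using r by blast
  qed
qed

theorem minimal_and_maximal_dense_orbits:
  "\<exists>p\<in>P_inf P Pm. \<exists>r\<in>P_inf P Pm. dense_orbit P Pm p \<and> dense_orbit P Pm r \<and>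
    (\<forall>q\<in>P_inf P Pm. dense_orbit P Pm q \<longrightarrow>
      specialization_of P Pm p q \<and> specialization_of P Pm q r)"
proof -
  define p where "p = (\<lambda>n. \<psi> n (min_elt n))"
  define r where "r = (\<lambda>n. \<psi> n (max_elt n))"
  have p: "p \<in> P_inf P Pm" and r: "r \<in> P_inf P Pm"
    unfolding p_def r_def by (intro Q_P_inf min_elt_Q max_elt_Q)+
  have \<phi>p: "\<phi> n (p n) = min_elt n" and \<phi>r: "\<phi> n (r n) = max_elt n" for n
    unfolding p_def r_def by (simp_all add: \<phi>_\<psi> Q_V[OF min_elt_Q] Q_V[OF max_elt_Q])
  \<comment> \<open>Every point of a level extends to the inverse limit, and every point of the
    limit is a specialisation of the maximal element.\<close>
  have "covers max_elt"
    unfolding covers_def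
  proof (intro allI ballI)
    fix n y assume "y \<in> V n"
    then obtain q where q: "q \<in> Q" "q n = y" using extend_to_Q by blast
    obtain A where A: "A \<in> row_finite_matrices" "\<And>N. rows_within A n N \<Longrightarrow> T n N A (max_elt N) = q n"
      using max_elt_maximal[OF q(1)] by blast
    then show "\<exists>N A. T n N A (max_elt N) = y" using rows_within_exists[OF A(1)] q(2) by blast
  qed
  then have "dense_orbit P Pm r" by (intro covers_dense_orbit r) (simp add: \<phi>r)
  moreover have "dense_orbit P Pm p" by (intro covers_dense_orbit p) (simp add: \<phi>p min_elt_covers)
  moreover have "specialization_of P Pm p q \<and> specialization_of P Pm q r"
    if q: "q \<in> P_inf P Pm" and dense: "dense_orbit P Pm q" for q
  proof
    have qQ: "(\<lambda>n. \<phi> n (q n)) \<in> Q" by (rule P_inf_Q[OF q])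
    have "covers (\<lambda>n. \<phi> n (q n))" by (rule dense_covers[OF qQ dense_orbit_dense[OF q dense]])
    from min_elt_minimal[OF qQ this] show "specialization_of P Pm p q"
      using specialization_ofI[OF p q] by (auto simp: \<phi>p)
    from max_elt_maximal[OF qQ] show "specialization_of P Pm q r"
      using specialization_ofI[OF q r] by (auto simp: \<phi>r)
  qed
  ultimately show ?thesis using p r by blast
qed

end

text \<open>In degree 0 the functor sends the zero endomorphism to the identity. The zero
  endomorphism factors through the zero space, whose image is zero by purity.\<close>

lemma degree_zero_trivial:
  assumes PF: "polynomial_functor P Pm" and hom: "homogeneous_functor 0 P Pm" and pure: "pure_functor P"
  shows "carrier (P (K_pow n :: ('a::field, 'a vec) module)) = {\<zero>\<^bsub>P (K_pow n)\<^esub>}"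
proof -
  interpret polynomial_functor P Pm by (rule PF)
  let ?U = "K_pow n :: ('a, 'a vec) module" and ?O = "K_pow 0 :: ('a, 'a vec) module"
  let ?z = "\<lambda>_ _. 0 :: 'a"
  have "carrier ?O = {\<zero>\<^bsub>?O\<^esub>}" by (auto simp: module_vec_simps)
  then have O: "carrier (P ?O) = {\<zero>\<^bsub>P ?O\<^esub>}" using pure fd_space_K_pow unfolding pure_functor_def by blast
  have "(\<lambda>v\<in>carrier ?U. (0::'a) \<odot>\<^bsub>?U\<^esub> v) = compose (carrier ?U) (block ?z n 0) (block ?z 0 n)"
    unfolding block_compose
    by (auto simp: block_def carrier_K_pow module_vec_simps mmul_def scalar_prod_def intro!: restrict_ext eq_vecI)
  then have "Pm ?U ?U (\<lambda>v\<in>carrier ?U. (0::'a) \<odot>\<^bsub>?U\<^esub> v) =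
      compose (carrier (P ?U)) (Pm ?O ?U (block ?z n 0)) (Pm ?U ?O (block ?z 0 n))"
    using mor_comp[OF fd_space_K_pow fd_space_K_pow fd_space_K_pow block_Hom block_Hom] by simp
  \<comment> \<open>Homogeneity for the scalar 0, with the convention 0^0 = 1.\<close>
  moreover have "Pm ?U ?U (\<lambda>v\<in>carrier ?U. (0::'a) \<odot>\<^bsub>?U\<^esub> v) = (\<lambda>w\<in>carrier (P ?U). 1 \<odot>\<^bsub>P ?U\<^esub> w)"
    using hom fd_space_K_pow unfolding homogeneous_functor_def by force
  ultimately have "(\<lambda>w\<in>carrier (P ?U). 1 \<odot>\<^bsub>P ?U\<^esub> w) =
      compose (carrier (P ?U)) (Pm ?O ?U (block ?z n 0)) (Pm ?U ?O (block ?z 0 n))" by (simp only:)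
  note eq' = fun_cong[OF this]
  have eq: "1 \<odot>\<^bsub>P ?U\<^esub> w = Pm ?O ?U (block ?z n 0) (Pm ?U ?O (block ?z 0 n) w)"
    if "w \<in> carrier (P ?U)" for w
    using eq'[of w] that by (simp add: compose_eq)
  have fd: "fd_space (P ?U)" by (rule obj[OF fd_space_K_pow])
  have const: "w = Pm ?O ?U (block ?z n 0) \<zero>\<^bsub>P ?O\<^esub>" if w: "w \<in> carrier (P ?U)" for w
  proof -
    have "Pm ?U ?O (block ?z 0 n) w \<in> carrier (P ?O)"
      using mor[OF fd_space_K_pow fd_space_K_pow block_Hom, of n 0 ?z] w by (auto simp: Hom_iff)
    then show ?thesis using eq[OF w] fd_space_closed(3)[OF fd w] O by simp
  qed
  have "w \<in> {\<zero>\<^bsub>P ?U\<^esub>}" if w: "w \<in> carrier (P ?U)" for w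
    unfolding singleton_iff by (rule trans[OF const[OF w] const[OF fd_space_closed(4)[OF fd], symmetric]])
  then have "carrier (P ?U) \<subseteq> {\<zero>\<^bsub>P ?U\<^esub>}" by (rule subsetI)
  moreover have "{\<zero>\<^bsub>P ?U\<^esub>} \<subseteq> carrier (P ?U)" using fd_space_closed(4)[OF fd] by simp
  ultimately show ?thesis by (rule equalityI)
qed

theorem mainTheorem2:
  fixes P :: "('a::{alg_closed_field, field_char_0}, 'a vec) module \<Rightarrow> ('a, 'w) module"
    and Pm :: "('a, 'a vec) module \<Rightarrow> ('a, 'a vec) module \<Rightarrow> ('a vec \<Rightarrow> 'a vec) \<Rightarrow> 'w \<Rightarrow> 'w"
  assumes "polynomial_functor P Pm"
    and "\<exists>d. homogeneous_functor d P Pm"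
    and "pure_functor P"
  shows "\<exists>p\<in>P_inf P Pm. \<exists>r\<in>P_inf P Pm.
    dense_orbit P Pm p \<and> dense_orbit P Pm r \<and>
    (\<forall>q\<in>P_inf P Pm. dense_orbit P Pm q \<longrightarrow>
      specialization_of P Pm p q \<and> specialization_of P Pm q r)"
proof -
  interpret polynomial_functor P Pm by (rule assms(1))
  obtain d where d: "homogeneous_functor d P Pm" using assms(2) by blast
  show ?thesis
  proof (cases "d = 0")
    case False
    have "\<forall>n. \<exists>x. coordinates (P (K_pow n)) (fst x) (snd x)"
      using coordinates_exist[OF obj[OF fd_space_K_pow]] by (metis fst_conv snd_conv)
    from choice[OF this] obtain x where "\<And>n. coordinates (P (K_pow n)) (fst (x n)) (snd (x n))" by blast
    then interpret coordinatised_functor P Pm d "\<lambda>n. fst (x n)" "\<lambda>n. snd (x n)"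
      by unfold_locales (use d False in auto)
    show ?thesis by (rule minimal_and_maximal_dense_orbits)
  next
    case True
    \<comment> \<open>In degree 0 every level is zero, so the inverse limit is this single
      point.\<close>
    define p where "p = (\<lambda>n. \<zero>\<^bsub>P (K_pow n)\<^esub>)"
    have C: "carrier (P (K_pow n)) = {p n}" for n
      unfolding p_def using degree_zero_trivial[OF assms(1) _ assms(3)] d True by simp
    have "Pm (K_pow (Suc n)) (K_pow n) (forget_last n) (p (Suc n)) \<in> carrier (P (K_pow n))" for n
      using mor[OF fd_space_K_pow fd_space_K_pow block_Hom] C
      unfolding forget_last_eq_block Hom_iff by blast
    then have P_inf: "P_inf P Pm = {p}"
      using C by (auto simp: P_inf_def fun_eq_iff)
    have I: "(\<lambda>i j. if i = j then 1 else 0) \<in> (GL_inf :: (nat \<Rightarrow> nat \<Rightarrow> 'a) set)"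
      unfolding GL_inf_def by (intro CollectI exI[of _ 0] bexI[of _ "1\<^sub>m 0"])
        (auto simp: invertible_mat_def inverts_mat_def intro!: exI[of _ "1\<^sub>m 0"])
    have act: "P_act P Pm g p = p" if "g \<in> row_finite_matrices" for g
    proof -
      have "P_act P Pm g p \<in> P_inf P Pm"
        by (rule P_act_in_P_inf[OF assms(1) _ that]) (simp add: P_inf)
      then show ?thesis by (simp add: P_inf)
    qed
    have actGL: "P_act P Pm g p = p" if "g \<in> GL_inf" for g
      by (rule act[OF set_mp[OF GL_inf_row_finite that]])
    have "GL_orbit P Pm p = {p}"
      unfolding GL_orbit_def using I by (auto simp: actGL intro!: exI[of _ "\<lambda>i j. if i = j then 1 else 0"])
    moreover have "P_inf_topology P Pm closure_of {p} = {p}"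
      using closure_of_subset[of "{p}" "P_inf_topology P Pm"] closure_of_subset_topspace[of "P_inf_topology P Pm" "{p}"]
      by (auto simp: topspace_P_inf_topology P_inf)
    ultimately have "dense_orbit P Pm p" by (simp add: dense_orbit_def P_inf)
    moreover have "specialization_of P Pm p p"
      unfolding specialization_of_def using act[OF set_mp[OF GL_inf_row_finite I]] set_mp[OF GL_inf_row_finite I]
      by (intro bexI[of _ "\<lambda>i j. if i = j then 1 else 0"]) simp_all
    ultimately show ?thesis by (simp add: P_inf)
  qed
qed

end
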